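(* Let $G$ be a strongly connected signed digraph on the vertex set $[n]=\{1,\dots,n\}$ without positive cycles. Then exactly one of the following holds (at least one holds): (i) $G$ is a cycle and no Boolean network on $G$ is synchronizing; or (ii) every and-or-net on $G$ has a synchronizing word of length at most $10(\sqrt{5}+1)^n$.
   Context: A signed digraph $G$ on a finite vertex set $V$ is a pair $(V,E)$ with $E\subseteq V\times V\times\{-1,1\}$; $(j,i,s)\in E$ is an arc from $j$ to $i$ of sign $s$ (loops are allowed, and both a positive and a negative arc from $j$ to $i$ may be present). Cycles are regarded as subgraphs without repeated vertices (a loop is a cycle of length one); the sign of a cycle is the product of the signs of its arcs. Graph notions not involving signs (strong connectivity, cycles as unsigned objects) refer to the underlying digraph. "$G$ is a cycle" means $G$ itself (as a graph) is a single cycle. A Boolean network (BN) with component set $V$ is a map $f:\{0,1\}^V\to\{0,1\}^V$, with $f_i(x)=f(x)_i$. Its signed interaction digraph has vertex set $V$ and a positive (resp. negative) arc from $j$ to $i$ iff there is $x$ with $x_j=0$ such that $f_i(x+e_j)-f_i(x)$ is positive (resp. negative), where $x+e_j$ is $x$ with component $j$ flipped. A BN on $G$ is a BN whose signed interaction digraph is $G$. A BN $f$ on $G$ is an and-or-net if for each $i$ either $f_i$ is a conjunction ($f_i(x)=1$ iff $x_j=1$ for every positive in-neighbor $j$ of $i$ and $x_j=0$ for every negative in-neighbor $j$ of $i$) or a disjunction ($f_i(x)=0$ iff $x_j=0$ for every positive in-neighbor $j$ and $x_j=1$ for every negative in-neighbor $j$). For $i\in V$, $f^i(x)$ is obtained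 from $x$ by replacing $x_i$ by $f_i(x)$. For a word $w=i_1\cdots i_\ell$ over $V$, $f^w=f^{i_\ell}\circ\cdots\circ f^{i_1}$ ($f^\epsilon$ is the identity). A word $w$ is synchronizing for $f$ if $f^w$ is constant; $f$ is synchronizing if it has a synchronizing word. *)

theory Defs
  imports Complex_Main
begin

text \<open>Signed digraphs on the vertex set UNIV of a finite type 'v (playing the role of [n],
  n = CARD('v)). An arc (j, i, s) goes from j to i with sign s.\<close>
type_synonym 'v sdigraph = "('v \<times> 'v \<times> int) set"

definition signed_digraph :: "'v sdigraph \<Rightarrow> bool" where
  "signed_digraph E \<longleftrightarrow> (\<forall>(j, i, s) \<in> E. s = 1 \<or> s = -1)"

definition underlying :: "'v sdigraph \<Rightarrow> ('v \<times> 'v) set" where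
  "underlying E = {(j, i). \<exists>s. (j, i, s) \<in> E}"

definition strongly_connected :: "'v sdigraph \<Rightarrow> bool" where
  "strongly_connected E \<longleftrightarrow> (\<forall>u v. (u, v) \<in> (underlying E)\<^sup>*)"

text \<open>A cycle of length k \<ge> 1: distinct vertices vs 0, ..., vs (k-1) together with chosen arcs
  (vs t, vs ((t+1) mod k), ss t) of G.\<close>
definition is_cycle_in :: "'v sdigraph \<Rightarrow> nat \<Rightarrow> (nat \<Rightarrow> 'v) \<Rightarrow> (nat \<Rightarrow> int) \<Rightarrow> bool" where
  "is_cycle_in E k vs ss \<longleftrightarrow> k \<ge> 1 \<and> inj_on vs {..<k} \<and>
     (\<forall>t<k. (vs t, vs ((t + 1) mod k), ss t) \<in> E)"

definition has_positive_cycle :: "'v sdigraph \<Rightarrow> bool" where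
  "has_positive_cycle E \<longleftrightarrow>
     (\<exists>k vs ss. is_cycle_in E k vs ss \<and> (\<Prod>t<k. ss t) = 1)"

text \<open>G itself is a cycle: its vertex set and arc set are exactly those of one cycle.\<close>
definition is_cycle_graph :: "'v sdigraph \<Rightarrow> bool" where
  "is_cycle_graph E \<longleftrightarrow>
     (\<exists>k vs ss. is_cycle_in E k vs ss \<and> vs ` {..<k} = UNIV \<and>
        E = {(vs t, vs ((t + 1) mod k), ss t) | t. t < k})"

text \<open>Boolean networks; states are 'v \<Rightarrow> bool (True = 1, False = 0).\<close>
type_synonym 'v bn = "('v \<Rightarrow> bool) \<Rightarrow> ('v \<Rightarrow> bool)"

definition interaction_graph :: "'v bn \<Rightarrow> 'v sdigraph" where
  "interaction_graph f =
     {(j, i, s). \<exists>x. \<not> x j \<and>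
        ((s = 1 \<and> \<not> f x i \<and> f (x(j := True)) i) \<or>
         (s = -1 \<and> f x i \<and> \<not> f (x(j := True)) i))}"

definition bn_on :: "'v sdigraph \<Rightarrow> 'v bn \<Rightarrow> bool" where
  "bn_on E f \<longleftrightarrow> interaction_graph f = E"

definition and_or_net :: "'v sdigraph \<Rightarrow> 'v bn \<Rightarrow> bool" where
  "and_or_net E f \<longleftrightarrow> bn_on E f \<and>
     (\<forall>i. (\<forall>x. f x i \<longleftrightarrow> (\<forall>j. ((j, i, 1) \<in> E \<longrightarrow> x j) \<and> ((j, i, -1) \<in> E \<longrightarrow> \<not> x j)))
        \<or> (\<forall>x. \<not> f x i \<longleftrightarrow> (\<forall>j. ((j, i, 1) \<in> E \<longrightarrow> \<not> x j) \<and> ((j, i, -1) \<in> E \<longrightarrow> x j))))"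

text \<open>Asynchronous update of component i, and f^w for a word w (first letter applied first).\<close>
definition upd :: "'v bn \<Rightarrow> 'v \<Rightarrow> ('v \<Rightarrow> bool) \<Rightarrow> ('v \<Rightarrow> bool)" where
  "upd f i x = x(i := f x i)"

fun run :: "'v bn \<Rightarrow> 'v list \<Rightarrow> ('v \<Rightarrow> bool) \<Rightarrow> ('v \<Rightarrow> bool)" where
  "run f [] x = x"
| "run f (i # w) x = run f w (upd f i x)"

definition synchronizing_word :: "'v bn \<Rightarrow> 'v list \<Rightarrow> bool" where
  "synchronizing_word f w \<longleftrightarrow> (\<exists>c. \<forall>x. run f w x = c)"

definition synchronizing :: "'v bn \<Rightarrow> bool" where
  "synchronizing f \<longleftrightarrow> (\<exists>w. synchronizing_word f w)"

end

theory Submission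
  imports Defs
begin

text \<open>Complementing the states of the disjunctive vertices turns the net into a conjunctive one, and the
  absence of positive cycles says that for every nonempty vertex set \<open>D\<close> and every state some vertex of
  \<open>D\<close> has no input in \<open>D\<close> coherent with its own value.

  Let two states differ on \<open>D\<close>. If \<open>D\<close> induces an acyclic subgraph, updating \<open>D\<close> in topological order
  merges them. Otherwise the size of a minimum feedback vertex set of \<open>D\<close> can be lowered at the cost of
  \<open>flip_cost (n - 1) + O(n)\<close> updates: unless it drops at once, the feedback vertices can be placed on
  disjoint cycles that oscillate in isolation. Since the graph is strongly connected and is not a
  cycle, some vertex outside \<open>D\<close> feeds one of these cycles, and it can be made to flip; turning twice
  around that cycle then makes its feedback vertex superfluous. Flipping a prescribed vertex obeys a
  Fibonacci recursion, hence the golden ratio \<open>(sqrt 5 + 1) / 2\<close> in the bound. If the image of the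
  word found so far has more than \<open>2 ^ (n - m)\<close> states, two of them differ in at most \<open>m\<close> places;
  merging such pairs halves the image once for every \<open>m = 1, ..., n\<close>, each time with half as many
  merges as before.

  On a cycle every update commutes with complementing all values, so nothing synchronizes.\<close>

section \<open>Conjunctive nets without coherent vertex sets\<close>

text \<open>An input is coherent when its literal at \<open>v\<close> equals the value of
  \<open>v\<close>. Two facts carry the argument. In every state some vertex has no coherent input,
  and if every vertex has an input, such a vertex is about to change. And if a conjunctive vertex
  has different images in two states, its literals on common inputs are true, while those on
  differing inputs are all true in one state and all false in the other; exchanging the two states
  on some but not all of these inputs makes both images False.

  The obstacle is that an update may enlarge the difference set, so its size measures no progress.
  The feedback number does: a new vertex all of whose arcs inside the difference set are coherent
  closes no cycle there, since coherent arcs form none. What remains delicate is the vertex that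
  strikes an oscillating cycle: it may flip in one state only, and a negative loop at it is never
  coherent, so it must then leave the difference set again.

  The factor 10 comes from bounding \<open>2 * flip_cost (n - 1) + 13 * n - 6\<close> by a multiple
  of the \<open>n\<close>-th power of the golden ratio.\<close>

lemma run_append: "run f (u @ w) x = run f w (run f u x)"
  by (induction u arbitrary: x) auto

lemma run_other: "i \<notin> set w \<Longrightarrow> run f w x i = x i"
  by (induction w arbitrary: x) (auto simp: upd_def)

lemma crossing_arc:
  assumes "(a, b) \<in> r\<^sup>*" "a \<notin> A" "b \<in> A"
  shows "\<exists>u v. (u, v) \<in> r \<and> u \<notin> A \<and> v \<in> A"
  using assms by (induction rule: rtrancl_induct) auto

definition initial_in :: "('v \<times> 'v) set \<Rightarrow> 'v set \<Rightarrow> 'v set \<Rightarrow> bool" where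
  "initial_in E U H \<longleftrightarrow> H \<noteq> {} \<and> H \<subseteq> U \<and> (\<forall>u\<in>U. \<forall>v\<in>H. (u, v) \<in> E \<longrightarrow> u \<in> H)"

text \<open>A smallest nonempty subset of \<open>U\<close> closed under predecessors in
  \<open>U\<close> is strongly connected: the part of it from which a given vertex can be reached
  inside it is again closed.\<close>

lemma initial_component:
  assumes "finite U" "U \<noteq> {}"
  shows "\<exists>H. initial_in E U H \<and> (\<forall>u\<in>H. \<forall>v\<in>H. (u, v) \<in> (E \<inter> H \<times> H)\<^sup>*)"
proof -
  have "initial_in E U U" using assms by (auto simp: initial_in_def)
  then obtain H where H: "initial_in E U H" and min: "\<And>H'. initial_in E U H' \<Longrightarrow> card H \<le> card H'"
    using ex_has_least_nat[of "initial_in E U" U card] by blast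
  have finH: "finite H" using H assms(1) by (auto simp: initial_in_def intro: finite_subset)
  have "(u, v) \<in> (E \<inter> H \<times> H)\<^sup>*" if "u \<in> H" "v \<in> H" for u v
  proof -
    let ?A = "{w \<in> H. (w, v) \<in> (E \<inter> H \<times> H)\<^sup>*}"
    have "initial_in E U ?A"
      using H that unfolding initial_in_def by (auto intro: converse_rtrancl_into_rtrancl)
    then have "card H \<le> card ?A" by (rule min)
    then have "?A = H" using finH by (intro card_seteq) auto
    then show ?thesis using that by blast
  qed
  with H show ?thesis by blast
qed

text \<open>Every subset has a source, and a sink is obtained by removing sources: nothing in
  \<open>P\<close> points to the source \<open>s\<close>, so a sink of \<open>P - {s}\<close> is one
  of \<open>P\<close>.\<close>

lemma sink_exists:
  assumes "finite P" "P \<noteq> {}"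
    and "\<And>Z. Z \<subseteq> P \<Longrightarrow> Z \<noteq> {} \<Longrightarrow> \<exists>v\<in>Z. \<forall>u\<in>Z. \<not> R u v"
  shows "\<exists>w\<in>P. \<forall>v\<in>P. \<not> R w v"
  using assms
proof (induction "card P" arbitrary: P)
  case 0
  then show ?case by simp
next
  case (Suc k)
  obtain s where s: "s \<in> P" "\<forall>u\<in>P. \<not> R u s" using Suc.prems by blast
  show ?case
  proof (cases "P - {s} = {}")
    case True
    then show ?thesis using s by auto
  next
    case False
    have "card (P - {s}) = k" using Suc.hyps s Suc.prems by simp
    moreover have "\<exists>v\<in>Z. \<forall>u\<in>Z. \<not> R u v" if "Z \<subseteq> P - {s}" "Z \<noteq> {}" for Z
      using Suc.prems(3)[of Z] that by blast
    ultimately obtain w where "w \<in> P - {s}" "\<forall>v\<in>P - {s}. \<not> R w v"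
      using Suc.hyps(1)[of "P - {s}"] False Suc.prems(1) by blast
    then show ?thesis using s by auto
  qed
qed

text \<open>\<open>flip_cost k + 2\<close> runs through 2, 3, 5, 8, ...; the summand 2 of the
  recursion pays for the updates of a flipped vertex and of one vertex that it forces.\<close>

fun flip_cost :: "nat \<Rightarrow> nat" where
  "flip_cost 0 = 0"
| "flip_cost (Suc 0) = 1"
| "flip_cost (Suc (Suc n)) = flip_cost (Suc n) + flip_cost n + 2"

lemma flip_cost_Suc: "flip_cost n + 1 \<le> flip_cost (Suc n)"
  by (induction n rule: flip_cost.induct) auto

lemma flip_cost_diff: "flip_cost (k - m) + m \<le> flip_cost k" if "m \<le> k"
  using that
proof (induction m)
  case (Suc m)
  have "flip_cost (k - Suc m) + 1 \<le> flip_cost (k - m)"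
    using flip_cost_Suc[of "k - Suc m"] Suc.prems by (simp add: Suc_diff_Suc)
  then show ?case using Suc by simp
qed simp

lemma flip_cost_mono: "m \<le> n \<Longrightarrow> flip_cost m \<le> flip_cost n"
  using flip_cost_diff[of "n - m" n] by simp

lemma flip_cost_rec: "2 \<le> k \<Longrightarrow> flip_cost k = flip_cost (k - 1) + flip_cost (k - 2) + 2"
  by (cases k rule: flip_cost.cases) auto

text \<open>\<open>q u v\<close> is the value of \<open>u\<close> that \<open>v\<close> asks for, so
  the arc is positive iff \<open>q u v\<close>. The assumption is the absence of positive cycles in
  state form: if each vertex of \<open>D\<close> had a coherent input in \<open>D\<close>, going
  back along these would close a coherent, hence positive, cycle.\<close>

locale and_net =
  fixes E :: "('v::finite \<times> 'v) set" and q :: "'v \<Rightarrow> 'v \<Rightarrow> bool"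
  assumes no_coherent:
    "D \<noteq> {} \<Longrightarrow> \<exists>v\<in>D. \<forall>u\<in>D. (u, v) \<in> E \<longrightarrow> (t u = q u v) \<noteq> t v"
begin

definition net :: "'v bn" where
  "net x i \<longleftrightarrow> (\<forall>j. (j, i) \<in> E \<longrightarrow> x j = q j i)"

abbreviation lit :: "('v \<Rightarrow> bool) \<Rightarrow> 'v \<Rightarrow> 'v \<Rightarrow> bool" where
  "lit x u v \<equiv> x u = q u v"

definition coh :: "('v \<Rightarrow> bool) \<Rightarrow> 'v \<Rightarrow> 'v \<Rightarrow> bool" where
  "coh x u v \<longleftrightarrow> (u, v) \<in> E \<and> lit x u v = x v"

lemma no_coherent_set: "D \<noteq> {} \<Longrightarrow> \<exists>v\<in>D. \<forall>u\<in>D. \<not> coh x u v"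
  using no_coherent[of D x] unfolding coh_def by blast

lemma netD: "net x v \<Longrightarrow> (u, v) \<in> E \<Longrightarrow> lit x u v"
  unfolding net_def by blast

lemma not_netD: "\<not> net x v \<Longrightarrow> \<exists>u. (u, v) \<in> E \<and> \<not> lit x u v"
  unfolding net_def by blast

lemma net_cong: "(\<And>u. (u, v) \<in> E \<Longrightarrow> x u = y u) \<Longrightarrow> net x v = net y v"
  unfolding net_def by auto

text \<open>Setting the vertices of \<open>U\<close> one after the other to values that are coherent with earlier ones.
  A vertex that is not forced by an already settled one lies downstream of an initial component of
  the rest; an entry of that component is switched by applying the same procedure inside the
  component. Either the old or the new value of this entry forces a further vertex, which gives a
  Fibonacci recursion for the length.\<close>

lemma coherent_completion:
  assumes "U \<subset> H"
    and "\<And>u v. u \<in> H \<Longrightarrow> v \<in> H \<Longrightarrow> (u, v) \<in> (E \<inter> H \<times> H)\<^sup>*"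
    and "\<And>v. v \<in> H \<Longrightarrow> \<exists>u\<in>H. (u, v) \<in> E"
    and "\<And>u v. (u, v) \<in> E \<Longrightarrow> v \<in> H \<Longrightarrow> u \<notin> H \<Longrightarrow> lit x u v"
  shows "\<exists>w. set w \<subseteq> U \<and> length w \<le> flip_cost (card U) \<and>
           (\<forall>v\<in>U. \<exists>u\<in>H. coh (run net w x) u v)"
  using assms
proof (induction "card U" arbitrary: U H x rule: less_induct)
  case less
  note strong = less.prems(2) and inp = less.prems(3) and out = less.prems(4)
  have UH: "U \<subseteq> H" using less.prems(1) by blast
  \<comment> \<open>Once \<open>A\<close> is supported from \<open>H - (U - A)\<close>, the
    recursive call on \<open>U - A\<close> touches neither \<open>A\<close> nor its
    supports.\<close>
  have extend: "\<exists>w. set w \<subseteq> U \<and> length w \<le> length w0 + flip_cost (card (U - A)) \<and>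
           (\<forall>v\<in>U. \<exists>u\<in>H. coh (run net w x) u v)"
    if A: "A \<subseteq> U" "A \<noteq> {}" and w0: "set w0 \<subseteq> U"
      and cohA: "\<forall>v\<in>A. \<exists>u\<in>H - (U - A). coh (run net w0 x) u v" for A w0
  proof -
    let ?x = "run net w0 x"
    have c: "card (U - A) < card U" using A by (intro psubset_card_mono) auto
    have sub: "U - A \<subset> H" using less.prems(1) by blast
    have out1: "lit ?x u v" if "(u, v) \<in> E" "v \<in> H" "u \<notin> H" for u v
      using out[OF that] run_other[of u w0 net x] w0 UH that(3) by auto
    have "\<exists>w. set w \<subseteq> U - A \<and> length w \<le> flip_cost (card (U - A)) \<and>
        (\<forall>v\<in>U - A. \<exists>u\<in>H. coh (run net w ?x) u v)"
      by (rule less.hyps[OF c sub strong inp out1])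
    then obtain w1 where w1: "set w1 \<subseteq> U - A" "length w1 \<le> flip_cost (card (U - A))"
        "\<forall>v\<in>U - A. \<exists>u\<in>H. coh (run net w1 ?x) u v" by blast
    have "\<exists>u\<in>H. coh (run net w1 ?x) u v" if "v \<in> A" for v
    proof -
      from bspec[OF cohA that] obtain u where u: "u \<in> H - (U - A)" "coh ?x u v"
        by (rule bexE)
      have "run net w1 ?x u = ?x u" "run net w1 ?x v = ?x v"
        using w1(1) u(1) that by (auto intro!: run_other)
      then show ?thesis using u unfolding coh_def by auto
    qed
    then show ?thesis using w1 w0
      by (intro exI[of _ "w0 @ w1"]) (auto simp: run_append)
  qed
  have cardpos: "card (U - {v}) = card U - 1" if "v \<in> U" for v using that by simp
  show ?case
  proof (cases "U = {}")
    case True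
    then show ?thesis by (intro exI[of _ "[]"]) auto
  next
    case False
    show ?thesis
    proof (cases "\<exists>v\<in>U. (\<exists>u\<in>H - U. (u, v) \<in> E \<and> \<not> lit x u v) \<or> (\<forall>u\<in>U. (u, v) \<notin> E)")
      case True
      then obtain v where v: "v \<in> U"
        "(\<exists>u\<in>H - U. (u, v) \<in> E \<and> \<not> lit x u v) \<or> (\<forall>u\<in>U. (u, v) \<notin> E)" by blast
      \<comment> \<open>Updating \<open>v\<close> makes it coherent with a settled vertex: with one
        that blocks it if its image is False, and with any input if all its literals are true and
        none of its inputs is unsettled.\<close>
      have "\<exists>u\<in>H - U. (u, v) \<in> E \<and> lit x u v = net x v"
      proof (cases "net x v")
        case True
        with v have "\<forall>u\<in>U. (u, v) \<notin> E" using netD by blast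
        then show ?thesis using True inp[of v] v UH netD by blast
      next
        case False
        then obtain u where "(u, v) \<in> E" "\<not> lit x u v" using not_netD by blast
        then show ?thesis using v False out[of u v] UH by blast
      qed
      then obtain u where u: "u \<in> H - U" "(u, v) \<in> E" "lit x u v = net x v" by blast
      then have "coh (run net [v] x) u v" using v(1) by (auto simp: coh_def upd_def)
      then obtain w where w: "set w \<subseteq> U" "length w \<le> length [v] + flip_cost (card (U - {v}))"
           "\<forall>v\<in>U. \<exists>u\<in>H. coh (run net w x) u v"
        using extend[of "{v}" "[v]"] u v by auto
      have "length w \<le> flip_cost (card U)"
        using w(2) flip_cost_Suc[of "card U - 1"] cardpos[OF v(1)] v(1) False by (simp add: card_gt_0_iff)
      with w show ?thesis by blast
    next
      case free: False
      then have lit1: "\<And>u v. v \<in> U \<Longrightarrow> u \<in> H - U \<Longrightarrow> (u, v) \<in> E \<Longrightarrow> lit x u v"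
        and Uinp: "\<And>v. v \<in> U \<Longrightarrow> \<exists>u\<in>U. (u, v) \<in> E" by blast+
      obtain H' where H': "initial_in E U H'"
        and strong': "\<And>u v. u \<in> H' \<Longrightarrow> v \<in> H' \<Longrightarrow> (u, v) \<in> (E \<inter> H' \<times> H')\<^sup>*"
        using initial_component[of U E] False by auto
      have H'U: "H' \<subseteq> U" "H' \<noteq> {}" and closed: "\<And>u v. u \<in> U \<Longrightarrow> v \<in> H' \<Longrightarrow> (u, v) \<in> E \<Longrightarrow> u \<in> H'"
        using H' unfolding initial_in_def by auto
      have inp': "\<exists>u\<in>H'. (u, v) \<in> E" if "v \<in> H'" for v
        using Uinp[of v] closed that H'U by blast
      have out': "lit x u v" if "(u, v) \<in> E" "v \<in> H'" "u \<notin> H'" for u v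
        using that closed[of u v] lit1[of v u] out[of u v] H'U UH by blast
      obtain a0 h0 where "a0 \<in> H" "a0 \<notin> H'" "h0 \<in> H'"
        using less.prems(1) H'U by blast
      then obtain a v where av: "(a, v) \<in> E" "a \<in> H" "a \<notin> H'" "v \<in> H'"
        using crossing_arc[OF strong[of a0 h0], of H'] H'U UH by blast
      have aU: "a \<in> H - U" using av closed[of a v] by blast
      have vU: "v \<in> U" using av H'U by blast
      have lita: "lit x a v" using lit1[OF vU aU av(1)] .
      show ?thesis
      proof (cases "x v")
        case True
        then have "coh (run net [] x) a v" using lita av by (simp add: coh_def)
        then obtain w where w: "set w \<subseteq> U" "length w \<le> length ([]::'v list) + flip_cost (card (U - {v}))"
             "\<forall>v\<in>U. \<exists>u\<in>H. coh (run net w x) u v"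
          using extend[of "{v}" "[]"] aU vU by auto
        have "length w \<le> flip_cost (card U)"
          using w(2) flip_cost_mono[of "card (U - {v})" "card U"] by (simp add: card_mono)
        with w show ?thesis by blast
      next
        case xv: False
        \<comment> \<open>If all other vertices of \<open>H'\<close> have a coherent input in
          \<open>H'\<close>, the vertex without one must be \<open>v\<close>. As \<open>v\<close> is
          False, all its literals are true, and the update makes it True, coherent with
          \<open>a\<close>.\<close>
        have flip: "run net (w0 @ [v]) x v"
          if w0: "set w0 \<subseteq> H' - {v}" and c: "\<forall>h\<in>H' - {v}. \<exists>u\<in>H'. coh (run net w0 x) u h" for w0
        proof -
          let ?x = "run net w0 x"
          have xv': "\<not> ?x v" using run_other[of v w0 net x] w0 xv by auto
          have "\<forall>u\<in>H'. \<not> coh ?x u v" using no_coherent_set[of H' ?x] H'U c by auto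
          moreover have "lit ?x u v" if "(u, v) \<in> E" "u \<notin> H'" for u
            using out'[of u v] that av run_other[of u w0 net x] w0 by auto
          ultimately have "lit ?x u v" if "(u, v) \<in> E" for u
            using that xv' by (cases "u \<in> H'") (auto simp: coh_def)
          then have "net ?x v" using not_netD by blast
          then show ?thesis by (simp add: run_append upd_def)
        qed
        have cohv: "coh (run net w x) a v"
          if "set w \<subseteq> U" "run net w x v" for w
          using that lita av aU run_other[of a w net x] by (auto simp: coh_def)
        have cardH': "card (H' - {v}) \<le> card U - 1" using H'U av
          by (metis card_Diff_singleton card_mono diff_le_mono finite)
        show ?thesis
        proof (cases "\<exists>h\<in>H' - {v}. (v, h) \<in> E \<and> q v h")
          case True
          then obtain h where h: "h \<in> H'" "h \<noteq> v" "(v, h) \<in> E" "q v h" by blast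
          \<comment> \<open>The old value False of \<open>v\<close> blocks \<open>h\<close>.
            Updating \<open>h\<close> thus settles it at once, and at most \<open>card U - 2\<close>
            vertices are left for the call that prepares the flip of \<open>v\<close>.\<close>
          let ?x = "upd net h x"
          have nh: "\<not> net x h" using h xv netD by blast
          have k2: "card {v, h} \<le> card U" using h av H'U by (intro card_mono) auto
          then have k2: "2 \<le> card U" using h(2) by auto
          have c2: "card (H' - {v} - {h}) \<le> card U - 2"
          proof -
            have "card (H' - {v} - {h}) = card H' - 2" using h av by simp
            then show ?thesis using card_mono[of U H'] H'U by simp
          qed
          then have c3: "card (H' - {v} - {h}) < card U" using k2 by simp
          have sub1: "H' - {v} - {h} \<subset> H'" using av by blast
          have out1: "lit ?x u v" if "(u, v) \<in> E" "v \<in> H'" "u \<notin> H'" for u v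
            using out'[OF that] h that by (auto simp: upd_def)
          have "\<exists>w1. set w1 \<subseteq> H' - {v} - {h} \<and>
              length w1 \<le> flip_cost (card (H' - {v} - {h})) \<and>
              (\<forall>g\<in>H' - {v} - {h}. \<exists>u\<in>H'. coh (run net w1 ?x) u g)"
            by (rule less.hyps[OF c3 sub1 strong' inp' out1])
          then obtain w1 where w1: "set w1 \<subseteq> H' - {v} - {h}"
              "length w1 \<le> flip_cost (card (H' - {v} - {h}))"
              "\<forall>g\<in>H' - {v} - {h}. \<exists>u\<in>H'. coh (run net w1 ?x) u g" by blast
          have "run net w1 ?x v = x v" "run net w1 ?x h = False"
            using w1(1) nh h(2) run_other[of v w1 net ?x] run_other[of h w1 net ?x]
            by (auto simp: upd_def)
          then have "coh (run net w1 ?x) v h" using h xv by (simp add: coh_def)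
          then have "\<forall>g\<in>H' - {v}. \<exists>u\<in>H'. coh (run net (h # w1) x) u g"
            using w1(3) av h by auto
          moreover have "set (h # w1) \<subseteq> H' - {v}" using w1(1) h by auto
          ultimately have fl: "run net ((h # w1) @ [v]) x v" by (intro flip)
          have sub: "set ((h # w1) @ [v]) \<subseteq> U" using w1(1) h H'U vU by auto
          obtain w where w: "set w \<subseteq> U" "length w \<le> length ((h # w1) @ [v]) + flip_cost (card (U - {v}))"
             "\<forall>v\<in>U. \<exists>u\<in>H. coh (run net w x) u v"
            using extend[of "{v}" "(h # w1) @ [v]"] aU vU cohv[OF sub fl] sub by blast
          have "length w \<le> flip_cost (card U - 2) + 2 + flip_cost (card U - 1)"
            using w(2) w1(2) flip_cost_mono[OF c2] cardpos[OF vU] by simp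
          then have "length w \<le> flip_cost (card U)" using flip_cost_rec[OF k2] by simp
          with w show ?thesis by blast
        next
          case noforce: False
          have "0 < card U" using vU by (auto simp: card_gt_0_iff)
          then have c3: "card (H' - {v}) < card U" using cardH' by simp
          have sub1: "H' - {v} \<subset> H'" using av by blast
          have "\<exists>w1. set w1 \<subseteq> H' - {v} \<and>
              length w1 \<le> flip_cost (card (H' - {v})) \<and>
              (\<forall>g\<in>H' - {v}. \<exists>u\<in>H'. coh (run net w1 x) u g)"
            by (rule less.hyps[OF c3 sub1 strong' inp' out'])
          then obtain w1 where w1: "set w1 \<subseteq> H' - {v}"
              "length w1 \<le> flip_cost (card (H' - {v}))"
              "\<forall>g\<in>H' - {v}. \<exists>u\<in>H'. coh (run net w1 x) u g" by blast
          have fl: "run net (w1 @ [v]) x v" using flip w1 by blast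
          have sub: "set (w1 @ [v]) \<subseteq> U" using w1(1) H'U vU by auto
          show ?thesis
          proof (cases "H' = {v}")
            case True
            obtain w where w: "set w \<subseteq> U" "length w \<le> length (w1 @ [v]) + flip_cost (card (U - {v}))"
               "\<forall>v\<in>U. \<exists>u\<in>H. coh (run net w x) u v"
              using extend[of "{v}" "w1 @ [v]"] aU vU cohv[OF sub fl] sub by blast
            have "length w \<le> 1 + flip_cost (card U - 1)"
              using w(2) w1(2) True cardpos[OF vU] by simp
            also have "\<dots> \<le> flip_cost (card U)"
              using flip_cost_Suc[of "card U - 1"] vU by (simp add: card_gt_0_iff False)
            finally show ?thesis using w by blast
          next
            case False
            then obtain g where "g \<in> H'" "g \<noteq> v" using av by blast
            then obtain h where h: "h \<in> H'" "h \<noteq> v" "(v, h) \<in> E"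
            proof -
              have "(v, g) \<in> (E \<inter> H' \<times> H')\<^sup>*" using strong' av \<open>g \<in> H'\<close> by blast
              then obtain u k where "(u, k) \<in> E \<inter> H' \<times> H'" "u \<notin> - {v}" "k \<in> - {v}"
                using crossing_arc[of v g _ "- {v}"] \<open>g \<noteq> v\<close> by blast
              then show ?thesis using that by auto
            qed
            then have nq: "\<not> q v h" using noforce by blast
            have hU: "h \<in> U" using h H'U by blast
            \<comment> \<open>Here it is the new value True of \<open>v\<close> that blocks
              \<open>h\<close>, so the vertex is saved in the call after the flip instead of the one
              before it.\<close>
            let ?x = "run net (w1 @ [v]) x"
            have nh: "\<not> net ?x h" using netD[of ?x h v] h(3) nq fl by blast
            have r1: "run net (w1 @ [v, h]) x v" "\<not> run net (w1 @ [v, h]) x h"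
              using fl nh h(2) by (auto simp: run_append upd_def)
            have sub2: "set (w1 @ [v, h]) \<subseteq> U" using sub hU by auto
            have "coh (run net (w1 @ [v, h]) x) v h" using r1 nq h by (simp add: coh_def)
            moreover have "coh (run net (w1 @ [v, h]) x) a v" using cohv[OF sub2 r1(1)] .
            ultimately have "\<forall>g\<in>{v, h}. \<exists>u\<in>H - (U - {v, h}). coh (run net (w1 @ [v, h]) x) u g"
              using aU vU UH hU by blast
            then obtain w where w: "set w \<subseteq> U" "length w \<le> length (w1 @ [v, h]) + flip_cost (card (U - {v, h}))"
               "\<forall>v\<in>U. \<exists>u\<in>H. coh (run net w x) u v"
              using extend[of "{v, h}" "w1 @ [v, h]"] vU hU sub2 by blast
            have "card {v, h} \<le> card U" using hU vU by (intro card_mono) auto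
            then have k2: "2 \<le> card U" using h(2) by auto
            have "card (U - {v, h}) = card U - 2"
              using card_Diff_subset[of "{v, h}" U] hU vU h(2) by auto
            then have "length w \<le> flip_cost (card U - 1) + 2 + flip_cost (card U - 2)"
              using w(2) w1(2) flip_cost_mono[OF cardH'] by simp
            then have "length w \<le> flip_cost (card U)" using flip_cost_rec[OF k2] by simp
            with w show ?thesis by blast
          qed
        qed
      qed
    qed
  qed
qed

end

section \<open>Feedback vertex sets of the difference of two states\<close>

definition dif :: "('v \<Rightarrow> bool) \<Rightarrow> ('v \<Rightarrow> bool) \<Rightarrow> 'v set" where
  "dif x y = {i. x i \<noteq> y i}"

lemma dif_iff: "i \<in> dif x y \<longleftrightarrow> x i \<noteq> y i"
  by (simp add: dif_def)

lemma dif_upd: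
  "dif (upd f v x) (upd f v y) = (if f x v = f y v then dif x y - {v} else insert v (dif x y))"
proof (rule set_eqI)
  fix i
  show "i \<in> dif (upd f v x) (upd f v y) \<longleftrightarrow>
      i \<in> (if f x v = f y v then dif x y - {v} else insert v (dif x y))"
    by (cases "i = v") (simp_all add: dif_def upd_def)
qed

lemma upd_same [simp]: "upd f v x v = f x v"
  by (simp add: upd_def)

lemma upd_neq [simp]: "i \<noteq> v \<Longrightarrow> upd f v x i = x i"
  by (simp add: upd_def)

context and_net
begin

definition acyclic_on :: "'v set \<Rightarrow> bool" where
  "acyclic_on S \<longleftrightarrow> (\<forall>Z\<subseteq>S. Z \<noteq> {} \<longrightarrow> (\<exists>v\<in>Z. \<forall>u\<in>Z. (u, v) \<notin> E))"

lemma acyclic_on_source: "acyclic_on S \<Longrightarrow> Z \<subseteq> S \<Longrightarrow> Z \<noteq> {} \<Longrightarrow> \<exists>v\<in>Z. \<forall>u\<in>Z. (u, v) \<notin> E"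
  unfolding acyclic_on_def by blast

lemma acyclic_on_subset: "acyclic_on S \<Longrightarrow> T \<subseteq> S \<Longrightarrow> acyclic_on T"
  unfolding acyclic_on_def by (meson order_trans)

text \<open>A set without a source would give each of its vertices a coherent input inside the
  set.\<close>

lemma coherent_acy:
  assumes "\<And>u v. u \<in> S \<Longrightarrow> v \<in> S \<Longrightarrow> (u, v) \<in> E \<Longrightarrow> coh x u v"
  shows "acyclic_on S"
  unfolding acyclic_on_def
proof (intro allI impI)
  fix Z assume Z: "Z \<subseteq> S" "Z \<noteq> {}"
  obtain v where "v \<in> Z" "\<forall>u\<in>Z. \<not> coh x u v" using no_coherent_set[OF Z(2)] by blast
  then show "\<exists>v\<in>Z. \<forall>u\<in>Z. (u, v) \<notin> E" using assms Z(1) by (meson subsetD)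
qed

text \<open>A source of \<open>S\<close> is updated before the rest, so no later update changes its
  inputs. The word does not depend on the state and can be applied to two states at once.\<close>

lemma satisfying_word:
  assumes "acyclic_on S"
  shows "\<exists>w. set w \<subseteq> S \<and> length w = card S \<and> (\<forall>x. \<forall>v\<in>S. net (run net w x) v = run net w x v)"
  using assms
proof (induction "card S" arbitrary: S)
  case 0
  then show ?case by (intro exI[of _ "[]"]) simp
next
  case (Suc k)
  then have "S \<noteq> {}" by auto
  then obtain v where v: "v \<in> S" "\<forall>u\<in>S. (u, v) \<notin> E" using acyclic_on_source[OF Suc.prems, of S] by blast
  have "k = card (S - {v})" using Suc.hyps(2) v(1) by simp
  moreover have "acyclic_on (S - {v})" using Suc.prems by (rule acyclic_on_subset) blast
  ultimately obtain w where w: "set w \<subseteq> S - {v}" "length w = card (S - {v})"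
      "\<forall>x. \<forall>v\<in>S - {v}. net (run net w x) v = run net w x v"
    using Suc.hyps(1) by blast
  have sat: "net (run net w (upd net v x)) v = run net w (upd net v x) v" for x
  proof -
    have "net (run net w (upd net v x)) v = net x v"
    proof (rule net_cong)
      fix u assume "(u, v) \<in> E"
      then have "u \<notin> S" using v by blast
      then have "u \<notin> set w" "u \<noteq> v" using w(1) v(1) by blast+
      then show "run net w (upd net v x) u = x u" by (simp add: run_other)
    qed
    also have "\<dots> = run net w (upd net v x) v"
    proof -
      have "v \<notin> set w" using w(1) by blast
      then show ?thesis by (simp add: run_other)
    qed
    finally show ?thesis .
  qed
  have "\<forall>x. \<forall>u\<in>S. net (run net (v # w) x) u = run net (v # w) x u"
  proof (intro allI ballI)
    fix x u assume "u \<in> S"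
    then show "net (run net (v # w) x) u = run net (v # w) x u"
      using sat w(3) by (cases "u = v") simp_all
  qed
  then show ?case using w v(1) Suc.hyps(2) \<open>k = card (S - {v})\<close>
    by (intro exI[of _ "v # w"]) auto
qed

lemma differ_input:
  assumes "net x v \<noteq> net y v"
  shows "\<exists>u\<in>dif x y. (u, v) \<in> E"
proof (rule ccontr)
  assume "\<not> ?thesis"
  then have "net x v = net y v" by (intro net_cong) (metis dif_iff)
  with assms show False by contradiction
qed

text \<open>One of the two conjunctions is true, so all its literals are. Those on common inputs are
  then true in both states, those on differing inputs false in the other.\<close>

lemma differ_lit:
  assumes "net x v \<noteq> net y v" "(u, v) \<in> E"
  shows "if u \<in> dif x y then lit x u v = net x v else lit x u v"
  using assms netD[of x v u] netD[of y v u] by (auto simp: dif_iff)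

lemma sat_coh:
  assumes "v \<in> dif x y" "net x v = x v" "net y v = y v" "u \<in> dif x y" "(u, v) \<in> E"
  shows "coh x u v"
  using assms differ_lit[of x v y u] by (auto simp: dif_iff coh_def)

lemma sat_acy:
  assumes "S \<subseteq> dif x y" "\<And>v. v \<in> S \<Longrightarrow> net x v = x v \<and> net y v = y v"
  shows "acyclic_on S"
proof (rule coherent_acy)
  fix u v assume "u \<in> S" "v \<in> S" "(u, v) \<in> E"
  then show "coh x u v" using assms sat_coh[of v x y u] by blast
qed

lemma dif_run: "set w \<subseteq> S \<Longrightarrow> S \<subseteq> dif x y \<Longrightarrow> dif (run net w x) (run net w y) \<subseteq> dif x y"
  using run_other[of _ w net x] run_other[of _ w net y] by (force simp: dif_iff)

lemma dif_run_outside: "i \<notin> set w \<Longrightarrow> i \<in> dif (run net w x) (run net w y) \<longleftrightarrow> i \<in> dif x y"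
  by (simp add: dif_iff run_other)

text \<open>The form of all progress statements: \<open>n\<close> is the budget of updates and
  \<open>k\<close> the size of a feedback vertex set to be beaten.\<close>

definition lowers :: "nat \<Rightarrow> nat \<Rightarrow> ('v \<Rightarrow> bool) \<Rightarrow> ('v \<Rightarrow> bool) \<Rightarrow> bool" where
  "lowers n k x y \<longleftrightarrow> (\<exists>w B. length w \<le> n \<and> card B < k \<and> acyclic_on (dif (run net w x) (run net w y) - B))"

lemma lowers_0: "card B < k \<Longrightarrow> acyclic_on (dif x y - B) \<Longrightarrow> lowers n k x y"
  unfolding lowers_def by (intro exI[of _ "[]"] exI[of _ B]) simp

lemma lowers_run:
  assumes "lowers n k (run net w x) (run net w y)" "length w + n \<le> m"
  shows "lowers m k x y"
proof -
  obtain w' B where "length w' \<le> n" "card B < k"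
      "acyclic_on (dif (run net w' (run net w x)) (run net w' (run net w y)) - B)"
    using assms(1) unfolding lowers_def by blast
  then show ?thesis using assms(2) unfolding lowers_def
    by (intro exI[of _ "w @ w'"] exI[of _ B]) (simp add: run_append)
qed

lemma lowers_upd:
  assumes "lowers n k (upd net v x) (upd net v y)" "Suc n \<le> m"
  shows "lowers m k x y"
  using lowers_run[of n k "[v]" x y m] assms by simp

lemma lowers_mono: "lowers n k x y \<Longrightarrow> n \<le> m \<Longrightarrow> lowers m k x y"
  unfolding lowers_def by (meson order_trans)

definition minimal_fvs :: "('v \<Rightarrow> bool) \<Rightarrow> ('v \<Rightarrow> bool) \<Rightarrow> nat \<Rightarrow> bool" where
  "minimal_fvs x y k \<longleftrightarrow> (\<forall>B. acyclic_on (dif x y - B) \<longrightarrow> k \<le> card B)"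

lemma not_minimal_lowers: "\<not> minimal_fvs x y k \<Longrightarrow> lowers n k x y"
  unfolding minimal_fvs_def by (meson leI lowers_0)

text \<open>The difference set is at rest outside \<open>B\<close>, while each vertex of
  \<open>B\<close> is about to take the value that it has in the other state.\<close>

definition perfect :: "('v \<Rightarrow> bool) \<Rightarrow> ('v \<Rightarrow> bool) \<Rightarrow> 'v set \<Rightarrow> bool" where
  "perfect x y B \<longleftrightarrow> B \<subseteq> dif x y \<and> acyclic_on (dif x y - B) \<and>
     (\<forall>v\<in>dif x y - B. net x v = x v \<and> net y v = y v) \<and>
     (\<forall>b\<in>B. net x b = y b \<and> net y b = x b)"

lemma perfectD:
  assumes "perfect x y B"
  shows "B \<subseteq> dif x y" "acyclic_on (dif x y - B)"
    "\<And>v. v \<in> dif x y \<Longrightarrow> v \<notin> B \<Longrightarrow> net x v = x v"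
    "\<And>v. v \<in> dif x y \<Longrightarrow> v \<notin> B \<Longrightarrow> net y v = y v"
    "\<And>b. b \<in> B \<Longrightarrow> net x b = y b" "\<And>b. b \<in> B \<Longrightarrow> net y b = x b"
    "\<And>v. v \<in> dif x y \<Longrightarrow> net x v \<noteq> net y v"
proof -
  show "net x v \<noteq> net y v" if "v \<in> dif x y" for v
    using that assms by (cases "v \<in> B") (auto simp: perfect_def dif_iff)
qed (use assms in \<open>auto simp: perfect_def\<close>)

lemma merge_lowers:
  assumes "acyclic_on (dif x y - {v} - B)" "card B < k" "net x v = net y v"
  shows "lowers 1 k x y"
proof -
  have "dif (upd net v x) (upd net v y) = dif x y - {v}"
    using assms(3) by (simp add: dif_upd)
  then have "lowers 0 k (upd net v x) (upd net v y)"
    using assms by (intro lowers_0[of B]) auto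
  then show ?thesis by (rule lowers_upd) simp
qed

text \<open>After the rest of the difference set has settled, a vertex \<open>b\<close> of
  \<open>B\<close> has equal images and can be merged, or is at rest in both states, so that
  \<open>B - {b}\<close> suffices by \<open>sat_acy\<close>, or has its two values exchanged by the
  net.\<close>

lemma to_perfect:
  assumes B: "B \<subseteq> dif x y" and acyclic_on: "acyclic_on (dif x y - B)" and q: "card B = k"
  shows "lowers (card (dif x y - B) + 1) k x y \<or>
     (\<exists>w. set w \<subseteq> dif x y - B \<and> length w = card (dif x y - B) \<and>
          minimal_fvs (run net w x) (run net w y) k \<and> perfect (run net w x) (run net w y) B)"
proof -
  obtain w where w: "set w \<subseteq> dif x y - B" "length w = card (dif x y - B)"
    and w0: "\<forall>z. \<forall>v\<in>dif x y - B. net (run net w z) v = run net w z v"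
    using satisfying_word[OF acyclic_on] by (elim exE conjE)
  have w3: "net (run net w z) v = run net w z v" if "v \<in> dif x y - B" for z v
    using w0[rule_format, OF that] .
  let ?x = "run net w x" and ?y = "run net w y"
  have sub: "dif ?x ?y \<subseteq> dif x y" using dif_run[OF w(1)] by blast
  have acy': "acyclic_on (dif ?x ?y - B)" using acyclic_on by (rule acyclic_on_subset) (use sub in blast)
  have sat: "net ?x v = ?x v \<and> net ?y v = ?y v" if "v \<in> dif ?x ?y - B" for v
    using w3 that sub by blast
  have Bd: "B \<subseteq> dif ?x ?y" using B w(1) dif_run_outside[of _ w x y] by blast
  have "lowers 1 k ?x ?y \<or> minimal_fvs ?x ?y k \<and> perfect ?x ?y B"
  proof (rule ccontr)
    assume c: "\<not> ?thesis"
    then have min: "minimal_fvs ?x ?y k" using not_minimal_lowers by blast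
    have "\<not> perfect ?x ?y B" using c min by blast
    then obtain b where b: "b \<in> B" "\<not> (net ?x b = ?y b \<and> net ?y b = ?x b)"
      using Bd acy' sat unfolding perfect_def by blast
    have cb: "card (B - {b}) < k" using b(1) q card_gt_0_iff[of B] by auto
    have "net ?x b = net ?y b \<or> net ?x b = ?x b \<and> net ?y b = ?y b"
      using b Bd by (auto simp: dif_iff)
    then show False
    proof
      assume "net ?x b = net ?y b"
      moreover have "acyclic_on (dif ?x ?y - {b} - (B - {b}))" using acy' by (rule acyclic_on_subset) blast
      ultimately show False using merge_lowers[OF _ cb] c by blast
    next
      assume s: "net ?x b = ?x b \<and> net ?y b = ?y b"
      have "acyclic_on (dif ?x ?y - (B - {b}))"
        using sat s by (intro sat_acy[of _ ?x ?y]) auto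
      then show False using lowers_0[OF cb] c by blast
    qed
  qed
  then show ?thesis
  proof
    assume "lowers 1 k ?x ?y"
    then show ?thesis using w(2) lowers_run[of 1 k w x y] by simp
  qed (use w in blast)
qed

definition swap_on :: "'v set \<Rightarrow> ('v \<Rightarrow> bool) \<Rightarrow> ('v \<Rightarrow> bool) \<Rightarrow> 'v \<Rightarrow> bool" where
  "swap_on S x y i = (if i \<in> S then y i else x i)"

lemma dif_swap_on [simp]: "dif (swap_on S x y) (swap_on S y x) = dif x y"
  by (rule set_eqI) (simp add: dif_def swap_on_def, metis)

lemma swap_on_empty [simp]: "swap_on {} x y = x"
  by (auto simp: swap_on_def)

lemma net_swap_on_none:
  assumes "\<And>u. u \<in> S \<Longrightarrow> u \<in> dif x y \<Longrightarrow> (u, v) \<notin> E"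
  shows "net (swap_on S x y) v = net x v"
  using assms by (intro net_cong) (auto simp: swap_on_def dif_iff)

lemma net_swap_on_all:
  assumes "\<And>u. (u, v) \<in> E \<Longrightarrow> u \<in> dif x y \<Longrightarrow> u \<in> S"
  shows "net (swap_on S x y) v = net y v"
  using assms by (intro net_cong) (auto simp: swap_on_def dif_iff)

text \<open>By \<open>differ_lit\<close> the differing literals at \<open>v\<close> agree within one
  state. After an exchange of some of them but not all, one is false; the same holds in the other
  state, so \<open>v\<close> can be merged.\<close>

lemma net_swap_on_mixed:
  assumes "net x v \<noteq> net y v" "a \<in> dif x y" "a \<in> S" "(a, v) \<in> E"
    and "b \<in> dif x y" "b \<notin> S" "(b, v) \<in> E"
  shows "\<not> net (swap_on S x y) v"
proof -
  have "lit x a v = lit x b v" using differ_lit[OF assms(1,4)] differ_lit[OF assms(1,7)] assms by auto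
  moreover have "lit y a v \<noteq> lit x a v" using assms(2) by (auto simp: dif_iff)
  ultimately have "\<not> (lit (swap_on S x y) a v \<and> lit (swap_on S x y) b v)" using assms by (auto simp: swap_on_def)
  then show ?thesis using netD assms by blast
qed

lemma net_swap_on_mixed2:
  assumes "net x v \<noteq> net y v" "a \<in> dif x y" "a \<in> S" "(a, v) \<in> E"
    and "b \<in> dif x y" "b \<notin> S" "(b, v) \<in> E"
  shows "net (swap_on S x y) v = net (swap_on S y x) v"
proof -
  have d: "dif y x = dif x y" by (auto simp: dif_iff)
  have "\<not> net (swap_on S y x) v" using assms net_swap_on_mixed[of y v x a S b] unfolding d by simp
  then show ?thesis using net_swap_on_mixed[OF assms] by simp
qed

lemma upd_swap_on: "net (swap_on S x y) w = y w \<Longrightarrow> upd net w (swap_on S x y) = swap_on (insert w S) x y"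
  by (rule ext) (simp add: upd_def swap_on_def)

text \<open>The feedback vertices are exchanged one at a time. If no exchanged vertex feeds
  \<open>e\<close>, its image is still the value in the other state; if one does, the inputs of
  \<open>e\<close> are mixed and \<open>e\<close> merges.\<close>

lemma flip_feedback:
  assumes per: "perfect x y B" and q: "card B = k" and min: "minimal_fvs x y k" and F: "F \<subseteq> B"
  shows "lowers (card F) k x y \<or>
    (\<exists>w. length w = card F \<and> run net w x = swap_on F x y \<and> run net w y = swap_on F y x)"
proof -
  have "finite F" by simp
  then show ?thesis using F
  proof (induction F)
    case empty
    then show ?case by (intro disjI2 exI[of _ "[]"]) simp
  next
    case (insert e F)
    note P = perfectD[OF per]
    have e: "e \<in> B" "e \<notin> F" "F \<subseteq> B" using insert by auto
    have ed: "e \<in> dif x y" using e P(1) by blast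
    have ce: "card (B - {e}) < k" using e q card_gt_0_iff[of B] by auto
    from insert.IH[OF e(3)] show ?case
    proof
      assume "lowers (card F) k x y"
      then show ?thesis using insert lowers_mono by (metis card_insert_disjoint le_SucI order_refl)
    next
      assume "\<exists>w. length w = card F \<and> run net w x = swap_on F x y \<and> run net w y = swap_on F y x"
      then obtain w where w: "length w = card F" "run net w x = swap_on F x y" "run net w y = swap_on F y x" by blast
      \<comment> \<open>If all differing inputs of \<open>e\<close> were in \<open>F\<close>, no
        cycle through \<open>e\<close> would survive the removal of \<open>B - {e}\<close>, against
        minimality.\<close>
      have "\<exists>b\<in>dif x y. (b, e) \<in> E \<and> b \<notin> F"
      proof (rule ccontr)
        assume no: "\<not> ?thesis"
        have "acyclic_on (dif x y - (B - {e}))"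
          unfolding acyclic_on_def
        proof (intro allI impI)
          fix Z assume Z: "Z \<subseteq> dif x y - (B - {e})" "Z \<noteq> {}"
          show "\<exists>v\<in>Z. \<forall>u\<in>Z. (u, v) \<notin> E"
          proof (cases "e \<in> Z")
            case True
            then show ?thesis using no Z(1) e by blast
          next
            case False
            then show ?thesis using acyclic_on_source[OF P(2), of Z] Z by blast
          qed
        qed
        then show False using min ce unfolding minimal_fvs_def by (meson leD)
      qed
      then obtain b where b: "b \<in> dif x y" "(b, e) \<in> E" "b \<notin> F" by blast
      show ?thesis
      proof (cases "\<exists>a\<in>F. (a, e) \<in> E")
        case True
        then obtain a where a: "a \<in> F" "(a, e) \<in> E" by blast
        have "net (swap_on F x y) e = net (swap_on F y x) e"
          using net_swap_on_mixed2[OF P(7)[OF ed], of a F b] a b e(3) P(1) by blast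
        moreover have "acyclic_on (dif (swap_on F x y) (swap_on F y x) - {e} - (B - {e}))"
          using P(2) by (rule acyclic_on_subset) auto
        ultimately have "lowers 1 k (run net w x) (run net w y)"
          using merge_lowers[OF _ ce] w by metis
        then have "lowers (card (insert e F)) k x y"
          by (rule lowers_run) (use w insert in simp)
        then show ?thesis ..
      next
        case False
        have dyx: "dif y x = dif x y" by (auto simp: dif_iff)
        have "net (swap_on F x y) e = net x e" "net (swap_on F y x) e = net y e"
          using False by (auto intro!: net_swap_on_none)
        then have "upd net e (swap_on F x y) = swap_on (insert e F) x y" "upd net e (swap_on F y x) = swap_on (insert e F) y x"
          using P(5,6) e(1) by (auto intro!: upd_swap_on)
        then have "length (w @ [e]) = card (insert e F) \<and> run net (w @ [e]) x = swap_on (insert e F) x y \<and>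
            run net (w @ [e]) y = swap_on (insert e F) y x"
          using w insert by (simp add: run_append)
        then show ?thesis by blast
      qed
    qed
  qed
qed

text \<open>The aim is an exchange set that contains one differing input of \<open>v\<close> but not
  another: then \<open>v\<close> merges and \<open>A\<close> remains as a smaller feedback vertex
  set.\<close>

lemma split_lowers:
  assumes per: "perfect x y B" and q: "card B = k" and min: "minimal_fvs x y k"
    and v: "v \<in> dif x y" and d: "d1 \<in> dif x y" "d2 \<in> dif x y" "d1 \<noteq> d2" "(d1, v) \<in> E" "(d2, v) \<in> E"
    and low: "acyclic_on (dif x y - {v} - A)" "card A < k"
  shows "lowers (card (dif x y) + 1) k x y"
proof -
  note P = perfectD[OF per]
  have final: "lowers 1 k (swap_on S x y) (swap_on S y x)"
    if "a \<in> S" "a \<in> dif x y" "(a, v) \<in> E" "b \<notin> S" "b \<in> dif x y" "(b, v) \<in> E" for S a b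
    using net_swap_on_mixed2[OF P(7)[OF v], of a S b] that low by (intro merge_lowers[of _ _ v A]) simp_all
  \<comment> \<open>With \<open>B\<close> exchanged, the exchange spreads in topological order,
    since the next vertex sees only exchanged inputs. The first input of \<open>v\<close> that it
    reaches separates the inputs of \<open>v\<close>.\<close>
  have topo: "lowers (card (dif x y - S) + 1) k (swap_on S x y) (swap_on S y x)"
    if "B \<subseteq> S" "\<forall>u\<in>S. (u, v) \<notin> E" for S
    using that
  proof (induction "card (dif x y - S)" arbitrary: S)
    case 0
    then have "dif x y \<subseteq> S" by auto
    then show ?case using 0 d by blast
  next
    case (Suc n)
    have "dif x y - S \<noteq> {}" using Suc.hyps(2) by (metis card.empty nat.distinct(1))
    moreover have "dif x y - S \<subseteq> dif x y - B" using Suc.prems by blast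
    ultimately obtain w where w: "w \<in> dif x y - S" "\<forall>u\<in>dif x y - S. (u, w) \<notin> E"
      using acyclic_on_source[OF P(2)] by blast
    have wB: "w \<notin> B" using w Suc.prems by blast
    have dyx: "dif y x = dif x y" by (auto simp: dif_iff)
    have "net (swap_on S x y) w = net y w" "net (swap_on S y x) w = net x w"
      using w dyx by (auto intro!: net_swap_on_all)
    then have u: "upd net w (swap_on S x y) = swap_on (insert w S) x y" "upd net w (swap_on S y x) = swap_on (insert w S) y x"
      using P(3,4)[of w] w wB by (auto intro!: upd_swap_on)
    have c: "n = card (dif x y - insert w S)"
      using Suc.hyps(2) w by (metis Diff_insert card_Diff_singleton diff_Suc_1)
    have "lowers (n + 1) k (swap_on (insert w S) x y) (swap_on (insert w S) y x)"
    proof (cases "(w, v) \<in> E")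
      case True
      obtain b where "b \<in> dif x y" "(b, v) \<in> E" "b \<noteq> w" using d by metis
      then have "lowers 1 k (swap_on (insert w S) x y) (swap_on (insert w S) y x)"
        using True w Suc.prems(2) by (intro final[of w "insert w S" b]) auto
      then show ?thesis by (rule lowers_mono) simp
    next
      case False
      then show ?thesis using Suc.hyps(1)[OF c] Suc.prems c by auto
    qed
    then have "lowers (n + 2) k (swap_on S x y) (swap_on S y x)"
      unfolding u[symmetric] by (rule lowers_upd) simp
    then show ?case using Suc.hyps(2) by simp
  qed
  show ?thesis
  proof (cases "\<exists>a\<in>B. (a, v) \<in> E")
    case True
    then obtain a where a: "a \<in> B" "(a, v) \<in> E" by blast
    obtain b where b: "b \<in> dif x y" "(b, v) \<in> E" "b \<noteq> a" using d by metis
    have pos: "1 \<le> card (dif x y)" using v by (metis One_nat_def Suc_leI card_gt_0_iff empty_iff finite)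
    from flip_feedback[OF per q min, of "{a}"] a(1) consider
        "lowers 1 k x y" |
        w where "length w = 1" "run net w x = swap_on {a} x y" "run net w y = swap_on {a} y x" by auto
    then show ?thesis
    proof cases
      case 1
      then show ?thesis by (rule lowers_mono) simp
    next
      case (2 w)
      have "lowers 1 k (run net w x) (run net w y)"
        unfolding 2 using a b P(1) by (intro final[of a _ b]) auto
      then show ?thesis by (rule lowers_run) (use 2 pos in simp)
    qed
  next
    case False
    from flip_feedback[OF per q min, of B] consider
        "lowers (card B) k x y" |
        w where "length w = card B" "run net w x = swap_on B x y" "run net w y = swap_on B y x" by auto
    then show ?thesis
    proof cases
      case 1
      then show ?thesis by (rule lowers_mono) (use P(1) in \<open>simp add: card_mono le_SucI\<close>)
    next
      case (2 w)
      have "lowers (card (dif x y - B) + 1) k (run net w x) (run net w y)"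
        using topo[of B] False 2 by auto
      then show ?thesis
        by (rule lowers_run) (use 2 P(1) in \<open>simp add: card_Diff_subset card_mono\<close>)
    qed
  qed
qed

end

section \<open>Isolated oscillating cycles\<close>

lemma orbit_leaves:
  assumes "e \<in> Z" "(p ^^ i) e \<notin> Z"
  shows "\<exists>j. (p ^^ j) e \<in> Z \<and> p ((p ^^ j) e) \<notin> Z"
proof (rule ccontr)
  assume "\<not> ?thesis"
  then have "(p ^^ j) e \<in> Z" for j using assms(1) by (induction j) auto
  with assms(2) show False by blast
qed

lemma orbit_back:
  assumes "0 < k" "(p ^^ k) b = b"
  shows "\<exists>m. (p ^^ m) ((p ^^ i) b) = b"
proof -
  have per: "(p ^^ (k * i)) b = b"
    using assms(2) by (induction i) (simp_all add: funpow_add)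
  have "i \<le> k * i" using assms(1) by simp
  then have "(p ^^ (k * i - i)) ((p ^^ i) b) = (p ^^ (k * i)) b"
    by (simp add: funpow_add[symmetric, THEN fun_cong, simplified])
  with per show ?thesis by metis
qed

lemma orbit_periodic:
  assumes "(p ^^ k) b = b"
  shows "(p ^^ k) ((p ^^ i) b) = (p ^^ i) b"
proof -
  have "(p ^^ k) ((p ^^ i) b) = (p ^^ i) ((p ^^ k) b)"
    by (metis add.commute comp_apply funpow_add)
  then show ?thesis using assms by simp
qed

text \<open>Here \<open>p\<close> is a predecessor map, so orbits run against the arcs. The last
  clause puts distinct members of \<open>B\<close> on distinct orbits.\<close>

definition orbits :: "'v set \<Rightarrow> 'v set \<Rightarrow> ('v \<Rightarrow> 'v) \<Rightarrow> bool" where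
  "orbits B K p \<longleftrightarrow> (\<forall>c\<in>K. \<exists>b\<in>B. \<exists>i. c = (p ^^ i) b) \<and> (\<forall>b\<in>B. \<exists>k>0. (p ^^ k) b = b) \<and>
     (\<forall>b\<in>B. \<forall>i. (p ^^ i) b \<in> B \<longrightarrow> (p ^^ i) b = b)"

context and_net
begin

text \<open>Together with \<open>orbits B K p\<close>, this says that the feedback vertices in \<open>B\<close> lie on disjoint cycles
  which no other arc from the difference set enters, so that they oscillate independently until an
  input from outside changes.\<close>

definition ready :: "('v \<Rightarrow> bool) \<Rightarrow> ('v \<Rightarrow> bool) \<Rightarrow> 'v set \<Rightarrow> 'v set \<Rightarrow> ('v \<Rightarrow> 'v) \<Rightarrow> bool" where
  "ready x y B K p \<longleftrightarrow> B \<subseteq> K \<and> K \<subseteq> dif x y \<and>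
     (\<forall>c\<in>K. p c \<in> K \<and> (p c, c) \<in> E \<and> (\<forall>u\<in>dif x y. (u, c) \<in> E \<longrightarrow> u = p c)) \<and>
     (\<forall>v\<in>dif x y - B. \<exists>u\<in>dif x y. coh x u v) \<and>
     (\<forall>c\<in>K. \<forall>u. (u, c) \<in> E \<longrightarrow> u \<notin> dif x y \<longrightarrow> lit x u c) \<and>
     (\<forall>b\<in>B. x b \<and> (\<exists>j. (j, b) \<in> E \<and> j \<notin> dif x y))"

lemma readyD:
  assumes "ready x y B K p"
  shows "B \<subseteq> K" "K \<subseteq> dif x y" "\<And>c. c \<in> K \<Longrightarrow> p c \<in> K" "\<And>c. c \<in> K \<Longrightarrow> (p c, c) \<in> E"
    "\<And>c u. c \<in> K \<Longrightarrow> u \<in> dif x y \<Longrightarrow> (u, c) \<in> E \<Longrightarrow> u = p c"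
    "\<And>v. v \<in> dif x y \<Longrightarrow> v \<notin> B \<Longrightarrow> \<exists>u\<in>dif x y. coh x u v"
    "\<And>c u. c \<in> K \<Longrightarrow> (u, c) \<in> E \<Longrightarrow> u \<notin> dif x y \<Longrightarrow> lit x u c"
    "\<And>b. b \<in> B \<Longrightarrow> x b" "\<And>b. b \<in> B \<Longrightarrow> \<exists>j. (j, b) \<in> E \<and> j \<notin> dif x y"
  using assms unfolding ready_def by blast+

text \<open>Removing one vertex of an oscillating cycle makes its member of \<open>B\<close> dispensable.\<close>

lemma broken_cycle_acy:
  assumes uniq: "\<And>i u. u \<in> D \<Longrightarrow> (u, (p ^^ i) e) \<in> E \<Longrightarrow> u = p ((p ^^ i) e)"
    and acyclic_on: "acyclic_on (D - B)" and D': "D' \<subseteq> D" "(p ^^ i) e \<notin> D'"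
  shows "acyclic_on (D' - (B - {e}))"
  unfolding acyclic_on_def
proof (intro allI impI)
  fix Z assume Z: "Z \<subseteq> D' - (B - {e})" "Z \<noteq> {}"
  show "\<exists>v\<in>Z. \<forall>u\<in>Z. (u, v) \<notin> E"
  proof (cases "e \<in> Z")
    case True
    moreover have "(p ^^ i) e \<notin> Z" using Z D' by blast
    ultimately obtain j where "(p ^^ j) e \<in> Z" "p ((p ^^ j) e) \<notin> Z"
      using orbit_leaves by metis
    then show ?thesis using uniq Z(1) D'(1) by blast
  next
    case False
    then have "Z \<subseteq> D - B" using Z D' by blast
    then show ?thesis using acyclic_on_source[OF acyclic_on] Z(2) by blast
  qed
qed

end

locale strong_and_net = and_net E q for E :: "('v::finite \<times> 'v) set" and q +
  assumes strong: "(u, v) \<in> E\<^sup>*"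
    and has_input: "\<exists>u. (u, v) \<in> E"
    and branching: "\<exists>v a b. a \<noteq> b \<and> (a, v) \<in> E \<and> (b, v) \<in> E"
begin

text \<open>The length pays for three settling words of at most \<open>n - k\<close> updates, with
  \<open>n\<close> the number of vertices (for \<open>B0\<close>, for the shifted set
  \<open>B\<close>, and after making \<open>B\<close> True in \<open>x\<close>), and for at most
  \<open>k\<close> exchanges.\<close>

lemma make_ready:
  assumes acy0: "acyclic_on (dif x y - B0)" and k: "card B0 = k" and k0: "0 < k"
  shows "lowers (3 * card (UNIV :: 'v set)) k x y \<or>
     (\<exists>w B K p. length w \<le> 3 * (card (UNIV :: 'v set) - k) + k \<and> card B = k \<and> orbits B K p \<and>
        ready (run net w x) (run net w y) B K p)"
proof (rule ccontr)
  assume c: "\<not> ?thesis"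
  then have nl: "\<not> lowers (3 * card (UNIV :: 'v set)) k x y" by blast
  let ?n = "card (UNIV :: 'v set)"
  have kn: "k \<le> ?n" using k card_mono[of UNIV B0] by simp
  have min0: "minimal_fvs x y k"
    using nl not_minimal_lowers[of x y k "3 * ?n"] by blast
  have "acyclic_on (dif x y - (B0 \<inter> dif x y))" using acy0 by (rule acyclic_on_subset) blast
  then have "k \<le> card (B0 \<inter> dif x y)" using min0 unfolding minimal_fvs_def by blast
  then have "B0 \<inter> dif x y = B0" using k by (intro card_seteq) auto
  then have B0d: "B0 \<subseteq> dif x y" by blast
  have cardD: "card (S - B) \<le> ?n - k" if "B \<subseteq> S" "card B = k" for S B :: "'v set"
    using that card_mono[of UNIV S] by (simp add: card_Diff_subset diff_le_mono)
  have nl': "\<not> lowers m k (run net w x) (run net w y)" if "length w + m \<le> 3 * ?n" for w m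
    using nl lowers_run[of m k w x y] that by blast
  have "\<not> lowers (card (dif x y - B0) + 1) k x y"
    using nl'[of "[]" "card (dif x y - B0) + 1"] cardD[OF B0d k] k0 kn by simp
  then obtain w1 where w1: "length w1 = card (dif x y - B0)"
      and min1: "minimal_fvs (run net w1 x) (run net w1 y) k"
      and per1: "perfect (run net w1 x) (run net w1 y) B0"
    using to_perfect[OF B0d acy0 k] by blast
  define x1 y1 where "x1 = run net w1 x" and "y1 = run net w1 y"
  define D where "D = dif x1 y1"
  note P1 = perfectD[OF per1[folded x1_def y1_def], folded D_def]
  have l1: "length w1 \<le> ?n - k" using w1 cardD[OF B0d k] by simp
  have Dmin: "k \<le> card A" if "acyclic_on (D - A)" for A
    using min1 that unfolding minimal_fvs_def D_def x1_def y1_def by blast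
  \<comment> \<open>A member of a feedback vertex set of size \<open>k\<close> with two inputs in
    \<open>D\<close> would let \<open>split_lowers\<close> finish within the budget.\<close>
  have uniq: "d1 = d2"
    if "acyclic_on (D - A)" "card A = k" "v \<in> A" "v \<in> D" "d1 \<in> D" "d2 \<in> D" "(d1, v) \<in> E" "(d2, v) \<in> E"
    for A v d1 d2
  proof (rule ccontr)
    assume "d1 \<noteq> d2"
    have "acyclic_on (D - {v} - (A - {v}))" using that(1) by (rule acyclic_on_subset) blast
    moreover have "card (A - {v}) < k" using that k0 by simp
    ultimately have "lowers (card D + 1) k x1 y1"
      using split_lowers[OF per1 k min1, folded x1_def y1_def, folded D_def] that \<open>d1 \<noteq> d2\<close> by blast
    moreover have "card D \<le> ?n" by (simp add: card_mono)
    ultimately show False using nl'[of w1 "card D + 1"] l1 k0 kn unfolding x1_def y1_def by linarith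
  qed
  define p where "p v = (SOME u. u \<in> D \<and> (u, v) \<in> E)" for v
  have p: "p v \<in> D \<and> (p v, v) \<in> E" if "v \<in> D" for v
  proof -
    have "\<exists>u. u \<in> D \<and> (u, v) \<in> E" using differ_input[OF P1(7)[OF that]] by (auto simp: D_def)
    then show ?thesis unfolding p_def by (rule someI_ex)
  qed
  have pD: "(p ^^ i) v \<in> D" if "v \<in> D" for v i using that p by (induction i) auto
  \<comment> \<open>A feedback vertex may be replaced by its only input in \<open>D\<close>, since
    every cycle of \<open>D\<close> through the one passes through the other. Landing in
    \<open>B0 - {b}\<close> would give a smaller set.\<close>
  have orb: "acyclic_on (D - insert ((p ^^ i) b) (B0 - {b})) \<and> (p ^^ i) b \<notin> B0 - {b}" if b: "b \<in> B0" for b i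
  proof (induction i)
    case 0
    have "insert b (B0 - {b}) = B0" using b by blast
    then show ?case using P1(2) by simp
  next
    case (Suc i)
    let ?v = "(p ^^ i) b" and ?A = "insert ((p ^^ i) b) (B0 - {b})"
    have vD: "?v \<in> D" using pD b P1(1) by blast
    have cA: "card ?A = k" using Suc.IH b k k0 by simp
    have acy': "acyclic_on (D - insert (p ?v) (B0 - {b}))"
      unfolding acyclic_on_def
    proof (intro allI impI)
      fix Z assume Z: "Z \<subseteq> D - insert (p ?v) (B0 - {b})" "Z \<noteq> {}"
      show "\<exists>v\<in>Z. \<forall>u\<in>Z. (u, v) \<notin> E"
      proof (cases "?v \<in> Z")
        case True
        have "\<forall>u\<in>Z. (u, ?v) \<notin> E"
          using uniq[of ?A ?v _ "p ?v"] Suc.IH cA vD p[OF vD] Z(1) by blast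
        then show ?thesis using True by blast
      next
        case False
        then have "Z \<subseteq> D - ?A" using Z by blast
        then show ?thesis using acyclic_on_source[of "D - ?A" Z] Suc.IH Z(2) by blast
      qed
    qed
    have "p ?v \<notin> B0 - {b}"
    proof
      assume "p ?v \<in> B0 - {b}"
      then have "insert (p ?v) (B0 - {b}) = B0 - {b}" by (rule insert_absorb)
      then have "k \<le> card (B0 - {b})" using Dmin acy' by metis
      then show False using b k k0 by simp
    qed
    with acy' show ?case by simp
  qed
  have uniqp: "u = p ((p ^^ i) b)" if "b \<in> B0" "u \<in> D" "(u, (p ^^ i) b) \<in> E" for b i u
  proof -
    have "card (insert ((p ^^ i) b) (B0 - {b})) = k" using orb[OF that(1), of i] that(1) k k0 by simp
    moreover have "(p ^^ i) b \<in> D" using pD that(1) P1(1) by blast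
    ultimately show ?thesis using uniq orb[OF that(1), of i] p that by blast
  qed
  \<comment> \<open>A backward orbit that never returned to \<open>b\<close> would be a set without
    a source in the acyclic part \<open>D - B0\<close>.\<close>
  have periodic: "\<exists>m>0. (p ^^ m) b = b" if b: "b \<in> B0" for b
  proof (rule ccontr)
    assume np: "\<not> ?thesis"
    let ?Z = "{(p ^^ Suc i) b | i. True}"
    have "?Z \<subseteq> D - B0"
    proof
      fix v assume "v \<in> ?Z"
      then obtain i where v: "v = (p ^^ Suc i) b" by blast
      then have "v \<noteq> b" "v \<notin> B0 - {b}" using np orb[OF b, of "Suc i"] by (auto simp del: funpow.simps)
      moreover have "v \<in> D" unfolding v using pD b P1(1) by blast
      ultimately show "v \<in> D - B0" by blast
    qed
    moreover have "?Z \<noteq> {}" by blast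
    ultimately obtain v where v: "v \<in> ?Z" "\<forall>u\<in>?Z. (u, v) \<notin> E" using acyclic_on_source[OF P1(2)] by blast
    then obtain i where i: "v = (p ^^ Suc i) b" by blast
    then have "p v = (p ^^ Suc (Suc i)) b" by simp
    then have "p v \<in> ?Z" by blast
    moreover have "(p v, v) \<in> E" using p pD b P1(1) unfolding i by blast
    ultimately show False using v(2) by blast
  qed
  \<comment> \<open>Without an entry from outside, the orbit is closed under predecessors, hence
    everything by strong connectivity, and no vertex has two inputs, against
    \<open>branching\<close>.\<close>
  have entry: "\<exists>i j. (j, (p ^^ i) b) \<in> E \<and> j \<notin> D" if b: "b \<in> B0" for b
  proof (rule ccontr)
    assume ne: "\<not> ?thesis"
    let ?O = "{(p ^^ i) b | i. True}"
    have closed: "u = p v \<and> u \<in> ?O" if h: "(u, v) \<in> E" "v \<in> ?O" for u v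
    proof -
      obtain i where i: "v = (p ^^ i) b" using h(2) by blast
      then have "u = p v" using uniqp[OF b] ne h by blast
      moreover have "p v = (p ^^ Suc i) b" using i by simp
      ultimately show ?thesis by blast
    qed
    have "b \<in> ?O" by (intro CollectI exI[of _ 0]) simp
    then have "v \<in> ?O" for v using crossing_arc[OF strong, of v ?O b] closed by blast
    then show False using branching closed by blast
  qed
  \<comment> \<open>Each feedback vertex moves to an entry point of its cycle, where an input
    outside the difference set can support it.\<close>
  define e where "e b = (SOME v. \<exists>i j. v = (p ^^ i) b \<and> (j, v) \<in> E \<and> j \<notin> D)" for b
  have e: "\<exists>i j. e b = (p ^^ i) b \<and> (j, e b) \<in> E \<and> j \<notin> D" if "b \<in> B0" for b
    unfolding e_def by (rule someI_ex) (use entry[OF that] in blast)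
  define B K where "B = e ` B0" and "K = {(p ^^ i) b | i b. b \<in> B0}"
  have eb: "\<exists>m. (p ^^ m) (e b) = b" if b: "b \<in> B0" for b
  proof -
    obtain i where i: "e b = (p ^^ i) b" using e[OF b] by blast
    obtain m where "0 < m" "(p ^^ m) b = b" using periodic[OF b] by blast
    then show ?thesis unfolding i by (rule orbit_back)
  qed
  have same: "b = b'" if h: "b \<in> B0" "b' \<in> B0" "(p ^^ i) (e b) = e b'" for b b' i
  proof -
    obtain m where m: "(p ^^ m) (e b') = b'" using eb h by blast
    obtain l where l: "e b = (p ^^ l) b" using e h by blast
    have "b' = (p ^^ (m + i + l)) b" using m h(3) l by (simp add: funpow_add)
    then show ?thesis using orb[OF h(1), of "m + i + l"] h(2) by (metis DiffI singletonD)
  qed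
  have "inj_on e B0" using same[of _ _ 0] by (auto simp: inj_on_def)
  then have cB: "card B = k" unfolding B_def using k by (simp add: card_image)
  have orbits: "orbits B K p"
    unfolding orbits_def
  proof (intro conjI ballI allI impI)
    fix c assume "c \<in> K"
    then obtain i b where ib: "c = (p ^^ i) b" "b \<in> B0" unfolding K_def by blast
    obtain m where "(p ^^ m) (e b) = b" using eb ib by blast
    then have "c = (p ^^ (i + m)) (e b)" using ib by (simp add: funpow_add)
    then show "\<exists>b\<in>B. \<exists>i. c = (p ^^ i) b" using ib unfolding B_def by blast
  next
    fix b' assume "b' \<in> B"
    then obtain b where b: "b' = e b" "b \<in> B0" unfolding B_def by blast
    obtain i where i: "e b = (p ^^ i) b" using e b by blast
    obtain m where "0 < m" "(p ^^ m) b = b" using periodic b by blast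
    then show "\<exists>k>0. (p ^^ k) b' = b'" using orbit_periodic[of m p b i] b i by auto
  next
    fix b' i assume "b' \<in> B" "(p ^^ i) b' \<in> B"
    then show "(p ^^ i) b' = b'" using same unfolding B_def by fastforce
  qed
  have KD: "K \<subseteq> D" unfolding K_def using pD P1(1) by blast
  have BK: "B \<subseteq> K" unfolding B_def K_def using e by blast
  have uniqK: "u = p c" if "c \<in> K" "u \<in> D" "(u, c) \<in> E" for c u
    using that uniqp unfolding K_def by blast
  have pK: "p c \<in> K" if h: "c \<in> K" for c
  proof -
    obtain i b where "c = (p ^^ i) b" "b \<in> B0" using h unfolding K_def by blast
    then have "p c = (p ^^ Suc i) b" by simp
    then show ?thesis using \<open>b \<in> B0\<close> unfolding K_def by blast
  qed
  have itK: "(p ^^ i) c \<in> K" if "c \<in> K" for c i using that pK by (induction i) auto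
  have acyB: "acyclic_on (D - B)"
    unfolding acyclic_on_def
  proof (intro allI impI)
    fix Z assume Z: "Z \<subseteq> D - B" "Z \<noteq> {}"
    show "\<exists>v\<in>Z. \<forall>u\<in>Z. (u, v) \<notin> E"
    proof (cases "Z \<inter> B0 = {}")
      case True
      then have "Z \<subseteq> D - B0" using Z by blast
      then show ?thesis using acyclic_on_source[OF P1(2)] Z(2) by blast
    next
      case False
      then obtain b where b: "b \<in> Z" "b \<in> B0" by blast
      obtain i where i: "e b = (p ^^ i) b" using e b by blast
      have "e b \<notin> Z" using b Z unfolding B_def by blast
      then have "(p ^^ i) b \<notin> Z" using i by simp
      then obtain j where "(p ^^ j) b \<in> Z" "p ((p ^^ j) b) \<notin> Z" using orbit_leaves b by metis
      then show ?thesis using uniqp[OF b(2)] Z(1) by blast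
    qed
  qed
  \<comment> \<open>Losing a vertex of \<open>K\<close> would break one of the cycles and lower the
    feedback number; so later settling words cannot remove any of \<open>K\<close>.\<close>
  have keepK: "K \<subseteq> D'" if "D' \<subseteq> D" "\<And>A. acyclic_on (D' - A) \<Longrightarrow> k \<le> card A" for D'
  proof (rule ccontr)
    assume "\<not> K \<subseteq> D'"
    then obtain c where c: "c \<in> K" "c \<notin> D'" by blast
    then obtain b i where b: "b \<in> B" "c = (p ^^ i) b" using orbits unfolding orbits_def by blast
    have "acyclic_on (D' - (B - {b}))"
    proof (rule broken_cycle_acy[of D p b B D' i])
      show "u = p ((p ^^ j) b)" if "u \<in> D" "(u, (p ^^ j) b) \<in> E" for j u
        using that uniqK itK b BK by blast
    qed (use acyB that(1) b c in auto)
    then have "k \<le> card (B - {b})" by (rule that(2))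
    then show False using b cB k0 by simp
  qed
  have BD: "B \<subseteq> D" using BK KD by blast
  have "\<not> lowers (card (D - B) + 1) k x1 y1"
    unfolding x1_def y1_def
    by (rule nl') (use l1 cardD[OF BD cB] k0 kn in linarith)
  then obtain w2 where w2: "set w2 \<subseteq> D - B" "length w2 = card (D - B)"
      and min2: "minimal_fvs (run net w2 x1) (run net w2 y1) k"
      and per2: "perfect (run net w2 x1) (run net w2 y1) B"
    using to_perfect[of B x1 y1 k, folded D_def] acyB cB BD by blast
  define x2 y2 where "x2 = run net w2 x1" and "y2 = run net w2 y1"
  have l2: "length w2 \<le> ?n - k" using w2 cardD[OF BD cB] by simp
  have D2: "dif x2 y2 \<subseteq> D"
    using dif_run[of w2 "D - B" x1 y1] w2(1) unfolding x2_def y2_def D_def by blast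
  \<comment> \<open>Exchanging the states on \<open>F\<close> makes all of \<open>B\<close> True in
    \<open>x\<close>. Then the true literals from outside the difference set are coherent inputs of
    \<open>B\<close>.\<close>
  define F where "F = {b \<in> B. \<not> x2 b}"
  have FB: "F \<subseteq> B" unfolding F_def by blast
  have cF: "card F \<le> k" using card_mono[OF _ FB] cB by simp
  have "\<not> lowers (card F) k x2 y2"
    using nl'[of "w1 @ w2" "card F"] l1 l2 cF kn unfolding x2_def y2_def x1_def y1_def
    by (auto simp: run_append)
  then obtain w3 where w3: "length w3 = card F" "run net w3 x2 = swap_on F x2 y2" "run net w3 y2 = swap_on F y2 x2"
    using flip_feedback[OF per2 cB min2 FB] unfolding x2_def y2_def by blast
  note P2 = perfectD[OF per2, folded x2_def y2_def]
  define x3 y3 where "x3 = swap_on F x2 y2" and "y3 = swap_on F y2 x2"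
  have D3: "dif x3 y3 = dif x2 y2" unfolding x3_def y3_def by simp
  have B3: "B \<subseteq> dif x3 y3" "acyclic_on (dif x3 y3 - B)" unfolding D3 using P2(1,2) by blast+
  have x3: "x3 = run net (w1 @ w2 @ w3) x" "y3 = run net (w1 @ w2 @ w3) y"
    using w3(2,3) unfolding x3_def y3_def x2_def y2_def x1_def y1_def by (simp_all add: run_append)
  have "\<not> lowers (card (dif x3 y3 - B) + 1) k x3 y3"
    unfolding x3 using l1 l2 w3(1) cF kn k0 cardD[OF B3(1) cB]
    by (intro nl') (simp add: x3[symmetric])
  then obtain w4 where w4: "set w4 \<subseteq> dif x3 y3 - B" "length w4 = card (dif x3 y3 - B)"
      and min4: "minimal_fvs (run net w4 x3) (run net w4 y3) k"
      and per4: "perfect (run net w4 x3) (run net w4 y3) B"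
    using to_perfect[OF B3 cB] by blast
  define x4 y4 where "x4 = run net w4 x3" and "y4 = run net w4 y3"
  note P4 = perfectD[OF per4, folded x4_def y4_def]
  have D4: "dif x4 y4 \<subseteq> D"
    using dif_run[of w4 "dif x3 y3 - B" x3 y3] w4(1) D2 D3 unfolding x4_def y4_def by blast
  have K4: "K \<subseteq> dif x4 y4"
    using min4 D4 unfolding minimal_fvs_def x4_def[symmetric] y4_def[symmetric]
    by (intro keepK) blast+
  have x4B: "x4 b" if "b \<in> B" for b
  proof -
    have "b \<notin> set w4" using w4(1) that by blast
    then have "x4 b = x3 b" unfolding x4_def by (rule run_other)
    moreover have "x3 b" using that P2(1) by (auto simp: x3_def swap_on_def F_def dif_iff)
    ultimately show ?thesis by simp
  qed
  have "ready x4 y4 B K p"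
    unfolding ready_def
  proof (intro conjI ballI allI impI)
    fix c assume c: "c \<in> K"
    show "p c \<in> K" using pK c .
    show "(p c, c) \<in> E" using p c KD by blast
    show "u = p c" if "u \<in> dif x4 y4" "(u, c) \<in> E" for u using uniqK c that D4 by blast
    show "lit x4 u c" if "(u, c) \<in> E" "u \<notin> dif x4 y4" for u
      using differ_lit[OF P4(7) that(1)] that(2) c K4 by auto
  next
    fix v assume v: "v \<in> dif x4 y4 - B"
    obtain u where "u \<in> dif x4 y4" "(u, v) \<in> E" using differ_input[OF P4(7)] v by blast
    then show "\<exists>u\<in>dif x4 y4. coh x4 u v" using sat_coh P4(3,4) v by blast
  next
    fix b assume b: "b \<in> B"
    show "x4 b" using x4B[OF b] .
    then show "\<exists>j. (j, b) \<in> E \<and> j \<notin> dif x4 y4" using e b D4 unfolding B_def by blast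
  qed (use BK K4 in auto)
  moreover have "x4 = run net (w1 @ w2 @ w3 @ w4) x" "y4 = run net (w1 @ w2 @ w3 @ w4) y"
    unfolding x4_def y4_def x3 by (simp_all add: run_append)
  moreover have "length (w1 @ w2 @ w3 @ w4) \<le> 3 * (?n - k) + k"
    using l1 l2 w3(1) cF w4(2) cardD[OF B3(1) cB] by simp
  ultimately show False using c cB orbits by metis
qed


section \<open>Updates outside the difference set that keep the cycles oscillating\<close>

lemma ready_cong:
  assumes r: "ready x y B K p" and d: "dif x' y' = dif x y"
    and "\<And>i. i \<in> dif x y \<Longrightarrow> x' i = x i" "\<And>c u. c \<in> K \<Longrightarrow> (u, c) \<in> E \<Longrightarrow> x' u = x u"
  shows "ready x' y' B K p"
proof -
  note R = readyD[OF r]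
  show ?thesis
    unfolding ready_def d
  proof (intro conjI ballI allI impI)
    fix v assume v: "v \<in> dif x y - B"
    then obtain u where "u \<in> dif x y" "coh x u v" using R(6) by blast
    then show "\<exists>u\<in>dif x y. coh x' u v" using v assms(3) by (auto simp: coh_def)
  next
    fix b assume "b \<in> B"
    then show "x' b" using R(1,2,8) assms(3) by blast
  qed (use R assms(4) in \<open>auto simp del: not_ex\<close>)
qed

text \<open>The new vertex is coherent with its differing inputs by \<open>differ_lit\<close>, and
  as it feeds no vertex of \<open>K\<close>, the cycles stay isolated.\<close>

lemma ready_grow:
  assumes r: "ready x y B K p" and v: "v \<notin> dif x y" "\<And>c. c \<in> K \<Longrightarrow> (v, c) \<notin> E"
    and ne: "net x v \<noteq> net y v"
  shows "ready (upd net v x) (upd net v y) B K p"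
proof -
  note R = readyD[OF r]
  have d: "dif (upd net v x) (upd net v y) = insert v (dif x y)" using ne by (simp add: dif_upd)
  obtain u where u: "u \<in> dif x y" "(u, v) \<in> E" using differ_input[OF ne] by blast
  have uv: "coh (upd net v x) u v"
    using differ_lit[OF ne u(2)] u v(1) by (auto simp: coh_def upd_def)
  have nv: "i \<noteq> v" if "i \<in> dif x y" for i using that v(1) by blast
  show ?thesis
    unfolding ready_def d
  proof (intro conjI ballI allI impI)
    show "K \<subseteq> insert v (dif x y)" using R(2) by blast
    fix w assume w: "w \<in> insert v (dif x y) - B"
    show "\<exists>u\<in>insert v (dif x y). coh (upd net v x) u w"
    proof (cases "w = v")
      case True
      then show ?thesis using u uv by blast
    next
      case False
      then obtain t where "t \<in> dif x y" "coh x t w" using R(6)[of w] w by blast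
      then show ?thesis using nv False by (auto simp: coh_def)
    qed
  next
    fix c u assume "c \<in> K" "u \<in> insert v (dif x y)" "(u, c) \<in> E"
    then show "u = p c" using R(5) v(2) by blast
  next
    fix c u assume "c \<in> K" "(u, c) \<in> E" "u \<notin> insert v (dif x y)"
    then show "lit (upd net v x) u c" using R(7) by simp
  next
    fix b assume b: "b \<in> B"
    then show "upd net v x b" using R(1,2,8) nv by (metis subsetD upd_neq)
    obtain j where "(j, b) \<in> E" "j \<notin> dif x y" using R(9)[OF b] by blast
    then show "\<exists>j. (j, b) \<in> E \<and> j \<notin> insert v (dif x y)" using v(2) b R(1) by blast
  qed (use R in auto)
qed

lemma ready_joint:
  assumes "ready x y B K p" and v: "v \<notin> dif x y" "\<And>c. c \<in> K \<Longrightarrow> (v, c) \<notin> E"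
    and "net x v = net y v"
  shows "ready (upd net v x) (upd net v y) B K p" "dif (upd net v x) (upd net v y) = dif x y"
proof -
  show d: "dif (upd net v x) (upd net v y) = dif x y" using assms by (simp add: dif_upd)
  show "ready (upd net v x) (upd net v y) B K p"
  proof (rule ready_cong[OF assms(1) d])
    show "upd net v x i = x i" if "i \<in> dif x y" for i using that v(1) by (cases "i = v") auto
    show "upd net v x u = x u" if "c \<in> K" "(u, c) \<in> E" for c u using that v(2) by (cases "u = v") auto
  qed
qed

lemma ready_joint_run:
  assumes "ready x y B K p" "set w \<subseteq> U" "U \<inter> dif x y = {}"
    and "\<And>u c. u \<in> U \<Longrightarrow> c \<in> K \<Longrightarrow> (u, c) \<notin> E"
    and "\<And>d u. d \<in> dif x y \<Longrightarrow> u \<in> U \<Longrightarrow> (d, u) \<notin> E"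
  shows "ready (run net w x) (run net w y) B K p \<and> dif (run net w x) (run net w y) = dif x y"
  using assms
proof (induction w arbitrary: x y)
  case (Cons v w)
  have v: "v \<in> U" "v \<notin> dif x y" using Cons.prems by auto
  have "net x v = net y v" using differ_input[of x v y] Cons.prems(5) v(1) by blast
  then have r: "ready (upd net v x) (upd net v y) B K p" "dif (upd net v x) (upd net v y) = dif x y"
    using ready_joint[OF Cons.prems(1) v(2)] Cons.prems(4)[OF v(1)] by blast+
  show ?case using Cons.IH[OF r(1)] Cons.prems r(2) by simp
qed simp

text \<open>Only the first state is required to flip \<open>z\<close>; what happens in the second is
  sorted out in \<open>struck_lowers\<close>.\<close>

definition hits :: "nat \<Rightarrow> ('v \<Rightarrow> bool) \<Rightarrow> ('v \<Rightarrow> bool) \<Rightarrow> 'v set \<Rightarrow> 'v set \<Rightarrow> ('v \<Rightarrow> 'v) \<Rightarrow> bool" where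
  "hits n x y B K p \<longleftrightarrow> (\<exists>w. length w \<le> n \<and> ready (run net w x) (run net w y) B K p \<and>
     (\<exists>z. z \<notin> dif (run net w x) (run net w y) \<and> (\<exists>c\<in>K. (z, c) \<in> E) \<and>
        net (run net w x) z \<noteq> run net w x z))"

lemma hits_0:
  "ready x y B K p \<Longrightarrow> z \<notin> dif x y \<Longrightarrow> c \<in> K \<Longrightarrow> (z, c) \<in> E \<Longrightarrow> net x z \<noteq> x z \<Longrightarrow> hits n x y B K p"
  unfolding hits_def by (intro exI[of _ "[]"]) auto

lemma hits_run:
  assumes "hits n (run net w x) (run net w y) B K p" "length w + n \<le> m"
  shows "hits m x y B K p"
proof -
  obtain w' where "length w' \<le> n" "ready (run net (w @ w') x) (run net (w @ w') y) B K p"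
     "\<exists>z. z \<notin> dif (run net (w @ w') x) (run net (w @ w') y) \<and> (\<exists>c\<in>K. (z, c) \<in> E) \<and>
        net (run net (w @ w') x) z \<noteq> run net (w @ w') x z"
    using assms(1) unfolding hits_def run_append by blast
  then show ?thesis using assms(2) unfolding hits_def by (intro exI[of _ "w @ w'"]) simp
qed

lemma hits_upd: "hits n (upd net v x) (upd net v y) B K p \<Longrightarrow> Suc n \<le> m \<Longrightarrow> hits m x y B K p"
  using hits_run[of n "[v]" x y B K p m] by simp

end

context strong_and_net
begin

text \<open>As long as no input of \<open>K\<close> changes, the common part of the two states is updated jointly, except
  that vertices with an input in the difference set may join it; such a vertex stays frozen from
  then on. Coherent completion outside the difference set makes every vertex coherent except
  common inputs of \<open>K\<close> and of the difference set, so one of these has to flip.\<close>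

lemma reach_hit:
  assumes "ready x y B K p" "B \<noteq> {}"
  shows "hits (flip_cost (card (- dif x y)) + card (- dif x y)) x y B K p"
  using assms(1)
proof (induction "card (- dif x y)" arbitrary: x y rule: less_induct)
  case less
  define D where "D = dif x y"
  define k where "k = card (- D)"
  define J where "J = {j. j \<notin> D \<and> (\<exists>c\<in>K. (j, c) \<in> E)}"
  define W where "W = {w. w \<notin> D \<and> (\<exists>d\<in>D. (d, w) \<in> E)}"
  \<comment> \<open>The True vertices of \<open>W\<close> without a coherent input in
    \<open>D\<close>. Their image in \<open>x\<close> is False; an update removes one of them,
    unless it is a hit or joins the difference set.\<close>
  define NG where "NG x = {w \<in> W. x w \<and> (\<forall>d\<in>D. (d, w) \<in> E \<longrightarrow> \<not> lit x d w)}" for x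
  define m where "m = card (J \<union> W)"
  \<comment> \<open>The budget once \<open>NG\<close> is empty: a coherent completion on the
    \<open>k - m\<close> vertices outside \<open>D\<close>, \<open>J\<close> and \<open>W\<close>,
    and, if some vertex of \<open>W\<close> may still join \<open>D\<close>, its update and the
    recursive call with \<open>k - 1\<close>.\<close>
  define R where "R = (if W \<subseteq> J then flip_cost (k - m)
      else flip_cost (k - m) + 1 + (flip_cost (k - 1) + (k - 1)))"
  note R0 = readyD[OF less.prems, folded D_def]
  have JW: "J \<union> W \<subseteq> - D" unfolding J_def W_def by blast
  have mk: "m \<le> k" unfolding m_def k_def using JW by (intro card_mono) auto
  have grow: "hits (Suc (flip_cost (k - 1) + (k - 1))) x y B K p"
    if r: "ready x y B K p" and d: "dif x y = D" and v: "v \<in> W - J" and ne: "net x v \<noteq> net y v" for x y v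
  proof -
    have vD: "v \<notin> dif x y" using v d unfolding W_def by blast
    have d': "dif (upd net v x) (upd net v y) = insert v D" using ne d by (simp add: dif_upd)
    have "- insert v D = - D - {v}" by blast
    then have c: "card (- dif (upd net v x) (upd net v y)) = k - 1"
      unfolding d' k_def using vD d by simp
    have "0 < k" unfolding k_def using vD d by (auto simp: card_gt_0_iff)
    then have "k - 1 < card (- D)" unfolding k_def by simp
    moreover have "ready (upd net v x) (upd net v y) B K p"
      using v d ready_grow[OF r vD _ ne] unfolding J_def W_def by blast
    ultimately have "hits (flip_cost (k - 1) + (k - 1)) (upd net v x) (upd net v y) B K p"
      using less.hyps[of "upd net v x" "upd net v y"] c unfolding D_def by simp
    then show ?thesis by (rule hits_upd) simp
  qed
  have main: "hits (card (NG x) + R) x y B K p" if "ready x y B K p" "dif x y = D" for x y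
    using that
  proof (induction "card (NG x)" arbitrary: x y)
    case 0
    then have NG0: "NG x = {}" by simp
    note r = readyD[OF 0(2), unfolded 0(3)]
    define U where "U = - (D \<union> J \<union> W)"
    have cU: "card U = k - m"
    proof -
      have "U = - D - (J \<union> W)" unfolding U_def by blast
      then show ?thesis unfolding k_def m_def using JW by (simp add: card_Diff_subset)
    qed
    have "B \<subseteq> D" using r(1,2) by blast
    then have "U \<subset> UNIV" using assms(2) unfolding U_def by blast
    then obtain w where w: "set w \<subseteq> U" "length w \<le> flip_cost (card U)"
        "\<forall>v\<in>U. \<exists>u\<in>UNIV. coh (run net w x) u v"
      using coherent_completion[of U UNIV x] strong has_input by auto
    define x' y' where "x' = run net w x" and "y' = run net w y"
    have r': "ready x' y' B K p" "dif x' y' = D"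
      using ready_joint_run[OF 0(2) w(1)] 0(3) unfolding U_def J_def W_def x'_def y'_def by blast+
    have out: "x' i = x i" if "i \<notin> U" for i
      unfolding x'_def using w(1) that by (intro run_other) blast
    have "hits (R - flip_cost (card U)) x' y' B K p"
    proof -
      \<comment> \<open>All of \<open>D\<close> has coherent inputs, \<open>B\<close> from outside
        \<open>D\<close>, and so has \<open>U\<close> by completion. Hence \<open>z\<close> lies in
        \<open>J\<close> or \<open>W\<close>.\<close>
      obtain z where z: "\<And>u. \<not> coh x' u z" using no_coherent_set[of UNIV x'] by blast
      have zD: "z \<notin> D"
      proof
        assume "z \<in> D"
        show False
        proof (cases "z \<in> B")
          case True
          obtain j where j: "(j, z) \<in> E" "j \<notin> D" using readyD(9)[OF r'(1) True] r'(2) by blast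
          have "z \<in> K" using True r(1) by blast
          then have "lit x' j z" using readyD(7)[OF r'(1)] j r'(2) by blast
          then have "coh x' j z" using readyD(8)[OF r'(1) True] j by (simp add: coh_def)
          then show False using z by blast
        next
          case False
          then show False using readyD(6)[OF r'(1), of z] r'(2) \<open>z \<in> D\<close> z by blast
        qed
      qed
      have zU: "z \<notin> U" using w(3) z unfolding x'_def by blast
      have fz: "net x' z \<noteq> x' z"
      proof (cases "x' z")
        case True
        obtain u where "(u, z) \<in> E" using has_input by blast
        then have "\<not> lit x' u z" using z[of u] True by (simp add: coh_def)
        then show ?thesis using True netD \<open>(u, z) \<in> E\<close> by blast
      next
        case False
        then have "lit x' u z" if "(u, z) \<in> E" for u using z[of u] that by (simp add: coh_def)
        then show ?thesis using False not_netD by blast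
      qed
      show ?thesis
      proof (cases "z \<in> J")
        case True
        then show ?thesis using hits_0[OF r'(1)] r'(2) fz zD unfolding J_def by blast
      next
        case False
        then have zW: "z \<in> W - J" using zU zD unfolding U_def by blast
        then obtain d where d: "d \<in> D" "(d, z) \<in> E" unfolding W_def by blast
        \<comment> \<open>With \<open>NG\<close> empty, a True vertex of \<open>W\<close> has a
          coherent input in \<open>D\<close>. So \<open>z\<close> is False and about to become True
          in \<open>x'\<close> but not in \<open>y'\<close>: it joins the difference set.\<close>
        have "\<not> x' z"
        proof
          assume xz: "x' z"
          then have "x z" using out[of z] zU by simp
          then obtain d where d: "d \<in> D" "(d, z) \<in> E" "lit x d z" using NG0 zW unfolding NG_def by blast
          then have "x' d = x d" using out[of d] unfolding U_def by blast
          then have "coh x' d z" using d xz by (simp add: coh_def)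
          then show False using z by blast
        qed
        then have t: "net x' z" using fz by simp
        then have "\<not> lit y' d z" using netD[OF t d(2)] d(1) r'(2) by (auto simp: dif_iff)
        then have "net x' z \<noteq> net y' z" using netD d(2) t by blast
        then have "hits (Suc (flip_cost (k - 1) + (k - 1))) x' y' B K p" using grow[OF r' zW] by blast
        moreover have "R - flip_cost (card U) = Suc (flip_cost (k - 1) + (k - 1))"
          using zW cU unfolding R_def by auto
        ultimately show ?thesis by simp
      qed
    qed
    then show ?case unfolding x'_def y'_def
    proof (rule hits_run)
      have "flip_cost (card U) \<le> R" unfolding R_def cU by simp
      then show "length w + (R - flip_cost (card U)) \<le> card (NG x) + R" using w(2) by simp
    qed
  next
    case (Suc g)
    obtain v where v: "v \<in> NG x" using Suc.hyps(2) by (metis card_gt_0_iff ex_in_conv zero_less_Suc)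
    have xv: "x v" "v \<in> W" "v \<notin> D" using v unfolding NG_def W_def by auto
    obtain d where d: "d \<in> D" "(d, v) \<in> E" using xv(2) unfolding W_def by blast
    then have nx: "\<not> net x v" using v netD unfolding NG_def by blast
    show ?case
    proof (cases "v \<in> J")
      case True
      then show ?thesis using hits_0[OF Suc.prems(1), of v] xv nx Suc.prems(2) unfolding J_def by blast
    next
      case False
      show ?thesis
      proof (cases "net y v")
        case True
        then have "hits (Suc (flip_cost (k - 1) + (k - 1))) x y B K p"
          using grow[OF Suc.prems, of v] nx False xv by blast
        moreover have "Suc (flip_cost (k - 1) + (k - 1)) \<le> R" using xv(2) False unfolding R_def by auto
        ultimately show ?thesis using hits_run[of _ "[]" x y B K p "card (NG x) + R"] by simp
      next
        case ny: False
        have r: "ready (upd net v x) (upd net v y) B K p" "dif (upd net v x) (upd net v y) = D"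
          using ready_joint[OF Suc.prems(1), of v] Suc.prems(2) xv False nx ny unfolding J_def by auto
        have "NG (upd net v x) = NG x - {v}"
        proof (rule set_eqI)
          fix w
          have "upd net v x d = x d" if "d \<in> D" for d using that xv(3) by (cases "d = v") auto
          then show "w \<in> NG (upd net v x) \<longleftrightarrow> w \<in> NG x - {v}"
            using nx unfolding NG_def by (cases "w = v") auto
        qed
        then have g: "g = card (NG (upd net v x))" using Suc.hyps(2) v by simp
        have "hits (g + R) (upd net v x) (upd net v y) B K p" using Suc.hyps(1)[OF g r] g by simp
        then show ?thesis by (rule hits_upd) (use Suc.hyps(2) in simp)
      qed
    qed
  qed
  show ?case
  proof (cases "NG x \<inter> J = {}")
    case False
    then obtain v where v: "v \<in> NG x" "v \<in> J" by blast
    then obtain d where "d \<in> D" "(d, v) \<in> E" "\<not> lit x d v" unfolding NG_def W_def by blast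
    then have "\<not> net x v" using netD by blast
    then show ?thesis using hits_0[OF less.prems, of v] v unfolding NG_def W_def J_def D_def by blast
  next
    case True
    have "card (NG x) + R \<le> flip_cost k + k"
    proof (cases "W \<subseteq> J")
      case True
      then have "NG x = {}" using \<open>NG x \<inter> J = {}\<close> unfolding NG_def by blast
      then show ?thesis using True flip_cost_mono[of "k - m" k] unfolding R_def by simp
    next
      case WJ: False
      obtain b where "b \<in> B" using assms(2) by blast
      then have "J \<noteq> {}" using R0(1,9) unfolding J_def by blast
      then have cJ: "1 \<le> card J" by (metis One_nat_def Suc_leI card_gt_0_iff finite)
      have "NG x \<subseteq> W - J" using True unfolding NG_def by blast
      then have "card (NG x) \<le> card (W - J)" by (intro card_mono) auto
      moreover have "m = card J + card (W - J)" unfolding m_def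
        by (metis Un_Diff_cancel card_Un_disjoint Diff_disjoint finite)
      moreover have "1 \<le> card (W - J)" using WJ by (metis One_nat_def Suc_leI card_gt_0_iff finite Diff_eq_empty_iff)
      ultimately have a: "card (NG x) \<le> m - 1" "2 \<le> m" using cJ by linarith+
      \<comment> \<open>The completion spares the \<open>m\<close> vertices of \<open>J\<close> and
        \<open>W\<close>, and \<open>flip_cost\<close> drops by at least one for each; this pays for
        emptying \<open>NG\<close>, which has at most \<open>m - 1\<close> members as
        \<open>J\<close> is nonempty.\<close>
      have "flip_cost (k - 2 - (m - 2)) + (m - 2) \<le> flip_cost (k - 2)"
        using mk a by (intro flip_cost_diff) simp
      moreover have "k - 2 - (m - 2) = k - m" using a mk by simp
      ultimately have "flip_cost (k - m) + (m - 2) \<le> flip_cost (k - 2)" by simp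
      moreover have "flip_cost k = flip_cost (k - 1) + flip_cost (k - 2) + 2"
        using a mk by (intro flip_cost_rec) simp
      ultimately show ?thesis using WJ a mk unfolding R_def by simp
    qed
    then show ?thesis
      using hits_run[of "card (NG x) + R" "[]" x y B K p] main[OF less.prems] unfolding D_def k_def by simp
  qed
qed

end

section \<open>Turning around a cycle that has been hit\<close>

text \<open>\<open>cs\<close> lists the cycle along its arcs from \<open>b\<close>, so one run of
  \<open>cs\<close> is one turn. \<open>D\<close> is the difference set at the moment of the hit and
  stays fixed while the states change.\<close>

locale struck = and_net E q for E :: "('v::finite \<times> 'v) set" and q +
  fixes B D :: "'v set" and cs :: "'v list" and p :: "'v \<Rightarrow> 'v" and b z c0 :: 'v
  assumes cs: "cs \<noteq> []" "distinct cs" "cs ! 0 = b"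
    and chain: "\<And>i. Suc i < length cs \<Longrightarrow> p (cs ! Suc i) = cs ! i" "p b = last cs"
    and parc: "\<And>c. c \<in> set cs \<Longrightarrow> (p c, c) \<in> E"
    and around: "\<And>c e. c \<in> set cs \<Longrightarrow> e \<in> set cs \<Longrightarrow> \<exists>j. (p ^^ j) c = e"
    and BC: "B \<inter> set cs = {b}" "B \<union> set cs \<subseteq> D"
    and z: "z \<notin> D" "c0 \<in> set cs" "(z, c0) \<in> E"
    and isolated: "\<And>c u. c \<in> set cs \<Longrightarrow> u \<in> D \<Longrightarrow> (u, c) \<in> E \<Longrightarrow> u = p c"
begin

abbreviation C :: "'v set" where "C \<equiv> set cs"

lemma bB: "b \<in> B" "b \<in> C"
  using BC by auto

lemma zC: "z \<notin> C" "z \<notin> B"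
  using BC z by auto

lemma pC: "c \<in> C \<Longrightarrow> p c \<in> C"
proof -
  assume "c \<in> C"
  then obtain i where "i < length cs" "c = cs ! i" by (metis in_set_conv_nth)
  then show ?thesis using chain cs by (cases i) auto
qed

lemma other_inputs: "c \<in> C \<Longrightarrow> (u, c) \<in> E \<Longrightarrow> u \<noteq> p c \<Longrightarrow> u \<notin> D"
  using isolated by blast

text \<open>No input other than the cycle predecessor blocks \<open>c\<close>, so \<open>c\<close>
  just copies the literal of \<open>p c\<close>.\<close>

definition ok :: "('v \<Rightarrow> bool) \<Rightarrow> 'v \<Rightarrow> bool" where
  "ok x c \<longleftrightarrow> (\<forall>u. (u, c) \<in> E \<longrightarrow> u \<noteq> p c \<longrightarrow> lit x u c)"

lemma net_ok: "c \<in> C \<Longrightarrow> net x c \<longleftrightarrow> ok x c \<and> lit x (p c) c"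
  using parc unfolding net_def ok_def by blast

lemma ok_cong: "c \<in> C \<Longrightarrow> (\<And>i. i \<notin> C \<Longrightarrow> x i = y i) \<Longrightarrow> ok x c = ok y c"
  using other_inputs BC unfolding ok_def by (metis UnCI subsetD)

text \<open>In one turn the head of the list still reads the old value of the last vertex; every
  other vertex reads its predecessor after the update.\<close>

lemma pass_nth:
  assumes "i < length cs"
  shows "run net cs x (cs ! i) = (ok x (cs ! i) \<and>
    (if i = 0 then lit x (last cs) (cs ! 0) else lit (run net cs x) (cs ! (i - 1)) (cs ! i)))"
proof -
  let ?c = "cs ! i" and ?s = "run net (take i cs) x"
  have split: "cs = take i cs @ cs ! i # drop (Suc i) cs" using assms by (rule id_take_nth_drop)
  have r: "run net cs x = run net (drop (Suc i) cs) (upd net ?c ?s)"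
    by (subst split) (simp add: run_append)
  have dd: "distinct (take i cs @ cs ! i # drop (Suc i) cs)" using cs(2) split by metis
  then have nd: "?c \<notin> set (drop (Suc i) cs)" by simp
  have val: "run net cs x ?c = net ?s ?c" unfolding r by (simp add: run_other[OF nd])
  have cC: "?c \<in> C" using assms by simp
  have "ok ?s ?c = ok x ?c"
  proof (rule ok_cong[OF cC])
    fix j assume "j \<notin> C"
    then have "j \<notin> set (take i cs)" using set_take_subset[of i cs] by blast
    then show "?s j = x j" by (rule run_other)
  qed
  then have v2: "run net cs x ?c = (ok x ?c \<and> lit ?s (p ?c) ?c)" unfolding val using net_ok[OF cC] by simp
  show ?thesis
  proof (cases i)
    case 0
    then show ?thesis using v2 chain(2) cs(3) by simp
  next
    case (Suc j)
    have j: "j < length cs" using assms Suc by simp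
    have "cs ! j \<notin> set (drop (Suc i) cs)" "cs ! j \<noteq> ?c"
    proof -
      have "cs ! j \<in> set (take i cs)" using Suc j by (auto simp: in_set_conv_nth intro!: exI[of _ j])
      then show "cs ! j \<notin> set (drop (Suc i) cs)" "cs ! j \<noteq> ?c" using dd by auto
    qed
    then have "run net cs x (cs ! j) = ?s (cs ! j)" unfolding r by (simp add: run_other)
    then show ?thesis using v2 chain(1)[of j] assms Suc by simp
  qed
qed

lemma run_cs_other: "i \<notin> C \<Longrightarrow> run net (cs @ cs) x i = x i"
  by (rule run_other) simp

text \<open>The conflict at \<open>b\<close> is carried once around the cycle, so a free turn
  complements it and two turns restore it.\<close>

lemma pass_flips:
  assumes ok: "\<And>c. c \<in> C \<Longrightarrow> ok x c" and sat: "\<And>c. c \<in> C \<Longrightarrow> c \<noteq> b \<Longrightarrow> x c = lit x (p c) c"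
    and conf: "x b \<noteq> lit x (p b) b"
  shows "c \<in> C \<Longrightarrow> run net cs x c = (\<not> x c)"
proof -
  have "run net cs x (cs ! i) = (\<not> x (cs ! i))" if "i < length cs" for i
    using that
  proof (induction i)
    case 0
    then show ?case using pass_nth[of 0 x] ok[of "cs ! 0"] conf chain(2) cs by auto
  next
    case (Suc i)
    have cC: "cs ! Suc i \<in> C" using Suc.prems by simp
    have "cs ! Suc i \<noteq> b" using cs Suc.prems nth_eq_iff_index_eq[of cs "Suc i" 0] by auto
    then have "x (cs ! Suc i) = lit x (cs ! i) (cs ! Suc i)" using sat[OF cC] chain(1)[OF Suc.prems] by simp
    then show ?case using pass_nth[OF Suc.prems, of x] ok[OF cC] Suc by auto
  qed
  then show "c \<in> C \<Longrightarrow> run net cs x c = (\<not> x c)" by (metis in_set_conv_nth)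
qed

lemma two_turns_free:
  assumes ok: "\<And>c. c \<in> C \<Longrightarrow> ok x c" and sat: "\<And>c. c \<in> C \<Longrightarrow> c \<noteq> b \<Longrightarrow> x c = lit x (p c) c"
    and conf: "x b \<noteq> lit x (p b) b"
  shows "run net (cs @ cs) x = x"
proof (rule ext)
  fix i
  let ?x = "run net cs x"
  have fl: "?x c = (\<not> x c)" if "c \<in> C" for c using pass_flips[OF ok sat conf that] by blast
  have off: "?x i = x i" if "i \<notin> C" for i using that by (rule run_other)
  show "run net (cs @ cs) x i = x i"
  proof (cases "i \<in> C")
    case True
    have "run net cs ?x i = (\<not> ?x i)"
    proof (rule pass_flips[OF _ _ _ True])
      show "ok ?x c" if "c \<in> C" for c using ok_cong[OF that, of ?x x] off ok[OF that] by blast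
      show "?x c = lit ?x (p c) c" if "c \<in> C" "c \<noteq> b" for c
        using fl[OF that(1)] fl[OF pC[OF that(1)]] sat[OF that] by auto
      show "?x b \<noteq> lit ?x (p b) b" using fl[OF bB(2)] fl[OF pC[OF bB(2)]] conf by auto
    qed
    then show ?thesis using fl[OF True] by (simp add: run_append)
  next
    case False
    then show ?thesis by (rule run_cs_other)
  qed
qed

text \<open>The blocked vertex becomes False in both turns, so the turns agree from there to the end
  of the list. Hence the head reads in the second turn the value that the last vertex finally has,
  and the cycle is at rest.\<close>

lemma two_turns_forced:
  assumes e: "e \<in> C" "\<not> ok x e" and c: "c \<in> C"
  shows "net (run net (cs @ cs) x) c = run net (cs @ cs) x c"
proof -
  let ?x1 = "run net cs x" and ?x2 = "run net (cs @ cs) x"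
  have x2: "?x2 = run net cs ?x1" by (simp add: run_append)
  have ok1: "ok ?x1 c = ok x c" "ok ?x2 c = ok x c" if "c \<in> C" for c
    using ok_cong[OF that, of ?x1 x] ok_cong[OF that, of ?x2 x] run_other[of _ cs net x] run_cs_other by blast+
  obtain m where m: "m < length cs" "e = cs ! m" using e(1) by (metis in_set_conv_nth)
  have eq: "?x2 (cs ! i) = ?x1 (cs ! i)" if "m \<le> i" "i < length cs" for i
    using that
  proof (induction i rule: dec_induct)
    case base
    then show ?case using pass_nth[OF m(1), of x] pass_nth[OF m(1), of ?x1] e m ok1[OF e(1)] x2 by simp
  next
    case (step i)
    have "cs ! Suc i \<in> C" using step.prems by simp
    then show ?case using pass_nth[OF step.prems, of x] pass_nth[OF step.prems, of ?x1] step x2 ok1 by simp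
  qed
  have last: "?x2 (last cs) = ?x1 (last cs)"
    using eq[of "length cs - 1"] m(1) cs(1) by (simp add: last_conv_nth)
  obtain i where i: "i < length cs" "c = cs ! i" using c by (metis in_set_conv_nth)
  show ?thesis
  proof (cases i)
    case 0
    then show ?thesis
      using net_ok[OF c, of ?x2] pass_nth[OF i(1), of ?x1] i last x2 ok1[OF c] chain(2) cs(3) by simp
  next
    case (Suc j)
    then show ?thesis
      using net_ok[OF c, of ?x2] pass_nth[OF i(1), of ?x1] i x2 ok1[OF c] chain(1)[of j] by simp
  qed
qed

text \<open>The blocked vertex is False in both states, and the other values follow from it along
  the cycle; the induction counts predecessor steps back to it.\<close>

lemma forced_unique:
  assumes "\<And>c. c \<in> C \<Longrightarrow> net x c = x c" "\<And>c. c \<in> C \<Longrightarrow> net y c = y c"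
    and "\<And>i. i \<notin> C \<Longrightarrow> (\<exists>c\<in>C. (i, c) \<in> E) \<Longrightarrow> x i = y i" and e: "e \<in> C" "\<not> ok x e" and c: "c \<in> C"
  shows "x c = y c"
proof -
  have ok: "ok x c = ok y c" if "c \<in> C" for c
    using other_inputs[OF that] assms(3) that BC unfolding ok_def by (metis UnCI subsetD)
  have "x c = y c" if "(p ^^ j) c = e" "c \<in> C" for j c
    using that
  proof (induction j arbitrary: c)
    case 0
    then have "\<not> ok x c" using e by simp
    then have "\<not> net x c" "\<not> net y c" using ok[OF 0(2)] net_ok[OF 0(2)] by blast+
    then show ?case using assms(1,2) 0(2) by blast
  next
    case (Suc j)
    have "x (p c) = y (p c)" using Suc.IH[of "p c"] Suc.prems pC by (simp add: funpow_swap1)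
    then have "net x c = net y c" using net_ok[OF Suc.prems(2)] ok[OF Suc.prems(2)] by simp
    then show ?case using assms(1,2) Suc.prems(2) by blast
  qed
  then show ?thesis using around[OF c e(1)] c by blast
qed

text \<open>\<open>P\<close> is the set of vertices still to be processed; vertices outside \<open>B\<close>, \<open>C\<close> and \<open>P\<close> that remain
  in the difference set have only coherent inputs there, where arcs at \<open>N\<close> are ignored.\<close>

definition invariant :: "('v \<Rightarrow> bool) \<Rightarrow> ('v \<Rightarrow> bool) \<Rightarrow> 'v set \<Rightarrow> 'v set \<Rightarrow> bool" where
  "invariant x y P N \<longleftrightarrow> P \<subseteq> D - B - C \<and> P \<union> B \<union> C \<subseteq> dif x y \<and> dif x y \<subseteq> insert z D \<and>
     (\<forall>v\<in>P. \<exists>u\<in>P \<union> B \<union> C. coh x u v) \<and>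
     (\<forall>v\<in>dif x y - B - C - P - N. \<forall>u\<in>dif x y - N. (u, v) \<in> E \<longrightarrow> coh x u v) \<and>
     (\<forall>c\<in>C - {b}. coh x (p c) c) \<and> x b \<and> \<not> lit x (p b) b \<and>
     (\<forall>c\<in>C. \<forall>u. (u, c) \<in> E \<longrightarrow> u \<noteq> p c \<longrightarrow> u \<noteq> z \<longrightarrow> lit x u c \<and> lit y u c)"

lemma invD:
  assumes "invariant x y P N"
  shows "P \<subseteq> D - B - C" "P \<subseteq> dif x y" "B \<subseteq> dif x y" "C \<subseteq> dif x y" "dif x y \<subseteq> insert z D"
    "\<And>v. v \<in> P \<Longrightarrow> \<exists>u\<in>P \<union> B \<union> C. coh x u v"
    "\<And>v u. v \<in> dif x y - B - C - P - N \<Longrightarrow> u \<in> dif x y - N \<Longrightarrow> (u, v) \<in> E \<Longrightarrow> coh x u v"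
    "\<And>c. c \<in> C - {b} \<Longrightarrow> coh x (p c) c" "x b" "\<not> lit x (p b) b"
    "\<And>c u. c \<in> C \<Longrightarrow> (u, c) \<in> E \<Longrightarrow> u \<noteq> p c \<Longrightarrow> u \<noteq> z \<Longrightarrow> lit x u c"
    "\<And>c u. c \<in> C \<Longrightarrow> (u, c) \<in> E \<Longrightarrow> u \<noteq> p c \<Longrightarrow> u \<noteq> z \<Longrightarrow> lit y u c"
  using assms unfolding invariant_def by blast+

text \<open>In whichever state \<open>w\<close> is False, its coherent input blocks it, so
  \<open>w\<close> keeps its value there; if the images differ, it keeps its value in the other
  state as well.\<close>

lemma coherent_input_step:
  assumes "w \<in> dif x y" "u \<in> dif x y" "coh x u w"
  shows "net x w = x w \<or> net y w = y w"
    "net x w \<noteq> net y w \<Longrightarrow> net x w = x w \<and> net y w = y w"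
  using assms netD[of x w u] netD[of y w u] unfolding coh_def dif_iff by metis+

text \<open>As \<open>w\<close> supports no vertex of \<open>P\<close>, the rest of \<open>P\<close>
  keeps its coherent inputs. If \<open>w\<close> stays in the difference set, it is at rest in both
  states, and \<open>sat_coh\<close> makes all its inputs there coherent.\<close>

lemma inv_step:
  assumes I: "invariant x y P N" and w: "w \<in> P" and sink: "\<And>v. v \<in> P \<Longrightarrow> \<not> coh x w v" and N: "N \<subseteq> {z}"
  shows "invariant (upd net w x) (upd net w y) (P - {w}) N" "net x w = x w \<or> net y w = y w"
proof -
  note i = invD[OF I]
  let ?x = "upd net w x" and ?y = "upd net w y"
  obtain u where u: "u \<in> P \<union> B \<union> C" "coh x u w" using i(6)[OF w] by blast
  have ud: "u \<in> dif x y" and wd: "w \<in> dif x y" using u(1) w i(2-4) by blast+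
  show "net x w = x w \<or> net y w = y w" using coherent_input_step(1)[OF wd ud u(2)] .
  have keep: "net x w \<noteq> net y w \<Longrightarrow> net x w = x w \<and> net y w = y w"
    using coherent_input_step(2)[OF wd ud u(2)] .
  have dsub: "dif ?x ?y \<subseteq> dif x y" "dif x y - {w} \<subseteq> dif ?x ?y"
    using wd unfolding dif_upd by auto
  have val: "?x i = x i" if "i \<in> dif ?x ?y" for i
    using that keep unfolding dif_upd by (cases "i = w") (auto split: if_splits)
  have wn: "w \<notin> B" "w \<notin> C" "w \<in> D" "w \<noteq> z" using i(1) w z(1) by blast+
  have xo: "?x i = x i" "?y i = y i" if "i \<noteq> w" for i using that by simp_all
  show "invariant ?x ?y (P - {w}) N"
    unfolding invariant_def
  proof (intro conjI ballI allI impI)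
    show "P - {w} \<subseteq> D - B - C" "dif ?x ?y \<subseteq> insert z D" using i(1,5) dsub by blast+
    show "P - {w} \<union> B \<union> C \<subseteq> dif ?x ?y" using i(2-4) dsub(2) wn by blast
    fix v assume v: "v \<in> P - {w}"
    obtain t where t: "t \<in> P \<union> B \<union> C" "coh x t v" using i(6) v by blast
    then have "t \<noteq> w" using sink[of v] v by blast
    moreover have "v \<noteq> w" using v by blast
    ultimately have "coh ?x t v" using t(2) by (simp add: coh_def)
    then show "\<exists>u\<in>P - {w} \<union> B \<union> C. coh ?x u v" using t(1) \<open>t \<noteq> w\<close> by blast
  next
    fix v u assume v: "v \<in> dif ?x ?y - B - C - (P - {w}) - N" and u': "u \<in> dif ?x ?y - N" and uv: "(u, v) \<in> E"
    have vx: "?x v = x v" "?x u = x u" using val v u' by blast+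
    have vd: "v \<in> dif x y" "u \<in> dif x y" using v u' dsub(1) by blast+
    show "coh ?x u v"
    proof (cases "v = w")
      case True
      have ne: "net x w \<noteq> net y w" using v True unfolding dif_upd by (auto split: if_splits)
      have "coh x u w" using keep[OF ne] wd vd uv True by (intro sat_coh[of w x y]) auto
      then show ?thesis using vx True unfolding coh_def by simp
    next
      case False
      then have "coh x u v" using i(7)[of v u] v u' vd uv by blast
      then show ?thesis using vx unfolding coh_def by simp
    qed
  next
    fix c assume c: "c \<in> C - {b}"
    then have "c \<noteq> w" "p c \<noteq> w" using wn pC by blast+
    then show "coh ?x (p c) c" using i(8)[OF c] by (simp add: coh_def)
  next
    have "b \<noteq> w" "p b \<noteq> w" using wn pC bB by blast+
    then show "?x b" "\<not> lit ?x (p b) b" using i(9,10) by simp_all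
  next
    fix c u assume c: "c \<in> C" "(u, c) \<in> E" "u \<noteq> p c" "u \<noteq> z"
    have "u \<noteq> w" using other_inputs[OF c(1-3)] wn by blast
    then show "lit ?x u c" "lit ?y u c" using i(11,12) c by simp_all
  qed
qed

lemma inv_sink:
  assumes "P \<noteq> {}"
  shows "\<exists>w\<in>P. \<forall>v\<in>P. \<not> coh x w v"
  by (rule sink_exists[of P "coh x"]) (use assms no_coherent_set in auto)

lemma inv_process:
  assumes "invariant x y P N" "N \<subseteq> {z}"
  shows "\<exists>w. set w \<subseteq> P \<and> length w = card P \<and> invariant (run net w x) (run net w y) {} N"
  using assms
proof (induction "card P" arbitrary: P x y)
  case 0
  then show ?case by (intro exI[of _ "[]"]) simp
next
  case (Suc n)
  have "P \<noteq> {}" using Suc.hyps(2) by (metis card.empty nat.distinct(1))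
  then obtain w where w: "w \<in> P" "\<forall>v\<in>P. \<not> coh x w v" using inv_sink by blast
  then have I: "invariant (upd net w x) (upd net w y) (P - {w}) N" using inv_step Suc.prems by blast
  have n: "n = card (P - {w})" using Suc.hyps(2) w(1) by simp
  obtain w' where w': "set w' \<subseteq> P - {w}" "length w' = card (P - {w})"
      "invariant (run net w' (upd net w x)) (run net w' (upd net w y)) {} N"
    using Suc.hyps(1)[OF n I Suc.prems(2)] by blast
  then show ?case using w n Suc.hyps(2) by (intro exI[of _ "w # w'"]) auto
qed

text \<open>The vertex \<open>z\<close> blocks the cycle in \<open>x\<close>. If it blocks it in
  \<open>y\<close> too, both states settle to the same values on the cycle. Otherwise
  \<open>y\<close> turns freely and is restored, while \<open>x\<close> comes to rest. In both cases
  \<open>b\<close> is no longer needed as a feedback vertex.\<close>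

lemma inv_turns:
  assumes I: "invariant x y {} N" and N: "N \<subseteq> {z}" and zx: "\<not> lit x z c0"
    and zy: "z \<notin> dif x y \<or> (\<forall>c\<in>C. (z, c) \<in> E \<longrightarrow> lit y z c)"
  defines "x2 \<equiv> run net (cs @ cs) x" and "y2 \<equiv> run net (cs @ cs) y"
  shows "z \<notin> dif x y \<or> y2 = y"
    and "\<And>u v. v \<in> dif x2 y2 - (B - {b}) - N \<Longrightarrow> u \<in> dif x2 y2 - N \<Longrightarrow> (u, v) \<in> E \<Longrightarrow> coh x2 u v"
proof -
  note i = invD[OF I]
  have off: "x2 j = x j" "y2 j = y j" if "j \<notin> C" for j
    using that unfolding x2_def y2_def by (rule run_cs_other)+
  have pc0: "z \<noteq> p c0" using pC[OF z(2)] zC by blast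
  then have nok: "\<not> ok x c0" using zx z(3) unfolding ok_def by blast
  have satx: "net x2 c = x2 c" if "c \<in> C" for c
    unfolding x2_def by (rule two_turns_forced[OF z(2) nok that])
  have yc: "y c = (\<not> x c)" if "c \<in> C" for c using that i(4) by (auto simp: dif_iff)
  have ysat: "y c = lit y (p c) c" if "c \<in> C" "c \<noteq> b" for c
    using i(8)[of c] that yc[of c] yc[OF pC[of c]] by (auto simp: coh_def)
  have ybconf: "lit y (p b) b" "\<not> y b" using i(9,10) yc[OF bB(2)] yc[OF pC[OF bB(2)]] by auto
  have cohoff: "coh x2 u v"
    if "v \<in> dif x y - B - C - N" "u \<in> dif x y - N" "(u, v) \<in> E" "x2 u = x u" for u v
    using i(7)[of v u] that off[of v] by (auto simp: coh_def)
  have sub: "dif x2 y2 \<subseteq> dif x y"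
  proof
    fix j assume j: "j \<in> dif x2 y2"
    show "j \<in> dif x y"
    proof (cases "j \<in> C")
      case False
      then show ?thesis using j off unfolding dif_iff by simp
    qed (use i(4) in blast)
  qed
  have both: "(z \<notin> dif x y \<or> y2 = y) \<and>
    (\<forall>v\<in>dif x2 y2 - (B - {b}) - N. \<forall>u\<in>dif x2 y2 - N. (u, v) \<in> E \<longrightarrow> coh x2 u v)"
  proof (cases "z \<in> dif x y")
    case False
    then have "\<not> lit y z c0" using zx by (simp add: dif_iff)
    then have noky: "\<not> ok y c0" using z(3) pc0 unfolding ok_def by blast
    have saty: "net y2 c = y2 c" if "c \<in> C" for c
      unfolding y2_def by (rule two_turns_forced[OF z(2) noky that])
    have "x2 c = y2 c" if "c \<in> C" for c
    proof (rule forced_unique[OF satx saty _ z(2) _ that])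
      show "x2 i = y2 i" if h: "i \<notin> C" "\<exists>c\<in>C. (i, c) \<in> E" for i
      proof -
        obtain c where c: "c \<in> C" "(i, c) \<in> E" using h(2) by blast
        then have "i \<noteq> p c" using h(1) pC by blast
        then have "i \<notin> D" using other_inputs c by blast
        then have "i \<notin> dif x y" using i(5) False by blast
        then show ?thesis using off h(1) by (simp add: dif_iff)
      qed
      show "\<not> ok x2 c0" using ok_cong[OF z(2), of x2 x] off nok by blast
    qed
    then have C2: "dif x2 y2 \<inter> C = {}" by (auto simp: dif_iff)
    have "coh x2 u v" if h: "v \<in> dif x2 y2 - (B - {b}) - N" "u \<in> dif x2 y2 - N" "(u, v) \<in> E" for u v
    proof (rule cohoff)
      have "u \<notin> C" "v \<notin> C" using h C2 by blast+
      then show "x2 u = x u" "v \<in> dif x y - B - C - N" using off h sub bB(2) by blast+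
    qed (use h sub in blast)+
    then show ?thesis using False by blast
  next
    case True
    then have zl: "\<forall>c\<in>C. (z, c) \<in> E \<longrightarrow> lit y z c" using zy by blast
    have oky: "ok y c" if "c \<in> C" for c
      unfolding ok_def
    proof (intro allI impI)
      fix u assume "(u, c) \<in> E" "u \<noteq> p c"
      then show "lit y u c" using i(12)[OF that] zl that by (cases "u = z") auto
    qed
    have y2: "y2 = y" unfolding y2_def
      by (rule two_turns_free[OF oky ysat]) (use ybconf in auto)
    have xv: "x2 u = x u" if "u \<in> dif x2 y2" for u
      using that sub y2 by (auto simp: dif_iff)
    have "coh x2 u v" if h: "v \<in> dif x2 y2 - (B - {b}) - N" "u \<in> dif x2 y2 - N" "(u, v) \<in> E" for u v
    proof (cases "v \<in> C")
      case False
      have "v \<in> dif x y - B - C - N" using h sub False bB(2) by blast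
      then show ?thesis using cohoff[of v u] h sub xv by blast
    next
      case vC: True
      show ?thesis
      proof (cases "v = b")
        case False
        have "net y v = y v" using net_ok[OF vC] oky[OF vC] ysat[OF vC False] by simp
        then show ?thesis using sat_coh[of v x2 y u] satx[OF vC] h y2 by blast
      next
        case True
        \<comment> \<open>If \<open>b\<close> still differs, its image is True in both states, so
          all its literals are, and it has no differing input at all.\<close>
        have "net y b" using net_ok[OF bB(2)] oky[OF bB(2)] ybconf by simp
        moreover have "x2 b" using h True ybconf(2) y2 by (auto simp: dif_iff)
        then have "net x2 b" using satx[OF bB(2)] by simp
        ultimately have "lit x2 u b" "lit y u b" using netD h(3) True by blast+
        then have False using h(2) y2 by (auto simp: dif_iff)
        then show ?thesis ..
      qed
    qed
    then show ?thesis using y2 by blast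
  qed
  then show "z \<notin> dif x y \<or> y2 = y"
    and "\<And>u v. v \<in> dif x2 y2 - (B - {b}) - N \<Longrightarrow> u \<in> dif x2 y2 - N \<Longrightarrow> (u, v) \<in> E \<Longrightarrow> coh x2 u v"
    by blast+
qed

lemma cardB: "card (B - {b}) < card B"
  using bB(1) by (intro psubset_card_mono) auto

lemma finish:
  assumes I: "invariant x y P {}" and zx: "\<not> lit x z c0"
    and zy: "z \<notin> dif x y \<or> (\<forall>c\<in>C. (z, c) \<in> E \<longrightarrow> lit y z c)"
  shows "lowers (card P + 2 * length cs) (card B) x y"
proof -
  obtain w where w: "set w \<subseteq> P" "length w = card P" "invariant (run net w x) (run net w y) {} {}"
    using inv_process[OF I] by blast
  let ?x = "run net w x" and ?y = "run net w y"
  have "z \<notin> set w" using w(1) invD(1)[OF I] z(1) by blast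
  then have zz: "?x z = x z" "?y z = y z" by (simp_all add: run_other)
  then have zx': "\<not> lit ?x z c0" and zy': "z \<notin> dif ?x ?y \<or> (\<forall>c\<in>C. (z, c) \<in> E \<longrightarrow> lit ?y z c)"
    using zx zy by (simp_all add: dif_iff)
  have "acyclic_on (dif (run net (cs @ cs) ?x) (run net (cs @ cs) ?y) - (B - {b}))"
    by (rule coherent_acy) (use inv_turns(2)[OF w(3) _ zx' zy'] in blast)
  then have "lowers 0 (card B) (run net (cs @ cs) ?x) (run net (cs @ cs) ?y)"
    by (rule lowers_0[OF cardB])
  then have "lowers (2 * length cs) (card B) ?x ?y" by (rule lowers_run) simp
  then show ?thesis by (rule lowers_run) (use w(2) in simp)
qed

text \<open>The negative loop is never coherent, so \<open>z\<close> has to be merged. The loop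
  blocks it in \<open>x\<close>; in \<open>y\<close> it is blocked by \<open>u\<close>, whose value
  there survives since \<open>u\<close> is not in \<open>P\<close> and the two turns restore
  \<open>y\<close>.\<close>

lemma finish_loop:
  assumes I: "invariant x y P {z}" and zx: "\<not> lit x z c0" and zy: "\<forall>c\<in>C. (z, c) \<in> E \<longrightarrow> lit y z c"
    and loop: "(z, z) \<in> E" and xz: "x z" and yz: "\<not> y z"
    and u: "u \<notin> insert z P" "(u, z) \<in> E" "\<not> lit y u z"
  shows "lowers (card P + 2 * length cs + 1) (card B) x y"
proof -
  have q: "\<not> q z z" using no_coherent[of "{z}" "\<lambda>_. True"] loop by auto
  obtain w where w: "set w \<subseteq> P" "length w = card P" "invariant (run net w x) (run net w y) {} {z}"
    using inv_process[OF I] by blast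
  let ?x = "run net w x" and ?y = "run net w y"
  have "z \<notin> set w" "u \<notin> set w" using w(1) invD(1)[OF I] z(1) u(1) by blast+
  then have zz: "?x z = x z" "?y z = y z" "?y u = y u" by (simp_all add: run_other)
  let ?x2 = "run net (cs @ cs) ?x" and ?y2 = "run net (cs @ cs) ?y"
  have zx': "\<not> lit ?x z c0" and zy': "z \<notin> dif ?x ?y \<or> (\<forall>c\<in>C. (z, c) \<in> E \<longrightarrow> lit ?y z c)"
    using zx zy zz by simp_all
  note t = inv_turns[OF w(3) order_refl zx' zy']
  have "z \<in> dif ?x ?y" using xz yz zz by (simp add: dif_iff)
  then have y2: "?y2 = ?y" using t(1) by blast
  have "?x2 z" using run_cs_other[OF zC(1)] zz xz by simp
  then have nx: "\<not> net ?x2 z" using netD[of ?x2 z z] loop q by blast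
  have ny: "\<not> net ?y2 z" using netD[of ?y2 z u] u zz y2 by auto
  have "acyclic_on (dif ?x2 ?y2 - {z} - (B - {b}))"
    by (rule coherent_acy) (use t(2) in blast)
  then have "lowers 1 (card B) ?x2 ?y2" using merge_lowers[OF _ cardB] nx ny by blast
  then have "lowers (2 * length cs + 1) (card B) ?x ?y" by (rule lowers_run) simp
  then show ?thesis by (rule lowers_run) (use w(2) in simp)
qed

lemma inv_change:
  assumes I: "invariant x y P {}" and zd: "z \<notin> dif x y" and eq: "\<And>i. i \<noteq> z \<Longrightarrow> x' i = x i" "\<And>i. i \<noteq> z \<Longrightarrow> y' i = y i"
  shows "invariant x' y' P {z}"
proof -
  note i = invD[OF I]
  have d: "dif x' y' - {z} = dif x y"
  proof (rule set_eqI)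
    fix j show "j \<in> dif x' y' - {z} \<longleftrightarrow> j \<in> dif x y"
      using zd eq[of j] by (cases "j = z") (simp_all add: dif_iff)
  qed
  have nz: "j \<noteq> z" if "j \<in> dif x y" for j using that zd by blast
  have coheq: "coh x' u v" if "coh x u v" "u \<noteq> z" "v \<noteq> z" for u v using that eq by (simp add: coh_def)
  have pz: "p c \<noteq> z" "c \<noteq> z" if "c \<in> C" for c using that pC zC by blast+
  show ?thesis
    unfolding invariant_def
  proof (intro conjI ballI allI impI)
    show "P \<union> B \<union> C \<subseteq> dif x' y'" using i(2-4) d by blast
    show "dif x' y' \<subseteq> insert z D" using i(5) d by blast
    fix v assume v: "v \<in> P"
    then obtain u where u: "u \<in> P \<union> B \<union> C" "coh x u v" using i(6) by blast
    have "u \<noteq> z" "v \<noteq> z" using u(1) v i(2-4) zd by blast+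
    then show "\<exists>u\<in>P \<union> B \<union> C. coh x' u v" using u coheq by blast
  next
    fix v u assume h: "v \<in> dif x' y' - B - C - P - {z}" "u \<in> dif x' y' - {z}" "(u, v) \<in> E"
    then have "coh x u v" using i(7)[of v u] d by blast
    then show "coh x' u v" using coheq h by blast
  next
    fix c assume "c \<in> C - {b}"
    then show "coh x' (p c) c" using i(8) coheq pz by blast
  next
    show "x' b" "\<not> lit x' (p b) b" using i(9,10) eq pz[OF bB(2)] by simp_all
  next
    fix c u assume "c \<in> C" "(u, c) \<in> E" "u \<noteq> p c" "u \<noteq> z"
    then show "lit x' u c" "lit y' u c" using i(11,12) eq by simp_all
  qed (use i(1) in blast)
qed

lemma inv_drop: "invariant x y P {z} \<Longrightarrow> z \<notin> dif x y \<Longrightarrow> invariant x y P {}"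
  unfolding invariant_def by simp

text \<open>Processing \<open>P\<close> could destroy the input that blocks \<open>z\<close> in
  \<open>y\<close>. So, while such an input lies in \<open>P\<close>, vertices of \<open>P\<close>
  are updated before \<open>z\<close> as long as \<open>z\<close> still wants to flip in
  \<open>x\<close>. A vertex \<open>w\<close> that would stop this changes in \<open>x\<close>,
  hence keeps in \<open>y\<close> the value that blocks \<open>z\<close>; updating \<open>z\<close>
  just before \<open>w\<close> makes \<open>w\<close> the blocking input for
  \<open>finish_loop\<close>.\<close>

lemma switch_loop:
  assumes "invariant x y P {}" "z \<notin> dif x y" "(z, z) \<in> E" "\<not> x z" "net x z"
    and "\<And>c. c \<in> C \<Longrightarrow> (z, c) \<in> E \<Longrightarrow> lit x z c"
  shows "lowers (card P + 2 * length cs + 2) (card B) x y"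
  using assms
proof (induction "card P" arbitrary: P x y rule: less_induct)
  case less
  note I = less.prems(1) and zd = less.prems(2) and loop = less.prems(3) and xz = less.prems(4)
    and nx = less.prems(5) and lz = less.prems(6)
  note i = invD[OF I]
  have yz: "\<not> y z" using zd xz by (simp add: dif_iff)
  have lzy: "lit y z c" if "c \<in> C" "(z, c) \<in> E" for c using lz[OF that] zd by (simp add: dif_iff)
  have off: "\<And>i. i \<noteq> z \<Longrightarrow> upd net z x i = x i" "\<And>i. i \<noteq> z \<Longrightarrow> upd net z y i = y i" by simp_all
  have zx: "\<not> lit (upd net z x) z c0" using lz[OF z(2,3)] xz nx by simp
  show ?case
  proof (cases "net y z")
    case True
    have nd: "z \<notin> dif (upd net z x) (upd net z y)" using nx True by (simp add: dif_iff)
    have "invariant (upd net z x) (upd net z y) P {}" using inv_change[OF I zd off] nd by (rule inv_drop)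
    then have "lowers (card P + 2 * length cs) (card B) (upd net z x) (upd net z y)"
      using zx nd by (intro finish) blast+
    then show ?thesis by (rule lowers_upd) simp
  next
    case ny: False
    then obtain u where u: "(u, z) \<in> E" "\<not> lit y u z" using not_netD by blast
    have q: "\<not> q z z" using no_coherent[of "{z}" "\<lambda>_. True"] loop by auto
    then have uz: "u \<noteq> z" using u yz by blast
    have zy: "\<forall>c\<in>C. (z, c) \<in> E \<longrightarrow> lit (upd net z y) z c" using lzy ny yz by simp
    have Iz: "invariant (upd net z x) (upd net z y) P {z}" using inv_change[OF I zd off] .
    show ?thesis
    proof (cases "u \<in> P")
      case False
      have "lowers (card P + 2 * length cs + 1) (card B) (upd net z x) (upd net z y)"
        using finish_loop[OF Iz zx zy loop, of u] nx ny u uz False by simp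
      then show ?thesis by (rule lowers_upd) simp
    next
      case True
      then obtain w where w: "w \<in> P" "\<forall>v\<in>P. \<not> coh x w v" using inv_sink by blast
      have wz: "w \<noteq> z" using w(1) i(2) zd by blast
      have st: "invariant (upd net w x) (upd net w y) (P - {w}) {}" "net x w = x w \<or> net y w = y w"
        using inv_step[OF I w(1)] w(2) by blast+
      have cp: "card P = Suc (card (P - {w}))" using w(1) by (metis card_Suc_Diff1 finite)
      have zd': "z \<notin> dif (upd net w x) (upd net w y)" using zd wz by (simp add: dif_iff)
      show ?thesis
      proof (cases "net (upd net w x) z")
        case True
        have "lowers (card (P - {w}) + 2 * length cs + 2) (card B) (upd net w x) (upd net w y)"
          using less.hyps[OF _ st(1) zd' loop _ True] cp xz wz lz by simp
        then show ?thesis by (rule lowers_upd) (use cp in simp)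
      next
        case False
        then obtain t where t: "(t, z) \<in> E" "\<not> lit (upd net w x) t z" using not_netD by blast
        then have "t = w" using netD[OF nx t(1)] by (cases "t = w") simp_all
        then have wt: "(w, z) \<in> E" "net x w \<noteq> q w z" using t by simp_all
        have "lit x w z" using netD[OF nx wt(1)] .
        then have xw: "net x w \<noteq> x w" using wt(2) by simp
        then have nyw: "net y w = y w" using st(2) by blast
        have "w \<in> dif x y" using w(1) i(2) by blast
        then have yl: "\<not> lit y w z" using \<open>lit x w z\<close> by (auto simp: dif_iff)
        have ysame: "upd net z y = y" using ny yz by (intro ext) (simp add: upd_def)
        have sink: "\<not> coh (upd net z x) w v" if "v \<in> P" for v
        proof -
          have "v \<noteq> z" using that i(2) zd by blast
          then show ?thesis using w(2) that wz by (simp add: coh_def)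
        qed
        let ?x = "upd net w (upd net z x)" and ?y = "upd net w (upd net z y)"
        have I2: "invariant ?x ?y (P - {w}) {z}" using inv_step(1)[OF Iz w(1) sink order_refl] by blast
        have vals: "?x z = net x z" "?y z = net y z" "?y w = y w" using wz nyw ysame ny yz by simp_all
        have "lowers (card (P - {w}) + 2 * length cs + 1) (card B) ?x ?y"
          using finish_loop[OF I2, of w] zx zy loop vals nx ny yl wt(1) wz by simp
        then have "lowers (card P + 2 * length cs + 1) (card B) (upd net z x) (upd net z y)"
          by (rule lowers_upd) (use cp in simp)
        then show ?thesis by (rule lowers_upd) simp
      qed
    qed
  qed
qed

lemma struck_lowers:
  assumes I: "invariant x y (D - B - C) {}" and d: "dif x y = D" and zn: "net x z \<noteq> x z"
    and lz: "\<And>c. c \<in> C \<Longrightarrow> (z, c) \<in> E \<Longrightarrow> lit x z c"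
  shows "lowers (2 * card (UNIV :: 'v set)) (card B) x y"
proof -
  let ?P = "D - B - C"
  have cC: "length cs = card C" using cs(2) by (simp add: distinct_card)
  have "card ?P + card C = card (?P \<union> C)" by (rule card_Un_disjoint[symmetric]) auto
  also have "\<dots> \<le> card (UNIV - {z})" using z(1) BC zC by (intro card_mono) auto
  finally have s: "card ?P + length cs \<le> card (UNIV :: 'v set) - 1" using cC by simp
  have n: "1 \<le> card (UNIV :: 'v set)" by (simp add: Suc_leI card_gt_0_iff)
  \<comment> \<open>The cycle is traversed twice, but it is disjoint from \<open>?P\<close> and both
    avoid \<open>z\<close>.\<close>
  have bound: "card ?P + 2 * length cs + 2 \<le> 2 * card (UNIV :: 'v set)"
  proof -
    have "length cs \<le> card (UNIV :: 'v set) - 1" using s by simp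
    then show ?thesis using s n by linarith
  qed
  have zd: "z \<notin> dif x y" using d z(1) by simp
  have yz: "y z = x z" using zd by (simp add: dif_iff)
  have off: "\<And>i. i \<noteq> z \<Longrightarrow> upd net z x i = x i" "\<And>i. i \<noteq> z \<Longrightarrow> upd net z y i = y i" by simp_all
  have Iz: "invariant (upd net z x) (upd net z y) ?P {z}" using inv_change[OF I zd off] .
  have zx: "\<not> lit (upd net z x) z c0" using lz[OF z(2,3)] zn by simp
  show ?thesis
  proof (cases "net x z = net y z")
    case True
    have nd: "z \<notin> dif (upd net z x) (upd net z y)" using True by (simp add: dif_iff)
    have "lowers (card ?P + 2 * length cs) (card B) (upd net z x) (upd net z y)"
      using inv_drop[OF Iz nd] zx nd by (intro finish) blast+
    then show ?thesis by (rule lowers_upd) (use bound in simp)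
  next
    case ne: False
    then have ny: "net y z = x z" using zn by blast
    show ?thesis
    proof (cases "(z, z) \<in> E")
      case loop: True
      have q: "\<not> q z z" using no_coherent[of "{z}" "\<lambda>_. True"] loop by auto
      have "\<not> x z"
      proof
        assume "x z"
        then have "\<not> net x z" "\<not> net y z" using netD[of x z z] netD[of y z z] loop q yz by blast+
        then show False using ne by blast
      qed
      then have "lowers (card ?P + 2 * length cs + 2) (card B) x y"
        using switch_loop[OF I zd loop] zn lz by blast
      then show ?thesis by (rule lowers_mono) (rule bound)
    next
      \<comment> \<open>Without a loop \<open>z\<close> joins the difference set coherently, and as
        \<open>y\<close> keeps its value at \<open>z\<close>, the cycle still turns freely in
        \<open>y\<close>.\<close>
      case nl: False
      have dz: "dif (upd net z x) (upd net z y) = insert z D" using ne d by (simp add: dif_upd)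
      have czz: "coh (upd net z x) u z" if "u \<in> D" "(u, z) \<in> E" for u
      proof -
        have "u \<noteq> z" using that z(1) by blast
        then show ?thesis using differ_lit[OF ne that(2)] that d by (simp add: coh_def)
      qed
      have "\<forall>v\<in>dif (upd net z x) (upd net z y) - B - C - ?P - {}.
          \<forall>u\<in>dif (upd net z x) (upd net z y) - {}. (u, v) \<in> E \<longrightarrow> coh (upd net z x) u v"
      proof (intro ballI)
        fix v u assume "v \<in> dif (upd net z x) (upd net z y) - B - C - ?P - {}"
          "u \<in> dif (upd net z x) (upd net z y) - {}"
        then have "v = z" "u \<in> insert z D" unfolding dz by blast+
        then show "(u, v) \<in> E \<longrightarrow> coh (upd net z x) u v" using czz nl by blast
      qed
      then have "invariant (upd net z x) (upd net z y) ?P {}"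
        using Iz unfolding invariant_def by (elim conjE, intro conjI) assumption+
      then have "lowers (card ?P + 2 * length cs) (card B) (upd net z x) (upd net z y)"
        using zx lz ny yz by (intro finish) simp_all
      then show ?thesis by (rule lowers_upd) (use bound in simp)
    qed
  qed
qed

end

section \<open>Short synchronizing words for conjunctive nets\<close>

text \<open>Since \<open>p\<close> points to predecessors, the list takes the orbit backwards: entry
  \<open>i\<close> is \<open>(p ^^ (k - i)) b\<close> for the least period \<open>k\<close>.\<close>

lemma orbit_list:
  assumes "0 < m" "(p ^^ m) b = b"
  shows "\<exists>cs. cs \<noteq> [] \<and> distinct cs \<and> cs ! 0 = b \<and> (\<forall>i. Suc i < length cs \<longrightarrow> p (cs ! Suc i) = cs ! i) \<and>
    p b = last cs \<and> set cs = {(p ^^ i) b | i. True}"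
proof -
  define k where "k = (LEAST k. 0 < k \<and> (p ^^ k) b = b)"
  have k: "0 < k" "(p ^^ k) b = b" and least: "\<And>j. 0 < j \<Longrightarrow> (p ^^ j) b = b \<Longrightarrow> k \<le> j"
    using LeastI[of "\<lambda>k. 0 < k \<and> (p ^^ k) b = b" m] Least_le[of "\<lambda>k. 0 < k \<and> (p ^^ k) b = b"] assms
    unfolding k_def by auto
  define cs where "cs = map (\<lambda>i. (p ^^ (k - i)) b) [0..<k]"
  have len: "length cs = k" unfolding cs_def by simp
  have nth: "cs ! i = (p ^^ (k - i)) b" if "i < k" for i using that unfolding cs_def by simp
  have inj: "i = j" if "i < j" "j \<le> k" "0 < i" "(p ^^ i) b = (p ^^ j) b" for i j
  proof -
    have "(p ^^ (k - j + i)) b = (p ^^ (k - j)) ((p ^^ j) b)"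
      unfolding that(4)[symmetric] by (simp only: funpow_add comp_apply)
    also have "\<dots> = (p ^^ (k - j + j)) b" by (simp only: funpow_add comp_apply)
    also have "\<dots> = b" using that(2) k(2) by simp
    finally have "(p ^^ (k - j + i)) b = b" .
    then have "k \<le> k - j + i" using least[of "k - j + i"] that(3) by simp
    then show ?thesis using that by simp
  qed
  have dist: "distinct cs"
    unfolding cs_def distinct_map
  proof (intro conjI inj_onI)
    fix i j assume h: "i \<in> set [0..<k]" "j \<in> set [0..<k]" "(p ^^ (k - i)) b = (p ^^ (k - j)) b"
    show "i = j"
    proof (rule linorder_cases[of i j])
      assume ij: "i < j"
      then have "k - j < k - i" "0 < k - j" using h(2) by auto
      then have "k - j = k - i" by (intro inj) (use h(3) in simp_all)
      then show ?thesis using ij h(2) by simp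
    next
      assume ji: "j < i"
      then have "k - i < k - j" "0 < k - i" using h(1) by auto
      then have "k - i = k - j" by (intro inj) (use h(3) in simp_all)
      then show ?thesis using ji h(1) by simp
    qed
  qed simp
  have mod: "(p ^^ i) b = (p ^^ (i mod k)) b" for i
    using k(2) by (metis funpow_mod_eq)
  have set: "set cs = {(p ^^ i) b | i. True}"
  proof
    show "set cs \<subseteq> {(p ^^ i) b | i. True}" unfolding cs_def by auto
    show "{(p ^^ i) b | i. True} \<subseteq> set cs"
    proof
      fix v assume "v \<in> {(p ^^ i) b | i. True}"
      then obtain i where v: "v = (p ^^ (i mod k)) b" using mod by blast
      show "v \<in> set cs"
      proof (cases "i mod k = 0")
        case True
        then have "v = cs ! 0" using v k nth[of 0] by simp
        then show ?thesis using k(1) len by simp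
      next
        case False
        moreover have "i mod k < k" using k(1) by simp
        ultimately have "v = cs ! (k - i mod k)" "k - i mod k < k" using v nth[of "k - i mod k"] by simp_all
        then show ?thesis using len by simp
      qed
    qed
  qed
  have "p (cs ! Suc i) = cs ! i" if "Suc i < length cs" for i
  proof -
    have "k - i = Suc (k - Suc i)" using that len by simp
    then show ?thesis using that len nth[of i] nth[of "Suc i"] by simp
  qed
  moreover have "p b = last cs" using k(1) nth[of "k - 1"] len by (simp add: last_conv_nth flip: length_greater_0_conv)
  ultimately show ?thesis using dist set k nth[of 0] len by (intro exI[of _ cs]) auto
qed

locale sized_net = strong_and_net E q for E :: "('v::finite \<times> 'v) set" and q +
  fixes n :: nat
  assumes card_UNIV: "card (UNIV :: 'v set) = n"
begin

text \<open>Preparing costs \<open>3 * (n - k) + k\<close>, reaching a hit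
  \<open>flip_cost (n - k) + (n - k)\<close> and using it \<open>2 * n\<close>. The sum
  \<open>flip_cost (n - k) + 6 * n - 3 * k\<close> is largest at \<open>k = 1\<close>.\<close>

definition level_cost :: nat where
  "level_cost = flip_cost (n - 1) + 6 * n - 3"

lemma n_pos: "1 \<le> n"
  by (simp add: Suc_leI card_gt_0_iff flip: card_UNIV)

lemma hit_lowers:
  assumes r: "ready x y B K p" and o: "orbits B K p" and z: "z \<notin> dif x y" "c0 \<in> K" "(z, c0) \<in> E" "net x z \<noteq> x z"
  shows "lowers (2 * n) (card B) x y"
proof -
  note R = readyD[OF r]
  obtain b i where b: "b \<in> B" "c0 = (p ^^ i) b" using o z(2) unfolding orbits_def by blast
  obtain k where k: "0 < k" "(p ^^ k) b = b" using o b(1) unfolding orbits_def by blast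
  obtain cs where cs: "cs \<noteq> []" "distinct cs" "cs ! 0 = b"
     and chain: "\<forall>i. Suc i < length cs \<longrightarrow> p (cs ! Suc i) = cs ! i" "p b = last cs"
     and C: "set cs = {(p ^^ i) b | i. True}"
    using orbit_list[OF k] by blast
  have itK: "(p ^^ i) b \<in> K" for i using R(1,3) b(1) by (induction i) auto
  have CK: "set cs \<subseteq> K" unfolding C using itK by blast
  have bC: "b \<in> set cs" using cs by (metis length_greater_0_conv nth_mem)
  have CB: "B \<inter> set cs = {b}"
    using o b(1) bC unfolding orbits_def C by blast
  interpret S: struck E q B "dif x y" cs p b z c0
  proof
    show "p (cs ! Suc i) = cs ! i" if "Suc i < length cs" for i using chain that by blast
    show "(p c, c) \<in> E" if "c \<in> set cs" for c using R(4) CK that by (meson subsetD)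
    show "\<exists>j. (p ^^ j) c = e" if h: "c \<in> set cs" "e \<in> set cs" for c e
    proof -
      obtain i j where ij: "c = (p ^^ i) b" "e = (p ^^ j) b" using h unfolding C by blast
      obtain m where "(p ^^ m) c = b" using orbit_back[OF k, of i] ij by blast
      then have "(p ^^ (j + m)) c = e" using ij by (simp add: funpow_add)
      then show ?thesis by blast
    qed
    show "B \<inter> set cs = {b}" by (rule CB)
    show "B \<union> set cs \<subseteq> dif x y" using R(1,2) CK by blast
    show "c0 \<in> set cs" using b(2) unfolding C by blast
    show "u = p c" if "c \<in> set cs" "u \<in> dif x y" "(u, c) \<in> E" for c u using R(5) CK that by blast
  qed (use cs chain z in auto)
  have par: "coh x (p c) c" if h: "c \<in> set cs - {b}" for c
  proof -
    have "c \<in> K" "c \<in> dif x y" "c \<notin> B" using h CK R(2) CB by blast+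
    then obtain u where "u \<in> dif x y" "coh x u c" using R(6) by blast
    then show ?thesis using R(5)[OF \<open>c \<in> K\<close>, of u] unfolding coh_def by blast
  qed
  \<comment> \<open>All cycle vertices but \<open>b\<close> are coherent with their predecessor, so
    the one without coherent input is \<open>b\<close>.\<close>
  obtain v where v: "v \<in> set cs" "\<forall>u\<in>set cs. \<not> coh x u v" using no_coherent_set[of "set cs" x] cs(1) by auto
  have "v = b"
  proof (rule ccontr)
    assume "v \<noteq> b"
    then have "coh x (p v) v" using par v(1) by simp
    then show False using v(2) S.pC[OF v(1)] by simp
  qed
  then have "\<not> coh x (p b) b" using v(2) S.pC[OF bC] by simp
  then have nl: "\<not> lit x (p b) b" using R(4,8) b(1) CK bC unfolding coh_def by (meson subsetD)
  have litx: "lit x u c \<and> lit y u c" if h: "c \<in> set cs" "(u, c) \<in> E" "u \<noteq> p c" for c u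
  proof -
    have "u \<notin> dif x y" using R(5) h CK by blast
    then show ?thesis using R(7)[of c u] h CK by (auto simp: dif_iff)
  qed
  have "S.invariant x y (dif x y - B - set cs) {}"
    unfolding S.invariant_def
  proof (intro conjI ballI allI impI)
    show "dif x y - B - set cs \<union> B \<union> set cs \<subseteq> dif x y" using R(1,2) CK by blast
    fix v assume "v \<in> dif x y - B - set cs"
    then obtain u where "u \<in> dif x y" "coh x u v" using R(6) by blast
    then show "\<exists>u\<in>dif x y - B - set cs \<union> B \<union> set cs. coh x u v" by blast
  qed (use par nl litx R(8) b(1) in auto)
  then show ?thesis
    unfolding card_UNIV[symmetric]
  proof (rule S.struck_lowers)
    show "lit x z c" if "c \<in> set cs" "(z, c) \<in> E" for c using R(7)[of c z] that CK z(1) by blast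
  qed (use z in auto)
qed

lemma level:
  assumes acy0: "acyclic_on (dif x y - B0)" and k: "card B0 = k" "0 < k"
  shows "lowers level_cost k x y"
proof -
  have kn: "k \<le> n" using k card_mono[of UNIV B0] card_UNIV by simp
  from make_ready[OF acy0 k, unfolded card_UNIV] consider "lowers (3 * n) k x y" |
    w B K p where "length w \<le> 3 * (n - k) + k" "card B = k" "orbits B K p"
      "ready (run net w x) (run net w y) B K p" by blast
  then show ?thesis
  proof cases
    case 1
    then show ?thesis by (rule lowers_mono) (use n_pos in \<open>simp add: level_cost_def\<close>)
  next
    case (2 w B K p)
    let ?x = "run net w x" and ?y = "run net w y"
    have "B \<noteq> {}" using 2(2) k by auto
    have "B \<subseteq> dif ?x ?y" using readyD(1,2)[OF 2(4)] by blast
    then have "card (- dif ?x ?y) \<le> card (UNIV - B)" by (intro card_mono) auto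
    also have "\<dots> = n - k" using 2(2) by (simp add: card_Diff_subset card_UNIV)
    finally have c: "card (- dif ?x ?y) \<le> n - k" .
    obtain w' where w': "length w' \<le> flip_cost (card (- dif ?x ?y)) + card (- dif ?x ?y)"
       "ready (run net w' ?x) (run net w' ?y) B K p"
       "\<exists>z. z \<notin> dif (run net w' ?x) (run net w' ?y) \<and> (\<exists>c\<in>K. (z, c) \<in> E) \<and>
          net (run net w' ?x) z \<noteq> run net w' ?x z"
      using reach_hit[OF 2(4) \<open>B \<noteq> {}\<close>] unfolding hits_def by blast
    have "lowers (2 * n) k (run net w' ?x) (run net w' ?y)"
      using w'(3) hit_lowers[OF w'(2) 2(3)] 2(2) by blast
    moreover have "length w' \<le> flip_cost (n - k) + (n - k)"
      using w'(1) c flip_cost_mono[OF c] by linarith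
    ultimately have "lowers (flip_cost (n - k) + (n - k) + 2 * n) k ?x ?y"
      by (intro lowers_run[of "2 * n" k w' ?x ?y]) simp_all
    then show ?thesis
    proof (rule lowers_run)
      have "flip_cost (n - k) \<le> flip_cost (n - 1)" using k by (intro flip_cost_mono) simp
      then show "length w + (flip_cost (n - k) + (n - k) + 2 * n) \<le> level_cost"
        using 2(1) kn k(2) unfolding level_cost_def by linarith
    qed
  qed
qed

text \<open>Each level lowers the feedback number. When the difference is acyclic, a settling word
  erases it: a source of what is left would have different images but no differing input.\<close>

lemma pair_word:
  assumes "acyclic_on (dif x y - B)" "card B \<le> k"
  shows "\<exists>w. length w \<le> level_cost * k + n \<and> run net w x = run net w y"
  using assms
proof (induction k arbitrary: x y B rule: less_induct)
  case (less k)
  show ?case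
  proof (cases "card B = 0")
    case True
    then have a: "acyclic_on (dif x y)" using less.prems by simp
    obtain w where w: "set w \<subseteq> dif x y" "length w = card (dif x y)"
      and w3: "\<forall>x'. \<forall>v\<in>dif x y. net (run net w x') v = run net w x' v"
      using satisfying_word[OF a] by blast
    have sub: "dif (run net w x) (run net w y) \<subseteq> dif x y" using dif_run[OF w(1)] by blast
    have "dif (run net w x) (run net w y) = {}"
    proof (rule ccontr)
      assume "\<not> ?thesis"
      then obtain v where v: "v \<in> dif (run net w x) (run net w y)"
          "\<forall>u\<in>dif (run net w x) (run net w y). (u, v) \<notin> E"
        using acyclic_on_source[OF a sub] by blast
      then have "net (run net w x) v \<noteq> net (run net w y) v"
        using w3 sub by (metis dif_iff subsetD)
      then show False using differ_input v(2) by blast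
    qed
    then have "run net w x = run net w y" by (auto simp: dif_def)
    moreover have "length w \<le> n" unfolding w(2) card_UNIV[symmetric] by (intro card_mono) auto
    ultimately show ?thesis by (intro exI[of _ w]) simp
  next
    case False
    then have "lowers level_cost (card B) x y" using level[OF less.prems(1) refl] False by blast
    then obtain w B' where w: "length w \<le> level_cost" "card B' < card B"
        "acyclic_on (dif (run net w x) (run net w y) - B')" unfolding lowers_def by blast
    moreover have "k - 1 < k" "card B' \<le> k - 1" using w(2) less.prems(2) False by auto
    ultimately obtain w' where w': "length w' \<le> level_cost * (k - 1) + n"
        "run net w' (run net w x) = run net w' (run net w y)"
      using less.IH[of "k - 1" "run net w x" "run net w y" B'] by blast
    have "level_cost * k = level_cost * (k - 1) + level_cost"
      using less.prems(2) False by (cases k) auto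
    then show ?thesis using w(1) w' by (intro exI[of _ "w @ w'"]) (simp add: run_append)
  qed
qed

section \<open>From pairs of states to the whole image\<close>

lemma close_pair:
  fixes I :: "('v \<Rightarrow> bool) set"
  assumes "2 ^ (n - m) < card I" "m \<le> n"
  shows "\<exists>x\<in>I. \<exists>y\<in>I. x \<noteq> y \<and> card (dif x y) \<le> m"
proof -
  obtain S :: "'v set" where S: "card S = n - m"
    using obtain_subset_with_card_n[of "n - m" "UNIV :: 'v set"] card_UNIV by auto
  let ?r = "\<lambda>x. {i \<in> S. x i}"
  have "card (?r ` I) \<le> card (Pow S)" by (intro card_mono) auto
  also have "\<dots> < card I" using assms S by (simp add: card_Pow)
  finally have "\<not> inj_on ?r I" using pigeonhole by blast
  then obtain x y where xy: "x \<in> I" "y \<in> I" "?r x = ?r y" "x \<noteq> y" unfolding inj_on_def by blast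
  have "dif x y \<subseteq> - S" using xy(3) by (auto simp: dif_iff)
  then have "card (dif x y) \<le> card (UNIV - S)" by (intro card_mono) auto
  also have "\<dots> = m" using S assms(2) by (simp add: card_Diff_subset card_UNIV)
  finally show ?thesis using xy by blast
qed

lemma shrink_image:
  assumes "m \<le> n" "card (range (run net w)) \<le> 2 ^ (n - m) + t"
  shows "\<exists>w'. length w' \<le> t * (level_cost * m + n) \<and> card (range (run net (w @ w'))) \<le> 2 ^ (n - m)"
  using assms(2)
proof (induction t arbitrary: w)
  case 0
  then show ?case by (intro exI[of _ "[]"]) simp
next
  case (Suc t)
  show ?case
  proof (cases "card (range (run net w)) \<le> 2 ^ (n - m)")
    case True
    then show ?thesis by (intro exI[of _ "[]"]) simp
  next
    case False
    then obtain x y where xy: "x \<in> range (run net w)" "y \<in> range (run net w)" "x \<noteq> y" "card (dif x y) \<le> m"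
      using close_pair[of m "range (run net w)"] assms(1) by auto
    obtain u where u: "length u \<le> level_cost * m + n" "run net u x = run net u y"
      using pair_word[of x y "dif x y" m] xy(4) by (auto simp: acyclic_on_def)
    have im: "range (run net (w @ u)) = run net u ` range (run net w)"
      by (auto simp: run_append image_image)
    have "\<not> inj_on (run net u) (range (run net w))" using u(2) xy unfolding inj_on_def by blast
    then have "card (range (run net (w @ u))) < card (range (run net w))"
      unfolding im by (metis card_image_le eq_card_imp_inj_on finite le_neq_implies_less)
    then have "card (range (run net (w @ u))) \<le> 2 ^ (n - m) + t" using Suc.prems by simp
    then obtain w' where "length w' \<le> t * (level_cost * m + n)"
        "card (range (run net ((w @ u) @ w'))) \<le> 2 ^ (n - m)" using Suc.IH by blast
    then show ?thesis using u(1) by (intro exI[of _ "u @ w'"]) simp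
  qed
qed

text \<open>The second summand of the length bound is the tail over all \<open>j > m\<close> of the
  series of costs \<open>2 ^ (n - j) * (level_cost * j + n)\<close>, continued to infinity; at
  \<open>m = 0\<close> it is the whole bound.\<close>

lemma shrink_all:
  "m \<le> n \<Longrightarrow> \<exists>w. card (range (run net w)) \<le> 2 ^ (n - m) \<and>
     length w + 2 ^ (n - m) * (level_cost * (m + 2) + n) \<le> 2 ^ n * (2 * level_cost + n)"
proof (induction m)
  case 0
  have "card (range (run net [])) \<le> 2 ^ n"
  proof (rule ccontr)
    assume "\<not> ?thesis"
    then have lt: "2 ^ (n - 0) < card (range (run net []))" by simp
    obtain x y :: "'v \<Rightarrow> bool" where "x \<noteq> y" "card (dif x y) \<le> 0"
      using close_pair[OF lt le0] by blast
    then have "dif x y = {}" by simp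
    then show False using \<open>x \<noteq> y\<close> by (auto simp: dif_def)
  qed
  then show ?case by (intro exI[of _ "[]"]) (simp add: mult.commute)
next
  case (Suc m)
  let ?T = "2 ^ (n - Suc m) :: nat"
  have T: "2 ^ (n - m) = 2 * ?T" using Suc.prems by (simp add: Suc_diff_Suc flip: power_Suc)
  obtain w where w: "card (range (run net w)) \<le> 2 * ?T"
     "length w + 2 * ?T * (level_cost * (m + 2) + n) \<le> 2 ^ n * (2 * level_cost + n)"
    using Suc unfolding T by auto
  then obtain w' where w': "length w' \<le> ?T * (level_cost * Suc m + n)"
      "card (range (run net (w @ w'))) \<le> ?T"
    using shrink_image[of "Suc m" w ?T] Suc.prems by auto
  have "?T * (level_cost * Suc m + n) + ?T * (level_cost * (Suc m + 2) + n)
      = 2 * ?T * (level_cost * (m + 2) + n)" by (simp add: algebra_simps)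
  then show ?case using w w' by (intro exI[of _ "w @ w'"]) simp
qed

theorem synchronizing_net:
  "\<exists>w. length w \<le> 2 ^ n * (2 * level_cost + n) \<and> (\<forall>x y. run net w x = run net w y)"
proof -
  obtain w where w: "card (range (run net w)) \<le> 1" "length w \<le> 2 ^ n * (2 * level_cost + n)"
    using shrink_all[of n] by auto
  have "run net w x = run net w y" for x y
    using w(1) by (metis card_le_Suc0_iff_eq finite One_nat_def rangeI)
  then show ?thesis using w(2) by blast
qed

end

section \<open>Arithmetic of the length bound\<close>

lemma flip_cost_golden:
  fixes \<phi> :: real
  assumes "\<phi>\<^sup>2 = \<phi> + 1" "\<phi> \<ge> 3 / 2"
  shows "real (flip_cost k) + 2 \<le> 2 * \<phi> ^ k"
proof (induction k rule: flip_cost.induct)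
  case (3 k)
  have "2 * \<phi> ^ Suc (Suc k) = 2 * \<phi> ^ k * \<phi>\<^sup>2" by (simp add: power2_eq_square)
  also have "\<dots> = 2 * \<phi> ^ Suc k + 2 * \<phi> ^ k" unfolding assms(1) by (simp add: algebra_simps)
  finally show ?case using 3 by simp
qed (use assms in auto)

text \<open>1.618 is a lower bound for the golden ratio \<phi>, and 12.18 is
  \<open>10 * 1.618 - 4\<close>. The growth factor covers the increment 13 inductively only from
  \<open>m = 2\<close> on, so 0 and 1 are checked separately.\<close>

lemma linear_le_power:
  "13 * real m + 3 \<le> 12.18 * (1.618 :: real) ^ m"
proof -
  have "13 * real (m + 2) + 3 \<le> 12.18 * (1.618 :: real) ^ (m + 2)" for m
    by (induction m) (simp_all add: power2_eq_square)
  moreover have "m = 0 \<or> m = 1 \<or> (\<exists>j. m = j + 2)" by presburger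
  ultimately show ?thesis by fastforce
qed

lemma word_length_bound:
  assumes "1 \<le> n"
  shows "real (2 ^ n * (2 * (flip_cost (n - 1) + 6 * n - 3) + n)) \<le> 10 * (sqrt 5 + 1) ^ n"
proof -
  define \<phi> :: real where "\<phi> = (sqrt 5 + 1) / 2"
  have sq: "\<phi>\<^sup>2 = \<phi> + 1"
    unfolding \<phi>_def by (simp add: power2_eq_square field_simps)
  have "2.236 \<le> sqrt (5 :: real)" by (rule real_le_rsqrt) (simp add: power2_eq_square)
  then have lb: "1.618 \<le> \<phi>" unfolding \<phi>_def by simp
  obtain m where m: "n = Suc m" using assms by (cases n) auto
  \<comment> \<open>With \<open>n = m + 1\<close> and \<open>flip_cost m\<close> at most
    \<open>2 * \<phi> ^ m - 2\<close>, the bracket in the claim is at most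
    \<open>4 * \<phi> ^ m + 13 * m + 3\<close>.\<close>
  have "13 * real m + 3 \<le> 12.18 * \<phi> ^ m"
    using linear_le_power[of m] power_mono[OF lb, of m]
    by (smt (verit, best) mult_left_mono zero_le_divide_iff zero_le_numeral zero_le_power)
  also have "\<dots> \<le> (10 * \<phi> - 4) * \<phi> ^ m" using lb by (intro mult_right_mono) auto
  finally have "13 * real m + 3 + 4 * \<phi> ^ m \<le> 10 * \<phi> ^ n" unfolding m by (simp add: algebra_simps)
  moreover have "real (flip_cost m) + 2 \<le> 2 * \<phi> ^ m" by (rule flip_cost_golden) (use sq lb in auto)
  ultimately have "2 * (real (flip_cost m) + 6 * real n - 3) + real n \<le> 10 * \<phi> ^ n" unfolding m by simp
  then have "2 ^ n * (2 * (real (flip_cost m) + 6 * real n - 3) + real n) \<le> 2 ^ n * (10 * \<phi> ^ n)"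
    by (intro mult_left_mono) simp_all
  also have "\<dots> = 10 * (sqrt 5 + 1) ^ n"
    unfolding \<phi>_def by (simp add: power_divide)
  finally have "2 ^ n * (2 * (real (flip_cost m) + 6 * real n - 3) + real n) \<le> 10 * (sqrt 5 + 1) ^ n" .
  moreover have "real (2 ^ n * (2 * (flip_cost (n - 1) + 6 * n - 3) + n))
      = 2 ^ n * (2 * (real (flip_cost m) + 6 * real n - 3) + real n)"
    unfolding m by (simp add: of_nat_diff)
  ultimately show ?thesis by simp
qed

section \<open>Signed digraphs\<close>

text \<open>Going back along coherent inputs must close a cycle. Each arc sign on it is the product
  of the labels of its two ends, so every label enters the sign of the cycle twice.\<close>

lemma positive_cycle:
  fixes G :: "('v::finite) sdigraph" and t :: "'v \<Rightarrow> bool"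
  assumes D: "D \<noteq> {}" and coh: "\<And>v. v \<in> D \<Longrightarrow> \<exists>u\<in>D. (u, v, if t u = t v then 1 else -1) \<in> G"
  shows "has_positive_cycle G"
proof -
  obtain p where p: "\<And>v. v \<in> D \<Longrightarrow> p v \<in> D \<and> (p v, v, if t (p v) = t v then 1 else -1) \<in> G"
    using coh by metis
  obtain a where a: "a \<in> D" using D by blast
  have pD: "(p ^^ i) a \<in> D" for i using a p by (induction i) auto
  have "\<not> inj (\<lambda>i. (p ^^ i) a)"
    using finite_imageD[of "\<lambda>i. (p ^^ i) a" UNIV] by auto
  then obtain i j where ij: "i < j" "(p ^^ i) a = (p ^^ j) a"
    unfolding inj_def by (metis linorder_neqE_nat)
  define b where "b = (p ^^ i) a"
  have b: "(p ^^ (j - i)) b = b"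
  proof -
    have "(p ^^ (j - i)) b = (p ^^ (j - i + i)) a" unfolding b_def by (simp only: funpow_add comp_apply)
    then show ?thesis using ij unfolding b_def by simp
  qed
  have j: "0 < j - i" using ij by simp
  obtain cs where cs: "cs \<noteq> []" "distinct cs"
    and chain: "\<And>i. Suc i < length cs \<Longrightarrow> p (cs ! Suc i) = cs ! i" "p b = last cs" "cs ! 0 = b"
    and set: "set cs = {(p ^^ i) b | i. True}"
    using orbit_list[OF j b] by metis
  have csD: "c \<in> D" if "c \<in> set cs" for c
  proof -
    obtain l where "c = (p ^^ l) b" using \<open>c \<in> set cs\<close> unfolding set by blast
    then have "c = (p ^^ (l + i)) a" unfolding b_def by (simp only: funpow_add comp_apply)
    then show ?thesis using pD by simp
  qed
  let ?k = "length cs" and ?vs = "\<lambda>l. cs ! l" and ?\<sigma> = "\<lambda>l. if t (cs ! l) then 1 else -1 :: int"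
  let ?ss = "\<lambda>l. ?\<sigma> l * ?\<sigma> ((l + 1) mod ?k)"
  have k: "1 \<le> ?k" using cs(1) by (simp add: Suc_leI)
  have arc: "(?vs l, ?vs ((l + 1) mod ?k), ?ss l) \<in> G" if l: "l < ?k" for l
  proof -
    let ?v = "?vs ((l + 1) mod ?k)"
    have v: "?v \<in> D" using cs(1) by (intro csD nth_mem) simp
    have "p ?v = cs ! l"
    proof (cases "Suc l = ?k")
      case True
      then have "cs ! l = last cs" using cs(1) by (metis diff_Suc_1 last_conv_nth)
      then show ?thesis using True chain by simp
    next
      case False
      then show ?thesis using l chain(1)[of l] by simp
    qed
    then show ?thesis using p[OF v] by (auto split: if_splits)
  qed
  have rot: "(\<Prod>l<?k. ?\<sigma> ((l + 1) mod ?k)) = (\<Prod>l<?k. ?\<sigma> l)"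
  proof -
    obtain m where m: "?k = Suc m" using k by (cases ?k) auto
    have "(\<Prod>l<Suc m. ?\<sigma> ((l + 1) mod Suc m)) = (\<Prod>l<m. ?\<sigma> (Suc l)) * ?\<sigma> 0"
      by (simp add: lessThan_Suc mult.commute)
    also have "\<dots> = (\<Prod>l<Suc m. ?\<sigma> l)"
      by (simp only: prod.lessThan_Suc_shift mult.commute)
    finally show ?thesis unfolding m .
  qed
  have "(\<Prod>l<?k. ?ss l) = (\<Prod>l<?k. ?\<sigma> l) * (\<Prod>l<?k. ?\<sigma> l)"
    unfolding prod.distrib rot ..
  also have "\<dots> = (\<Prod>l<?k. ?\<sigma> l * ?\<sigma> l)" by (rule prod.distrib[symmetric])
  also have "\<dots> = 1" by (intro prod.neutral) simp
  finally have one: "(\<Prod>l<?k. ?ss l) = 1" .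
  have "is_cycle_in G ?k ?vs ?ss"
    unfolding is_cycle_in_def using k arc cs(2) by (auto simp: inj_on_def nth_eq_iff_index_eq)
  then show ?thesis unfolding has_positive_cycle_def using one by blast
qed

text \<open>Otherwise a labelling for which every vertex has a coherent input could be grown along arcs
  from a vertex with inputs of both signs to the whole vertex set.\<close>

lemma unique_sign:
  fixes G :: "('v::finite) sdigraph"
  assumes sd: "signed_digraph G" and sc: "strongly_connected G" and np: "\<not> has_positive_cycle G"
  shows "\<not> ((j, i, 1) \<in> G \<and> (j, i, -1) \<in> G)"
proof
  assume h: "(j, i, 1) \<in> G \<and> (j, i, -1) \<in> G"
  let ?ok = "\<lambda>A (t :: 'v \<Rightarrow> bool). i \<in> A \<and> (\<forall>v\<in>A - {i}. \<exists>u\<in>A. (u, v, if t u = t v then 1 else -1 :: int) \<in> G)"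
  have "\<exists>A t. ?ok A t \<and> l \<le> card A" if "l \<le> card (UNIV :: 'v set)" for l
    using that
  proof (induction l)
    case 0
    show ?case by (intro exI[of _ "{i}"]) simp
  next
    case (Suc l)
    then obtain A t where A: "?ok A t" "l \<le> card A" by auto
    show ?case
    proof (cases "A = UNIV")
      case True
      then show ?thesis using A Suc.prems by (intro exI[of _ A] exI[of _ t]) simp
    next
      case False
      then obtain b where "b \<in> - A" by blast
      moreover have "(i, b) \<in> (underlying G)\<^sup>*" using sc unfolding strongly_connected_def by blast
      ultimately obtain u v where uv: "(u, v) \<in> underlying G" "u \<in> A" "v \<notin> A"
        using crossing_arc[of i b "underlying G" "- A"] A(1) by auto
      then obtain s where s: "(u, v, s) \<in> G" "s = 1 \<or> s = -1"
        using sd unfolding underlying_def signed_digraph_def by auto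
      let ?t = "t(v := (t u = (s = 1)))"
      have "\<exists>u\<in>insert v A. (u, w, if ?t u = ?t w then 1 else -1) \<in> G" if w: "w \<in> insert v A - {i}" for w
      proof (cases "w = v")
        case True
        have "(u, w, if ?t u = ?t w then 1 else -1) \<in> G" using s uv True by (cases "t u") auto
        then show ?thesis using uv by blast
      next
        case False
        then obtain u' where "u' \<in> A" "(u', w, if t u' = t w then 1 else -1) \<in> G" using w A(1) by blast
        then have "(u', w, if ?t u' = ?t w then 1 else -1) \<in> G" using uv(3) False by auto
        then show ?thesis using \<open>u' \<in> A\<close> by blast
      qed
      moreover have "Suc l \<le> card (insert v A)" using A(2) uv(3) by simp
      ultimately show ?thesis using A(1) by (intro exI[of _ "insert v A"] exI[of _ ?t]) blast
    qed
  qed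
  then obtain A t where A: "?ok A t" "card (UNIV :: 'v set) \<le> card A" by blast
  then have "A = UNIV" by (metis card_seteq finite subset_UNIV)
  \<comment> \<open>The vertex \<open>i\<close> itself is supported by \<open>j\<close>, whatever
    the labels are, since arcs of both signs are available.\<close>
  then have "\<exists>u\<in>UNIV. (u, v, if t u = t v then 1 else -1) \<in> G" for v
    using A(1) h by (cases "v = i") auto
  then show False using positive_cycle[of UNIV t G] np by blast
qed

text \<open>In the coordinates \<open>x i = a i\<close>, an arc keeps its sign iff its ends are of
  the same type, conjunctive or disjunctive.\<close>

lemma and_or_net_switch:
  assumes ao: "and_or_net G f" and sd: "signed_digraph G"
    and us: "\<And>i j. \<not> ((j, i, 1) \<in> G \<and> (j, i, -1) \<in> G)"
  obtains a where "\<And>x i. (f x i = a i) \<longleftrightarrow>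
    (\<forall>j. (j, i) \<in> underlying G \<longrightarrow> (x j = a j) = ((a j = a i) = ((j, i, 1) \<in> G)))"
proof -
  \<comment> \<open>A vertex with a single input satisfies both formulas and counts as
    conjunctive.\<close>
  define a where "a i \<longleftrightarrow> (\<forall>x. f x i \<longleftrightarrow> (\<forall>j. ((j, i, 1) \<in> G \<longrightarrow> x j) \<and> ((j, i, -1) \<in> G \<longrightarrow> \<not> x j)))" for i
  have u: "(j, i) \<in> underlying G \<longleftrightarrow> (j, i, 1) \<in> G \<or> (j, i, -1) \<in> G" for i j
    using sd unfolding underlying_def signed_digraph_def by auto
  have 1: "f x i \<longleftrightarrow> (\<forall>j. ((j, i, 1) \<in> G \<longrightarrow> x j) \<and> ((j, i, -1) \<in> G \<longrightarrow> \<not> x j))" if "a i" for x i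
    using that unfolding a_def by blast
  have 2: "\<not> f x i \<longleftrightarrow> (\<forall>j. ((j, i, 1) \<in> G \<longrightarrow> \<not> x j) \<and> ((j, i, -1) \<in> G \<longrightarrow> x j))" if "\<not> a i" for x i
  proof -
    have "a i \<or> (\<forall>x. \<not> f x i \<longleftrightarrow> (\<forall>j. ((j, i, 1) \<in> G \<longrightarrow> \<not> x j) \<and> ((j, i, -1) \<in> G \<longrightarrow> x j)))"
      using ao unfolding a_def and_or_net_def by (elim conjE allE)
    then show ?thesis using that by simp
  qed
  have "(f x i = a i) \<longleftrightarrow>
    (\<forall>j. (j, i) \<in> underlying G \<longrightarrow> (x j = a j) = ((a j = a i) = ((j, i, 1) \<in> G)))" for x i
  proof (cases "a i")
    case True
    have "(((j, i, 1) \<in> G \<longrightarrow> x j) \<and> ((j, i, -1) \<in> G \<longrightarrow> \<not> x j)) \<longleftrightarrow>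
      ((j, i) \<in> underlying G \<longrightarrow> (x j = a j) = ((a j = a i) = ((j, i, 1) \<in> G)))" for j
      using us[of j i] True unfolding u by (cases "a j") auto
    then show ?thesis using 1[OF True, of x] True by simp
  next
    case False
    have "(((j, i, 1) \<in> G \<longrightarrow> \<not> x j) \<and> ((j, i, -1) \<in> G \<longrightarrow> x j)) \<longleftrightarrow>
      ((j, i) \<in> underlying G \<longrightarrow> (x j = a j) = ((a j = a i) = ((j, i, 1) \<in> G)))" for j
      using us[of j i] False unfolding u by (cases "a j") auto
    then show ?thesis using 2[OF False, of x] False by simp
  qed
  then show ?thesis by (rule that)
qed

text \<open>The unique predecessor map generates all ancestors of a vertex, so by strong
  connectivity its orbit from any vertex is a cycle through everything.\<close>

lemma in_degree_one_cycle:
  fixes G :: "('v::finite) sdigraph"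
  assumes sd: "signed_digraph G" and sc: "strongly_connected G"
    and us: "\<And>i j. \<not> ((j, i, 1) \<in> G \<and> (j, i, -1) \<in> G)"
    and inp: "\<And>v. \<exists>u. (u, v) \<in> underlying G"
    and one: "\<And>u w v. (u, v) \<in> underlying G \<Longrightarrow> (w, v) \<in> underlying G \<Longrightarrow> u = w"
  shows "is_cycle_graph G"
proof -
  obtain p where p: "\<And>v. (p v, v) \<in> underlying G" using inp by metis
  have pu: "u = p v" if "(u, v) \<in> underlying G" for u v using one[OF that p] .
  have reach: "\<exists>i. u = (p ^^ i) v" if "(u, v) \<in> (underlying G)\<^sup>*" for u v
    using that
  proof (induction rule: converse_rtrancl_induct)
    case base
    show ?case by (intro exI[of _ 0]) simp
  next
    case (step y z)
    then obtain i where "z = (p ^^ i) v" by blast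
    then have "y = (p ^^ Suc i) v" using pu[OF step(1)] by simp
    then show ?case by blast
  qed
  obtain b :: 'v where True by blast
  obtain m where "b = (p ^^ m) (p b)"
    using reach[of b "p b"] sc unfolding strongly_connected_def by blast
  then have m: "(p ^^ Suc m) b = b" by (simp add: funpow_swap1)
  obtain cs where cs: "cs \<noteq> []" "distinct cs"
    and chain: "\<And>i. Suc i < length cs \<Longrightarrow> p (cs ! Suc i) = cs ! i" "p b = last cs" "cs ! 0 = b"
    and set: "set cs = {(p ^^ i) b | i. True}"
    using orbit_list[OF zero_less_Suc m] by metis
  have all: "set cs = UNIV"
    using reach[of _ b] sc unfolding strongly_connected_def set by blast
  let ?k = "length cs"
  define s where "s v = (if (p v, v, 1) \<in> G then 1 else -1 :: int)" for v
  have G: "(u, v, r) \<in> G \<longleftrightarrow> u = p v \<and> r = s v" for u v r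
  proof
    assume h: "(u, v, r) \<in> G"
    then have "u = p v" "r = 1 \<or> r = -1"
      using pu[of u v] sd unfolding underlying_def signed_digraph_def by auto
    then show "u = p v \<and> r = s v" using h us[of "p v" v] unfolding s_def by auto
  next
    assume h: "u = p v \<and> r = s v"
    obtain r' where "(p v, v, r') \<in> G" using p[of v] unfolding underlying_def by blast
    then show "(u, v, r) \<in> G" using h sd unfolding s_def signed_digraph_def by auto
  qed
  have k: "1 \<le> ?k" using cs(1) by (simp add: Suc_leI)
  have pred: "p (cs ! ((l + 1) mod ?k)) = cs ! l" if l: "l < ?k" for l
  proof (cases "Suc l = ?k")
    case True
    then have "cs ! l = last cs" using cs(1) by (metis diff_Suc_1 last_conv_nth)
    then show ?thesis using True chain by simp
  next
    case False
    then show ?thesis using l chain(1)[of l] by simp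
  qed
  have surj: "\<exists>l<?k. v = cs ! ((l + 1) mod ?k)" for v
  proof -
    have "v \<in> set cs" using all by simp
    then obtain l where l: "l < ?k" "v = cs ! l" by (metis in_set_conv_nth)
    show ?thesis
    proof (cases l)
      case 0
      then show ?thesis using l k by (intro exI[of _ "?k - 1"]) simp
    next
      case (Suc m)
      then show ?thesis using l by (intro exI[of _ m]) simp
    qed
  qed
  let ?ss = "\<lambda>l. s (cs ! ((l + 1) mod ?k))"
  have "is_cycle_in G ?k (\<lambda>l. cs ! l) ?ss"
    unfolding is_cycle_in_def using k pred cs(2) by (auto simp: inj_on_def nth_eq_iff_index_eq G)
  moreover have "(\<lambda>l. cs ! l) ` {..<?k} = UNIV"
    using all by (simp add: lessThan_atLeast0 nth_image)
  moreover have "G = {(cs ! l, cs ! ((l + 1) mod ?k), ?ss l) | l. l < ?k}" (is "_ = ?R")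
  proof (rule set_eqI)
    fix e :: "'v \<times> 'v \<times> int"
    obtain u v r where e: "e = (u, v, r)" by (cases e)
    show "e \<in> G \<longleftrightarrow> e \<in> ?R"
    proof
      assume "e \<in> G"
      then have h: "u = p v" "r = s v" using G e by auto
      obtain l where "l < ?k" "v = cs ! ((l + 1) mod ?k)" using surj by blast
      then show "e \<in> ?R" using h e pred by auto
    next
      assume "e \<in> ?R"
      then show "e \<in> G" using e pred G by auto
    qed
  qed
  ultimately show ?thesis unfolding is_cycle_graph_def by blast
qed

section \<open>Networks on a cycle\<close>

lemma cycle_graph_predecessor:
  assumes "is_cycle_graph G"
  obtains p s where "\<And>u v r. (u, v, r) \<in> G \<longleftrightarrow> u = p v \<and> r = s v"
proof -
  obtain k :: nat and vs ss where k: "1 \<le> k" "inj_on vs {..<k}" and surj: "vs ` {..<k} = UNIV"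
    and G: "G = {(vs t, vs ((t + 1) mod k), ss t) | t. t < k}"
    using assms unfolding is_cycle_graph_def is_cycle_in_def by blast
  have ex: "\<exists>!t. t < k \<and> vs ((t + 1) mod k) = v" for v
  proof -
    obtain l where l: "l < k" "vs l = v" using surj by (metis UNIV_I imageE lessThan_iff)
    have "\<exists>t<k. (t + 1) mod k = l"
    proof (cases l)
      case 0
      then show ?thesis using k by (intro exI[of _ "k - 1"]) simp
    next
      case (Suc m)
      then show ?thesis using l by (intro exI[of _ m]) simp
    qed
    then obtain t where t: "t < k" "(t + 1) mod k = l" by blast
    have "t' = t" if t': "t' < k" "vs ((t' + 1) mod k) = v" for t'
    proof -
      have "(t' + 1) mod k = l"
        using inj_onD[OF k(2), of "(t' + 1) mod k" l] t' l k(1) by simp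
      then show ?thesis using t t'(1) by (auto simp: mod_Suc split: if_splits)
    qed
    then show ?thesis using t l by blast
  qed
  define T where "T v = (THE t. t < k \<and> vs ((t + 1) mod k) = v)" for v
  have T: "T v < k \<and> vs ((T v + 1) mod k) = v" for v unfolding T_def by (rule theI'[OF ex])
  have Tu: "T v = t" if "t < k" "vs ((t + 1) mod k) = v" for t v using ex T that by blast
  have "(u, v, r) \<in> G \<longleftrightarrow> u = vs (T v) \<and> r = ss (T v)" for u v r
  proof
    assume "(u, v, r) \<in> G"
    then obtain t where "t < k" "u = vs t" "v = vs ((t + 1) mod k)" "r = ss t" unfolding G by blast
    then show "u = vs (T v) \<and> r = ss (T v)" using Tu[of t v] by simp
  next
    assume h: "u = vs (T v) \<and> r = ss (T v)"
    have "(vs (T v), vs ((T v + 1) mod k), ss (T v)) \<in> G" unfolding G using T by blast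
    then show "(u, v, r) \<in> G" using h T by simp
  qed
  then show ?thesis by (rule that[of "\<lambda>v. vs (T v)" "\<lambda>v. ss (T v)"])
qed

lemma interaction_step:
  assumes "bn_on G f" "f (x(j := True)) i \<noteq> f (x(j := False)) i"
  shows "\<exists>s. (j, i, s) \<in> G"
proof -
  let ?x = "x(j := False)"
  have "(\<not> f ?x i \<and> f (?x(j := True)) i) \<or> (f ?x i \<and> \<not> f (?x(j := True)) i)" using assms(2) by auto
  then have "(j, i, 1) \<in> interaction_graph f \<or> (j, i, -1) \<in> interaction_graph f"
    unfolding interaction_graph_def by (auto intro!: exI[of _ ?x])
  then show ?thesis using assms(1) unfolding bn_on_def by blast
qed

lemma depends_on_inputs:
  fixes x y :: "'v::finite \<Rightarrow> bool"
  assumes "bn_on G f" "\<And>j s. (j, i, s) \<in> G \<Longrightarrow> x j = y j"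
  shows "f x i = f y i"
proof -
  have "f (\<lambda>v. if v \<in> A then y v else x v) i = f x i" for A :: "'v set"
    using finite[of A]
  proof induction
    case (insert j A)
    let ?z = "\<lambda>v. if v \<in> A then y v else x v"
    have e: "(\<lambda>v. if v \<in> insert j A then y v else x v) = ?z(j := y j)" by (rule ext) simp
    have "f (?z(j := y j)) i = f ?z i"
    proof (cases "y j = ?z j")
      case True
      then have "?z(j := y j) = ?z" by (simp add: fun_upd_idem)
      then show ?thesis by simp
    next
      case False
      then have "x j \<noteq> y j" "?z(j := \<not> y j) = ?z" by (auto simp: fun_upd_idem_iff split: if_splits)
      then have "f (?z(j := True)) i = f (?z(j := False)) i"
        using interaction_step[OF assms(1), of ?z j i] assms(2) by blast
      then show ?thesis using \<open>?z(j := \<not> y j) = ?z\<close> by (cases "y j") auto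
    qed
    then show ?case using insert.IH e by simp
  qed simp
  from this[of UNIV] show ?thesis by simp
qed

lemma cycle_not_synchronizing:
  fixes G :: "('v::finite) sdigraph"
  assumes c: "is_cycle_graph G" and f: "bn_on G f"
  shows "\<not> synchronizing f"
proof -
  obtain p s where G: "\<And>u v r. (u, v, r) \<in> G \<longleftrightarrow> u = p v \<and> r = s v"
    using cycle_graph_predecessor[OF c] by blast
  let ?N = "\<lambda>x v. \<not> x v"
  \<comment> \<open>Component \<open>i\<close> depends on \<open>p i\<close> alone, and does depend
    on it, so complementing the state complements the image.\<close>
  have anti: "f (?N x) i = (\<not> f x i)" for x i
  proof -
    let ?j = "p i"
    have "(?j, i, s i) \<in> interaction_graph f" using G f unfolding bn_on_def by blast
    then obtain z where z: "\<not> z ?j" "f z i \<noteq> f (z(?j := True)) i"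
      unfolding interaction_graph_def by auto
    have d: "f x i = f y i" if "x ?j = y ?j" for x y
      using depends_on_inputs[OF f, of i x y] that by (simp add: G)
    show ?thesis
    proof (cases "x ?j")
      case True
      then have "f x i = f (z(?j := True)) i" "f (?N x) i = f z i" using z(1) by (intro d, simp)+
      then show ?thesis using z(2) by blast
    next
      case False
      then have "f x i = f z i" "f (?N x) i = f (z(?j := True)) i" using z(1) by (intro d, simp)+
      then show ?thesis using z(2) by blast
    qed
  qed
  have upd: "upd f i (?N x) = ?N (upd f i x)" for i x
    unfolding upd_def using anti by (auto simp: fun_eq_iff)
  have run: "run f w (?N x) = ?N (run f w x)" for w x
    by (induction w arbitrary: x) (simp_all add: upd)
  show ?thesis
  proof
    assume "synchronizing f"
    then obtain w c where "\<And>x. run f w x = c"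
      unfolding synchronizing_def synchronizing_word_def by blast
    then have "?N c = c" using run[of w] by metis
    then show False by (metis)
  qed
qed

text \<open>This makes the alternatives exclusive: if a cycle carried no and-or-net, the second
  would hold for it vacuously.\<close>

lemma cycle_has_net:
  assumes c: "is_cycle_graph G" and sd: "signed_digraph G"
  shows "\<exists>f. and_or_net G f"
proof -
  obtain p s where G: "\<And>u v r. (u, v, r) \<in> G \<longleftrightarrow> u = p v \<and> r = s v"
    using cycle_graph_predecessor[OF c] by blast
  have s: "s v = 1 \<or> s v = -1" for v
    using sd G[of "p v" v "s v"] unfolding signed_digraph_def by auto
  define f where "f x i \<longleftrightarrow> x (p i) = (s i = 1)" for x i
  have "interaction_graph f = G"
  proof (rule set_eqI)
    fix e :: "'a \<times> 'a \<times> int"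
    obtain j i r where e: "e = (j, i, r)" by (cases e)
    show "e \<in> interaction_graph f \<longleftrightarrow> e \<in> G"
      unfolding e G interaction_graph_def f_def using s[of i]
      by (auto split: if_splits intro!: exI[of _ "\<lambda>_. False"])
  qed
  then have "bn_on G f" unfolding bn_on_def .
  moreover have "f x i \<longleftrightarrow> (\<forall>j. ((j, i, 1) \<in> G \<longrightarrow> x j) \<and> ((j, i, -1) \<in> G \<longrightarrow> \<not> x j))" for x i
    unfolding G f_def using s[of i] by auto
  ultimately have "and_or_net G f" unfolding and_or_net_def by (intro conjI allI disjI1) simp_all
  then show ?thesis by blast
qed

lemma noncycle_synchronizing:
  fixes G :: "('v::finite) sdigraph"
  assumes sd: "signed_digraph G" and sc: "strongly_connected G" and np: "\<not> has_positive_cycle G"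
    and nc: "\<not> is_cycle_graph G" and ao: "and_or_net G f"
  shows "\<exists>w. synchronizing_word f w \<and> real (length w) \<le> 10 * (sqrt 5 + 1) ^ card (UNIV :: 'v set)"
proof (cases "\<forall>v. \<exists>u. (u, v) \<in> underlying G")
  case False
  let ?n = "card (UNIV :: 'v set)"
  from False obtain v where v: "\<And>u. (u, v) \<notin> underlying G" by blast
  \<comment> \<open>In a strongly connected digraph a vertex without inputs is the only vertex, and
    a single update then synchronizes.\<close>
  have "u = v" for u
    using sc v by (metis rtranclE strongly_connected_def)
  have "f x v = f y v" for x y
    using ao depends_on_inputs[of G f v x y] v unfolding and_or_net_def underlying_def by blast
  then have "upd f v x u = upd f v y u" for x y u
    using \<open>\<And>u. u = v\<close>[of u] by simp
  then have "upd f v x = upd f v y" for x y by (rule ext)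
  then have "synchronizing_word f [v]"
    unfolding synchronizing_word_def run.simps by (intro exI[of _ "upd f v (\<lambda>_. False)"] allI)
  moreover have "real (length [v]) \<le> 10 * (sqrt 5 + 1) ^ ?n"
  proof -
    have "1 \<le> (sqrt 5 + 1) ^ ?n" by (rule one_le_power) simp
    moreover have "real (length [v]) = 1" by simp
    ultimately show ?thesis by linarith
  qed
  ultimately show ?thesis by blast
next
  case True
  note us = unique_sign[OF sd sc np]
  obtain a where a: "\<And>x i. (f x i = a i) \<longleftrightarrow>
      (\<forall>j. (j, i) \<in> underlying G \<longrightarrow> (x j = a j) = ((a j = a i) = ((j, i, 1) \<in> G)))"
    using and_or_net_switch[OF ao sd us] by blast
  let ?E = "underlying G" and ?q = "\<lambda>j i. (a j = a i) = ((j, i, 1) \<in> G)" and ?n = "card (UNIV :: 'v set)"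
  have u: "(j, i) \<in> ?E \<longleftrightarrow> (j, i, 1) \<in> G \<or> (j, i, -1) \<in> G" for i j
    using sd unfolding underlying_def signed_digraph_def by auto
  interpret sized_net ?E ?q ?n
  proof
    fix D :: "'v set" and t :: "'v \<Rightarrow> bool"
    assume D: "D \<noteq> {}"
    show "\<exists>v\<in>D. \<forall>u\<in>D. (u, v) \<in> ?E \<longrightarrow> (t u = ?q u v) \<noteq> t v"
    proof (rule ccontr)
      assume c: "\<not> ?thesis"
      \<comment> \<open>Undoing the switch turns coherence in the conjunctive net into coherence of
        signed arcs of \<open>G\<close> for the labels \<open>t u = a u\<close>.\<close>
      have "\<exists>u\<in>D. (u, v, if (t u = a u) = (t v = a v) then 1 else -1) \<in> G" if v: "v \<in> D" for v
      proof -
        obtain u where h: "u \<in> D" "(u, v) \<in> ?E" "(t u = ?q u v) = t v" using c v by blast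
        have "(u, v, if (t u = a u) = (t v = a v) then 1 else -1) \<in> G"
        proof (cases "(u, v, 1) \<in> G")
          case True
          then have "(t u = a u) = (t v = a v)" using h(3) by auto
          then show ?thesis using True by simp
        next
          case False
          then have ne: "(t u = a u) \<noteq> (t v = a v)" using h(3) by auto
          show ?thesis unfolding if_not_P[OF ne] using False h(2) u by blast
        qed
        then show ?thesis using h(1) by blast
      qed
      then show False using positive_cycle[OF D, of "\<lambda>v. t v = a v" G] np by blast
    qed
  next
    show "(i, j) \<in> ?E\<^sup>*" for i j using sc unfolding strongly_connected_def by blast
    show "\<exists>j. (j, i) \<in> ?E" for i using True by blast
    show "\<exists>v a b. a \<noteq> b \<and> (a, v) \<in> ?E \<and> (b, v) \<in> ?E"
      using in_degree_one_cycle[OF sd sc us] True nc by blast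
    show "?n = ?n" ..
  qed
  let ?\<phi> = "\<lambda>x i. x i = a i"
  have step: "?\<phi> (upd f i x) = upd net i (?\<phi> x)" for i x
    unfolding upd_def net_def using a[of x i] by (auto simp: fun_eq_iff)
  have run: "?\<phi> (run f w x) = run net w (?\<phi> x)" for w x
    by (induction w arbitrary: x) (simp_all add: step)
  obtain w where w: "length w \<le> 2 ^ ?n * (2 * level_cost + ?n)" "\<And>x y. run net w x = run net w y"
    using synchronizing_net by blast
  have "run f w x = run f w y" for x y
  proof
    fix i
    have "?\<phi> (run f w x) = ?\<phi> (run f w y)" by (rule trans[OF run trans[OF w(2) run[symmetric]]])
    from fun_cong[OF this, of i] show "run f w x i = run f w y i" by auto
  qed
  then have "synchronizing_word f w" unfolding synchronizing_word_def by blast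
  moreover have "real (length w) \<le> 10 * (sqrt 5 + 1) ^ ?n"
    using w(1) word_length_bound[OF n_pos] unfolding level_cost_def by linarith
  ultimately show ?thesis by blast
qed

theorem theorem1:
  fixes G :: "('v::finite) sdigraph"
  assumes "signed_digraph G"
    and "strongly_connected G"
    and "\<not> has_positive_cycle G"
  defines "P \<equiv> is_cycle_graph G \<and> (\<forall>f. bn_on G f \<longrightarrow> \<not> synchronizing f)"
    and "Q \<equiv> (\<forall>f. and_or_net G f \<longrightarrow>
              (\<exists>w. synchronizing_word f w \<and>
                   real (length w) \<le> 10 * (sqrt 5 + 1) ^ card (UNIV :: 'v set)))"
  shows "(P \<or> Q) \<and> \<not> (P \<and> Q)"
proof (cases "is_cycle_graph G")
  case True
  then have P using cycle_not_synchronizing unfolding P_def by blast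
  moreover obtain f where f: "and_or_net G f" using cycle_has_net[OF True assms(1)] by blast
  moreover have "\<not> Q"
  proof
    assume Q
    then have "synchronizing f" using f unfolding Q_def synchronizing_def by blast
    then show False using f cycle_not_synchronizing[OF True] unfolding and_or_net_def by blast
  qed
  ultimately show ?thesis by blast
next
  case False
  then have Q using noncycle_synchronizing[OF assms(1-3)] unfolding Q_def by blast
  then show ?thesis using False unfolding P_def by blast
qed

end
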